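(* Let $d\in\mathbb{N}$ with $d\geq 2$. Then there is a monotone increasing function $\beta_{d}\colon [1,\infty)\to [1,\infty)$, with $2\lfloor t\rfloor-1\leq\beta_{d}(t)\leq 2^{8dt}$ for all $t\in [1,\infty)$, such that the following holds: For any $H\in\mathbb{N}$, $L\geq 1$ and any $L$-bilipschitz mapping \[f\colon \big(\mathbb{R}^{d-1}\times\{\tfrac{1}{2},H+\tfrac{1}{2}\}\big)\cup\big(\mathbb{Z}^{d-1}\times\{1,\ldots,H\}\big)\to\mathbb{R}^{d}\] satisfying $f(x)=x$ for all $x\in \mathbb{R}^{d-1}\times \{\frac{1}{2},H+\frac{1}{2}\}$ and $f(\mathbb{Z}^{d-1}\times\{1,\ldots,H\})\subseteq \mathbb{R}^{d-1}\times[\frac{1}{2},H+\frac{1}{2}]$, there is a bilipschitz extension $F\colon\mathbb{R}^{d}\to \mathbb{R}^{d}$ of $f$ with \[\operatorname{bilip}(F)\leq 2^{38}d^{9/2}L^{9}H^{2+\frac{3}{d-1}}\cdot \beta_{d}\big(2^{42}d^{9/2}L^{10}H^{3+\frac{3}{d-1}}\big)^{3^{d-1}}.\] Moreover, $\beta_d$ may be taken to be the function $\beta_d$ defined in the context below.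
   Context: For injective $f$, $\operatorname{bilip}(f)=\max\{\operatorname{Lip}(f),\operatorname{Lip}(f^{-1})\}$ with respect to the Euclidean norm; $L$-bilipschitz means $\operatorname{bilip}\le L$. Definition of $\beta_d$: let $\mathcal{F}_d$ be the collection of all monotone increasing functions $\psi\colon[1,\infty)\to[1,\infty)$ such that the following holds: for every $S\in\mathbb{N}$, with $Q:=(-\frac12,\dots,-\frac12)+[0,S]^{d-1}\subseteq\mathbb{R}^{d-1}$, and every permutation $\sigma\colon\mathbb{Z}^{d-1}\to\mathbb{Z}^{d-1}$ such that for each $z\in\mathbb{Z}^{d-1}$ the restriction of $\sigma$ to $\mathbb{Z}^{d-1}\cap(Q+Sz)$ is a permutation of $\mathbb{Z}^{d-1}\cap(Q+Sz)$, there is a $\psi(S)$-bilipschitz mapping $\Upsilon\colon\mathbb{R}^d\to\mathbb{R}^d$ with $\Upsilon(x)=x$ for all $x\in\mathbb{R}^{d-1}\times(\mathbb{R}\setminus(-\frac12,\frac12))$ and $\Upsilon(x,0)=(\sigma(x),0)$ for all $x\in\mathbb{Z}^{d-1}$. Then $\beta_d$ is the pointwise infimum of $\mathcal{F}_d$. *)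

theory Defs
  imports "HOL-Analysis.Analysis"
begin

text \<open>R^(d-1) is modelled as real^'m (CARD('m) = d-1), R^d as (real^'m) \<times> real
  with the (Euclidean) product norm; the last coordinate is the d-th one.\<close>

definition bilipschitz_on :: "real \<Rightarrow> 'a::metric_space set \<Rightarrow> ('a \<Rightarrow> 'b::metric_space) \<Rightarrow> bool" where
  "bilipschitz_on L X f \<longleftrightarrow> inj_on f X \<and> L-lipschitz_on X f \<and> L-lipschitz_on (f ` X) (inv_into X f)"

definition int_lattice :: "(real^'m) set" where
  "int_lattice = {x. \<forall>i. x $ i \<in> \<int>}"

definition block :: "nat \<Rightarrow> real^'m \<Rightarrow> (real^'m) set" where
  "block S z = {x. \<forall>i. real S * z $ i - 1/2 \<le> x $ i \<and> x $ i \<le> real S * z $ i + real S - 1/2}"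

definition block_perm :: "nat \<Rightarrow> (real^'m \<Rightarrow> real^'m) \<Rightarrow> bool" where
  "block_perm S \<sigma> \<longleftrightarrow> bij_betw \<sigma> int_lattice int_lattice \<and>
     (\<forall>z\<in>int_lattice. bij_betw \<sigma> (int_lattice \<inter> block S z) (int_lattice \<inter> block S z))"

definition admissible :: "'m::finite itself \<Rightarrow> (real \<Rightarrow> real) \<Rightarrow> bool" where
  "admissible _ \<psi> \<longleftrightarrow> mono_on {1..} \<psi> \<and> \<psi> ` {1..} \<subseteq> {1..} \<and>
     (\<forall>S::nat. S \<ge> 1 \<longrightarrow> (\<forall>\<sigma> :: real^'m \<Rightarrow> real^'m. block_perm S \<sigma> \<longrightarrow>
        (\<exists>\<Upsilon> :: (real^'m) \<times> real \<Rightarrow> (real^'m) \<times> real.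
           bilipschitz_on (\<psi> (real S)) UNIV \<Upsilon> \<and>
           (\<forall>x. \<bar>snd x\<bar> \<ge> 1/2 \<longrightarrow> \<Upsilon> x = x) \<and>
           (\<forall>x\<in>int_lattice. \<Upsilon> (x, 0) = (\<sigma> x, 0)))))"

definition beta :: "'m::finite itself \<Rightarrow> real \<Rightarrow> real" where
  "beta T t = Inf ((\<lambda>\<psi>. \<psi> t) ` {\<psi>. admissible T \<psi>})"

end

theory Submission
  imports Defs
begin

text \<open>For the extension, flatten the source points and the target points: a bilipschitz map of the slab,
  equal to the identity outside it, moves either point set onto sites of a fine lattice in the middle layer,
  the source points onto even sites and the target points onto odd sites. As \<open>f\<close> has bounded
  displacement, the correspondence between the two sets of sites is bounded, hence it is a product of
  \<open>3^(d-1)\<close> block permutations, each of which swaps the pairs that start in one residue class of cubes.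

  For the upper bound on \<open>beta\<close>, Hall's theorem routes a block permutation through \<open>2 (d-1)\<close> stages of
  permutations of lines, odd-even transposition sort performs each stage in \<open>S\<close> rounds of disjoint
  adjacent swaps, and a half turn cut off at an ellipsoid realizes a swap with constant \<open>16\<close>.
  The lower bound is metric for \<open>d \<ge> 3\<close>; for \<open>d = 2\<close> it rests on two paths in a strip having to cross.\<close>

section \<open>Bilipschitz maps\<close>

text \<open>The power of \<open>H\<close> has its origin in columns. Points above one small
  horizontal cell are told apart by their height level only, and with levels of thickness
  \<open>1 / (2 * L)\<close> there are about \<open>2 * L * H\<close> of them. Each level gets its
  own site in the cell, so a cell needs \<open>N\<close> sites per direction with
  \<open>N ^ (d-1)\<close> at least \<open>2 * L * H + 1\<close>. The spacing is then of order
  \<open>1 / (L * d * N)\<close>, flattening costs \<open>4 * H / \<delta>\<close>, and it is paid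
  twice, for the source and for the target.

  The displacement of \<open>f\<close> is bounded because \<open>f\<close> is Lipschitz and fixes
  the plane point below each lattice point, which is at distance at most \<open>H\<close>.

  The parities answer an obstacle: a partial matching between overlapping sets of sites would have
  to be completed to a permutation along chains that may be infinite. Between disjoint sets,
  exchanging the two partners of every pair is already an involution, and the exchanges made for
  different residue classes do not disturb one another.\<close>

lemma bilipschitz_on_iff:
  "bilipschitz_on L X f \<longleftrightarrow>
     0 \<le> L \<and> (\<forall>x\<in>X. \<forall>y\<in>X. dist (f x) (f y) \<le> L * dist x y \<and> dist x y \<le> L * dist (f x) (f y))"
    (is "_ \<longleftrightarrow> ?R")
proof
  assume B: "bilipschitz_on L X f"
  then have inj: "inj_on f X" and l1: "L-lipschitz_on X f" and l2: "L-lipschitz_on (f ` X) (inv_into X f)"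
    by (auto simp: bilipschitz_on_def)
  show ?R
    using lipschitz_onD[OF l1] lipschitz_onD[OF l2] lipschitz_on_nonneg[OF l1] inj
    by (metis image_eqI inv_into_f_f)
next
  assume R: ?R
  have inj: "inj_on f X"
    using R by (intro inj_onI) (metis dist_eq_0_iff dist_le_zero_iff mult_zero_right)
  then show "bilipschitz_on L X f"
    using R unfolding bilipschitz_on_def
    by (auto intro!: lipschitz_onI simp: inv_into_f_f)
qed

lemma bilipschitz_on_nonneg: "bilipschitz_on L X f \<Longrightarrow> 0 \<le> L"
  by (simp add: bilipschitz_on_iff)

lemma bilipschitz_on_upper:
  "bilipschitz_on L X f \<Longrightarrow> x \<in> X \<Longrightarrow> y \<in> X \<Longrightarrow> dist (f x) (f y) \<le> L * dist x y"
  by (simp add: bilipschitz_on_iff)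

lemma bilipschitz_on_lower:
  "bilipschitz_on L X f \<Longrightarrow> x \<in> X \<Longrightarrow> y \<in> X \<Longrightarrow> dist x y \<le> L * dist (f x) (f y)"
  by (simp add: bilipschitz_on_iff)

lemma bilipschitz_on_mono:
  fixes f :: "'a::metric_space \<Rightarrow> 'b::metric_space"
  assumes "bilipschitz_on L X f" "L \<le> M"
  shows "bilipschitz_on M X f"
proof -
  have "L * dist u v \<le> M * dist u v" for u v :: 'a
    using assms(2) by (simp add: mult_right_mono)
  moreover have "L * dist u v \<le> M * dist u v" for u v :: 'b
    using assms(2) by (simp add: mult_right_mono)
  ultimately show ?thesis
    using assms unfolding bilipschitz_on_iff by (meson order_trans)
qed

lemma bilipschitz_on_compose:
  assumes f: "bilipschitz_on L UNIV f" and g: "bilipschitz_on M UNIV g"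
  shows "bilipschitz_on (L * M) UNIV (f \<circ> g)"
  unfolding bilipschitz_on_iff
proof (intro conjI ballI)
  have nn: "0 \<le> L" "0 \<le> M" using f g by (auto simp: bilipschitz_on_nonneg)
  then show "0 \<le> L * M" by simp
  fix x y
  have "dist (f (g x)) (f (g y)) \<le> L * dist (g x) (g y)"
    by (rule bilipschitz_on_upper[OF f]) auto
  also have "\<dots> \<le> L * (M * dist x y)"
    by (rule mult_left_mono[OF bilipschitz_on_upper[OF g]]) (auto simp: nn)
  finally show "dist ((f \<circ> g) x) ((f \<circ> g) y) \<le> L * M * dist x y" by (simp add: mult.assoc)
  have "dist x y \<le> M * dist (g x) (g y)"
    by (rule bilipschitz_on_lower[OF g]) auto
  also have "\<dots> \<le> M * (L * dist (f (g x)) (f (g y)))"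
    by (rule mult_left_mono[OF bilipschitz_on_lower[OF f]]) (auto simp: nn)
  finally show "dist x y \<le> L * M * dist ((f \<circ> g) x) ((f \<circ> g) y)" by (simp add: mult_ac)
qed

lemma bilipschitz_on_inv:
  assumes "bij f" "bilipschitz_on L UNIV f"
  shows "bilipschitz_on L UNIV (inv f)"
  using assms unfolding bilipschitz_on_iff
  by (metis UNIV_I bij_inv_eq_iff)

lemma bilipschitz_on_inverseI:
  assumes "\<And>x. g (f x) = x" "L-lipschitz_on UNIV f" "L-lipschitz_on UNIV g"
  shows "bilipschitz_on L UNIV f"
  unfolding bilipschitz_on_iff
  using assms by (metis UNIV_I lipschitz_onD lipschitz_on_nonneg)

lemma bilipschitz_on_id: "bilipschitz_on 1 UNIV (\<lambda>x. x)"
  by (simp add: bilipschitz_on_iff)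

text \<open>For points in two different supports, connectedness of the segment between them yields
  a point on it that both maps fix.\<close>
lemma glue_lipschitz:
  fixes U :: "'i \<Rightarrow> 'a::real_normed_vector set" and g :: "'i \<Rightarrow> 'a \<Rightarrow> 'a"
  assumes op: "\<And>i. i \<in> I \<Longrightarrow> open (U i)"
    and disj: "\<And>i j. i \<in> I \<Longrightarrow> j \<in> I \<Longrightarrow> i \<noteq> j \<Longrightarrow> U i \<inter> U j = {}"
    and lip: "\<And>i. i \<in> I \<Longrightarrow> L-lipschitz_on UNIV (g i)"
    and fix_out: "\<And>i x. i \<in> I \<Longrightarrow> x \<notin> U i \<Longrightarrow> g i x = x"
    and L: "1 \<le> L"
    and f_in: "\<And>i x. i \<in> I \<Longrightarrow> x \<in> U i \<Longrightarrow> f x = g i x"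
    and f_out: "\<And>x. x \<notin> (\<Union>i\<in>I. U i) \<Longrightarrow> f x = x"
  shows "L-lipschitz_on UNIV f"
proof (rule lipschitz_onI)
  have lipD: "dist (g i x) (g i y) \<le> L * dist x y" if "i \<in> I" for i x y
    using lipschitz_onD[OF lip[OF that]] by simp
  have one: "dist (f x) (f y) \<le> L * dist x y" if "i \<in> I" "x \<in> U i" "y \<notin> (\<Union>j\<in>I. U j)" for i x y
    using lipD[OF that(1), of x y] f_in[OF that(1,2)] f_out[OF that(3)] fix_out[of i y] that by auto
  fix x y
  consider "x \<notin> (\<Union>j\<in>I. U j)" "y \<notin> (\<Union>j\<in>I. U j)"
    | i where "i \<in> I" "x \<in> U i" "y \<notin> (\<Union>j\<in>I. U j)"
    | i where "i \<in> I" "y \<in> U i" "x \<notin> (\<Union>j\<in>I. U j)"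
    | i where "i \<in> I" "y \<in> U i" "x \<in> U i"
    | i j where "i \<in> I" "j \<in> I" "i \<noteq> j" "x \<in> U i" "y \<in> U j"
    by blast
  then show "dist (f x) (f y) \<le> L * dist x y"
  proof cases
    case 1
    then show ?thesis using f_out L mult_right_mono[OF L zero_le_dist[of x y]] by simp
  next
    case 2 then show ?thesis by (rule one)
  next
    case 3
    then show ?thesis using one[of i y x] by (simp add: dist_commute)
  next
    case 4
    then show ?thesis using lipD[of i x y] f_in by simp
  next
    case 5
    have "\<not> closed_segment x y \<subseteq> U i \<union> U j"
    proof
      assume sub: "closed_segment x y \<subseteq> U i \<union> U j"
      have "U i \<inter> closed_segment x y = {} \<or> U j \<inter> closed_segment x y = {}"
        by (rule connectedD[OF connected_segment(1)[of x y]]) (use op 5 disj[OF 5(1-3)] sub in auto)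
      then show False using 5 by auto
    qed
    then obtain p where p: "p \<in> closed_segment x y" "p \<notin> U i" "p \<notin> U j" by auto
    have "dist (f x) (f y) \<le> dist (g i x) (g i p) + dist (g j p) (g j y)"
      using fix_out p 5 f_in dist_triangle[of "g i x" "g j y" p] by simp
    also have "\<dots> \<le> L * dist x p + L * dist p y"
      using lipD 5 by (intro add_mono) auto
    also have "\<dots> = L * dist x y"
    proof -
      obtain u where u: "0 \<le> u" "u \<le> 1" "p = (1 - u) *\<^sub>R x + u *\<^sub>R y"
        using p(1) by (auto simp: in_segment)
      have "x - p = u *\<^sub>R (x - y)" "p - y = (1 - u) *\<^sub>R (x - y)"
        by (simp_all add: u(3) algebra_simps)
      then have "dist x p = u * dist x y" "dist p y = (1 - u) * dist x y"
        using u by (simp_all add: dist_norm)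
      then have "dist x p + dist p y = dist x y" by (simp add: algebra_simps)
      then show ?thesis by (metis distrib_left)
    qed
    finally show ?thesis .
  qed
qed (use L in simp)

text \<open>By injectivity no point of \<open>U\<close> can land on a fixed point outside
  \<open>U\<close>, which is already its own image.\<close>

lemma image_eq_if_fixes_complement:
  assumes "bij g" "\<And>x. x \<notin> U \<Longrightarrow> g x = x"
  shows "g x \<in> U \<longleftrightarrow> x \<in> U"
  by (metis assms bij_is_inj inj_eq)

text \<open>The inverses of the \<open>g i\<close> have the same supports and the same Lipschitz
  constant, so they glue as well; the two glued maps are mutually inverse because each
  \<open>g i\<close> preserves its support.\<close>

lemma glue_bilipschitz:
  fixes U :: "'i \<Rightarrow> 'a::real_normed_vector set" and g :: "'i \<Rightarrow> 'a \<Rightarrow> 'a"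
  assumes op: "\<And>i. i \<in> I \<Longrightarrow> open (U i)"
    and disj: "\<And>i j. i \<in> I \<Longrightarrow> j \<in> I \<Longrightarrow> i \<noteq> j \<Longrightarrow> U i \<inter> U j = {}"
    and lip: "\<And>i. i \<in> I \<Longrightarrow> bilipschitz_on L UNIV (g i)"
    and bij: "\<And>i. i \<in> I \<Longrightarrow> bij (g i)"
    and fix_out: "\<And>i x. i \<in> I \<Longrightarrow> x \<notin> U i \<Longrightarrow> g i x = x"
    and L: "1 \<le> L"
  obtains f where "bilipschitz_on L UNIV f" "bij f"
    "\<And>i x. i \<in> I \<Longrightarrow> x \<in> U i \<Longrightarrow> f x = g i x"
    "\<And>x. x \<notin> (\<Union>i\<in>I. U i) \<Longrightarrow> f x = x"
proof -
  \<comment> \<open>The choice of the index is unambiguous, the supports being disjoint.\<close>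
  define glue where "glue h x = (if x \<in> (\<Union>i\<in>I. U i) then h (SOME i. i \<in> I \<and> x \<in> U i) x else x)"
    for h :: "'i \<Rightarrow> 'a \<Rightarrow> 'a" and x
  have glue_in: "glue h x = h i x" if "i \<in> I" "x \<in> U i" for h i x
  proof -
    have "(SOME i. i \<in> I \<and> x \<in> U i) = i"
      by (rule some_equality) (use that disj in blast)+
    then show ?thesis using that by (auto simp: glue_def)
  qed
  have glue_out: "glue h x = x" if "x \<notin> (\<Union>i\<in>I. U i)" for h x
    using that by (simp add: glue_def)
  have invU: "inv (g i) x = x" if "i \<in> I" "x \<notin> U i" for i x
    using fix_out[OF that] bij[OF that(1)] by (metis bij_inv_eq_iff)
  have gU: "g i x \<in> U i \<longleftrightarrow> x \<in> U i" if "i \<in> I" for i x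
    using image_eq_if_fixes_complement[OF bij fix_out] that by blast
  have giU: "inv (g i) x \<in> U i \<longleftrightarrow> x \<in> U i" if "i \<in> I" for i x
    using image_eq_if_fixes_complement[OF bij_imp_bij_inv[OF bij] invU] that by blast
  have lip1: "L-lipschitz_on UNIV (glue g)"
  proof (rule glue_lipschitz[where U=U and g=g and I=I])
    show "L-lipschitz_on UNIV (g i)" if "i \<in> I" for i
      using lip[OF that] by (simp add: bilipschitz_on_def)
  qed (use op disj fix_out L glue_in glue_out in auto)
  have lip2: "L-lipschitz_on UNIV (glue (\<lambda>i. inv (g i)))"
  proof (rule glue_lipschitz[where U=U and g="\<lambda>i. inv (g i)" and I=I])
    show "L-lipschitz_on UNIV (inv (g i))" if "i \<in> I" for i
      using bilipschitz_on_inv[OF bij lip, OF that that] by (simp add: bilipschitz_on_def)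
  qed (use op disj invU L glue_in glue_out in auto)
  have l: "glue (\<lambda>i. inv (g i)) (glue g x) = x" for x
    by (cases "x \<in> (\<Union>i\<in>I. U i)") (auto simp: glue_in glue_out gU bij bij_is_inj inv_f_f)
  have r: "glue g (glue (\<lambda>i. inv (g i)) x) = x" for x
    by (cases "x \<in> (\<Union>i\<in>I. U i)") (auto simp: glue_in glue_out giU bij bij_is_surj surj_f_inv_f)
  show ?thesis
  proof
    show "bilipschitz_on L UNIV (glue g)" by (rule bilipschitz_on_inverseI[OF l lip1 lip2])
    show "bij (glue g)" by (rule o_bij[of "glue (\<lambda>i. inv (g i))"]) (auto simp: l r)
  qed (use glue_in glue_out in auto)
qed

text \<open>A perturbation of slope 1/2 changes distances by a factor between 1/2 and 3/2. A
  preimage of \<open>z\<close> is a fixed point of the contraction sending \<open>x\<close> to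
  \<open>z - g x\<close>.\<close>

lemma perturbed_identity:
  fixes g :: "'a::banach \<Rightarrow> 'a"
  assumes g: "(1/2)-lipschitz_on UNIV g"
  shows "bij (\<lambda>x. x + g x)" "bilipschitz_on 2 UNIV (\<lambda>x. x + g x)"
proof -
  have gD: "norm (g x - g y) \<le> norm (x - y) / 2" for x y
    using lipschitz_onD[OF g, of x y] by (simp add: dist_norm)
  have up: "norm ((x + g x) - (y + g y)) \<le> 2 * norm (x - y)" for x y
  proof -
    have "norm ((x + g x) - (y + g y)) = norm ((x - y) + (g x - g y))" by (simp add: algebra_simps)
    then show ?thesis
      using gD[of x y] norm_triangle_ineq[of "x - y" "g x - g y"] norm_ge_zero[of "x - y"] by linarith
  qed
  have lo: "norm (x - y) \<le> 2 * norm ((x + g x) - (y + g y))" for x y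
  proof -
    have "norm (x - y) = norm (((x + g x) - (y + g y)) - (g x - g y))" by (simp add: algebra_simps)
    then show ?thesis
      using gD[of x y] norm_triangle_ineq4[of "(x + g x) - (y + g y)" "g x - g y"] by linarith
  qed
  show "bilipschitz_on 2 UNIV (\<lambda>x. x + g x)"
    using up lo by (simp add: bilipschitz_on_iff dist_norm)
  have "\<exists>x. x + g x = z" for z
  proof -
    have "\<exists>!x. x \<in> UNIV \<and> (z - g x) = x"
      by (rule Banach_fix[of UNIV "1/2"])
        (use gD in \<open>auto simp: complete_UNIV dist_norm norm_minus_commute\<close>)
    then obtain x where "z - g x = x" by blast
    then have "x + g x = z" by (metis diff_add_cancel)
    then show ?thesis ..
  qed
  moreover have "inj (\<lambda>x. x + g x)"
  proof (rule injI)
    fix x y assume "x + g x = y + g y"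
    then show "x = y" using lo[of x y] by simp
  qed
  ultimately show "bij (\<lambda>x. x + g x)"
    unfolding bij_def surj_def by (metis (no_types))
qed

text \<open>Each point is pushed by a cone-shaped bump on the ball of radius \<rho> around it.
  Displacements of at most \<open>\<rho> / 2\<close> give the bump slope at most 1/2, and the
  separation makes the balls disjoint, so gluing keeps the constant 2 however many points
  move.\<close>

lemma move_separated_points:
  fixes P :: "'a::banach set"
  assumes rho: "0 < \<rho>"
    and sep: "\<And>x y. x \<in> P \<Longrightarrow> y \<in> P \<Longrightarrow> x \<noteq> y \<Longrightarrow> 2 * \<rho> \<le> dist x y"
    and close: "\<And>x. x \<in> P \<Longrightarrow> dist (g x) x \<le> \<rho> / 2"
  obtains f where "bilipschitz_on 2 UNIV f" "bij f" "\<And>x. x \<in> P \<Longrightarrow> f x = g x"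
    "\<And>x. (\<And>p. p \<in> P \<Longrightarrow> \<rho> \<le> dist p x) \<Longrightarrow> f x = x"
proof -
  define b where "b p x = (max 0 (1 - dist p x / \<rho>)) *\<^sub>R (g p - p)" for p x
  have lip: "(1/2)-lipschitz_on UNIV (b p)" if "p \<in> P" for p
  proof (rule lipschitz_onI)
    fix x y
    have "\<bar>max 0 (1 - dist p x / \<rho>) - max 0 (1 - dist p y / \<rho>)\<bar> \<le> \<bar>dist p x / \<rho> - dist p y / \<rho>\<bar>"
      by auto
    also have "\<dots> = \<bar>dist p x - dist p y\<bar> / \<rho>"
      using rho by (simp flip: diff_divide_distrib)
    also have "\<dots> \<le> dist x y / \<rho>"
      using rho abs_dist_diff_le[of x p y] by (simp add: dist_commute divide_right_mono)
    finally have *: "\<bar>max 0 (1 - dist p x / \<rho>) - max 0 (1 - dist p y / \<rho>)\<bar> \<le> dist x y / \<rho>" .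
    have "dist (b p x) (b p y)
        = \<bar>max 0 (1 - dist p x / \<rho>) - max 0 (1 - dist p y / \<rho>)\<bar> * norm (g p - p)"
      by (simp add: b_def dist_norm flip: scaleR_diff_left)
    also have "\<dots> \<le> dist x y / \<rho> * (\<rho> / 2)"
      using * close[OF that] by (intro mult_mono) (auto simp: dist_norm rho less_imp_le)
    finally show "dist (b p x) (b p y) \<le> 1/2 * dist x y" using rho by simp
  qed simp
  have disj: "ball p \<rho> \<inter> ball q \<rho> = {}" if "p \<in> P" "q \<in> P" "p \<noteq> q" for p q
  proof -
    have False if "dist p x < \<rho>" "dist q x < \<rho>" for x
      using sep[OF \<open>p \<in> P\<close> \<open>q \<in> P\<close> \<open>p \<noteq> q\<close>] dist_triangle2[of p q x] that by simp
    then show ?thesis by auto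
  qed
  have out: "x + b p x = x" if "x \<notin> ball p \<rho>" for p x
    using that rho by (simp add: b_def)
  obtain f where f: "bilipschitz_on 2 UNIV f" "bij f"
      "\<And>p x. p \<in> P \<Longrightarrow> x \<in> ball p \<rho> \<Longrightarrow> f x = x + b p x"
      "\<And>x. x \<notin> (\<Union>p\<in>P. ball p \<rho>) \<Longrightarrow> f x = x"
    by (rule glue_bilipschitz[of P "\<lambda>p. ball p \<rho>" 2 "\<lambda>p x. x + b p x"])
       (use disj perturbed_identity[OF lip] out in auto)
  show ?thesis
  proof
    show "f x = g x" if "x \<in> P" for x
      using f(3)[OF that] rho by (simp add: b_def)
    show "f x = x" if "\<And>p. p \<in> P \<Longrightarrow> \<rho> \<le> dist p x" for x
      using that by (intro f(4)) (auto simp: not_less)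
  qed (use f in auto)
qed

section \<open>Odd-even transposition sort\<close>

primrec compose_upto :: "(nat \<Rightarrow> 'a \<Rightarrow> 'a) \<Rightarrow> nat \<Rightarrow> 'a \<Rightarrow> 'a" where
  "compose_upto \<tau> 0 = id"
| "compose_upto \<tau> (Suc n) = \<tau> n \<circ> compose_upto \<tau> n"

text \<open>Round \<open>t\<close> compares the positions \<open>i - 1\<close> and \<open>i\<close>
  with \<open>t + i\<close> even. The step permutes positions, not values, so that updating the
  array \<open>y\<close> is composition with the step.\<close>

definition oet_step :: "nat \<Rightarrow> nat \<Rightarrow> (nat \<Rightarrow> nat) \<Rightarrow> nat \<Rightarrow> nat" where
  "oet_step n t y i =
     (if even (t + i) \<and> 0 < i \<and> i < n \<and> y i < y (i - 1) then i - 1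
      else if odd (t + i) \<and> Suc i < n \<and> y (Suc i) < y i then Suc i else i)"

primrec oet_array :: "nat \<Rightarrow> (nat \<Rightarrow> nat) \<Rightarrow> nat \<Rightarrow> nat \<Rightarrow> nat" where
  "oet_array n \<pi> 0 = \<pi>"
| "oet_array n \<pi> (Suc t) = oet_array n \<pi> t \<circ> oet_step n t (oet_array n \<pi> t)"

lemma oet_step_involution: "oet_step n t y (oet_step n t y i) = i"
  by (auto simp: oet_step_def)

lemma oet_step_adjacent:
  "oet_step n t y i = i \<or> oet_step n t y i = Suc i \<or> i = Suc (oet_step n t y i)"
  by (auto simp: oet_step_def)

lemma oet_step_outside: "n \<le> i \<Longrightarrow> oet_step n t y i = i"
  by (auto simp: oet_step_def)

lemma oet_step_permutes: "oet_step n t y permutes {..<n}"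
proof -
  have "bij (oet_step n t y)"
    by (rule o_bij[of "oet_step n t y"]) (auto simp: oet_step_involution)
  then show ?thesis
    using oet_step_outside by (simp add: permutes_def bij_iff)
qed

lemma oet_array_permutes: "\<pi> permutes {..<n} \<Longrightarrow> oet_array n \<pi> t permutes {..<n}"
  by (induction t) (auto intro: permutes_compose oet_step_permutes)

text \<open>Each round is an involution, so what it removes from the array it adds to the product of
  the rounds. Once the array is sorted to the identity, that product is \<pi> itself.\<close>

lemma oet_array_compose:
  "oet_array n \<pi> t \<circ> compose_upto (\<lambda>t. oet_step n t (oet_array n \<pi> t)) t = \<pi>"
  by (induction t) (auto simp: fun_eq_iff oet_step_involution)

text \<open>The 0-1 principle in counting form: a threshold \<theta> reduces the array to zeros and
  ones, and the array is sorted when every tail contains as many ones as possible.\<close>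

definition tail_count :: "nat \<Rightarrow> nat \<Rightarrow> (nat \<Rightarrow> nat) \<Rightarrow> nat \<Rightarrow> nat" where
  "tail_count n \<theta> y j = card {i \<in> {j..<n}. \<theta> \<le> y i}"

lemma tail_count_Suc:
  assumes "j < n"
  shows "tail_count n \<theta> y j = tail_count n \<theta> y (Suc j) + (if \<theta> \<le> y j then 1 else 0)"
proof -
  have "{i \<in> {j..<n}. \<theta> \<le> y i} = (if \<theta> \<le> y j then {j} else {}) \<union> {i \<in> {Suc j..<n}. \<theta> \<le> y i}"
    using assms by (auto simp: le_less Suc_le_eq)
  then show ?thesis
    by (simp add: tail_count_def)
qed

text \<open>No compared pair straddles the cut below \<open>j\<close> in this round, so the step
  permutes the tail within itself.\<close>

lemma tail_count_inactive:
  assumes "odd (t + j) \<or> j = 0 \<or> n \<le> j"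
  shows "tail_count n \<theta> (y \<circ> oet_step n t y) j = tail_count n \<theta> y j"
  unfolding tail_count_def
proof (rule bij_betw_same_card)
  have "oet_step n t y i \<in> {j..<n}" if "i \<in> {j..<n}" for i
    using assms that by (auto simp: oet_step_def le_eq_less_or_eq)
  then show "bij_betw (oet_step n t y) {i \<in> {j..<n}. \<theta> \<le> (y \<circ> oet_step n t y) i} {i \<in> {j..<n}. \<theta> \<le> y i}"
    by (intro bij_betw_byWitness[where f'="oet_step n t y"]) (auto simp: oet_step_involution)
qed

text \<open>Position \<open>j\<close> receives the larger value of the compared pair. If that value
  reaches \<theta>, it adds one to the unchanged count beyond \<open>j\<close>; otherwise neither of
  the two values counted before.\<close>

lemma tail_count_active:
  assumes "even (t + j)" "0 < j" "j < n"
  shows "tail_count n \<theta> y (j - 1) \<le> tail_count n \<theta> (y \<circ> oet_step n t y) j \<or>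
    Suc (tail_count n \<theta> y (Suc j)) \<le> tail_count n \<theta> (y \<circ> oet_step n t y) j"
proof -
  let ?y' = "y \<circ> oet_step n t y"
  have 1: "tail_count n \<theta> ?y' j = tail_count n \<theta> y (Suc j) + (if \<theta> \<le> ?y' j then 1 else 0)"
    using tail_count_Suc[OF assms(3), of \<theta> ?y'] tail_count_inactive[of t "Suc j" n \<theta> y] assms by simp
  have 2: "tail_count n \<theta> y (j - 1) = tail_count n \<theta> y j + (if \<theta> \<le> y (j - 1) then 1 else 0)"
    using tail_count_Suc[of "j - 1" n \<theta> y] assms by simp
  have 3: "?y' j = max (y (j - 1)) (y j)"
    using assms by (auto simp: oet_step_def)
  show ?thesis
    using 1 2 3 tail_count_Suc[OF assms(3), of \<theta> y] by (auto simp: le_max_iff_disj)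
qed

lemma tail_count_permutes_0:
  assumes "y permutes {..<n}" "\<theta> \<le> n"
  shows "tail_count n \<theta> y 0 = n - \<theta>"
proof -
  have "bij_betw y {i \<in> {0..<n}. \<theta> \<le> y i} {\<theta>..<n}"
    unfolding bij_betw_def
  proof
    show "inj_on y {i \<in> {0..<n}. \<theta> \<le> y i}"
      by (rule inj_on_subset[OF permutes_inj[OF assms(1)]]) simp
    have "k \<in> y ` {i \<in> {0..<n}. \<theta> \<le> y i}" if "k \<in> {\<theta>..<n}" for k
    proof -
      have "k \<in> y ` {..<n}" using that permutes_image[OF assms(1)] by auto
      then show ?thesis using that by auto
    qed
    moreover have "y i < n" if "i < n" for i
      using permutes_in_image[OF assms(1), of i] that by simp
    ultimately show "y ` {i \<in> {0..<n}. \<theta> \<le> y i} = {\<theta>..<n}" by auto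
  qed
  then show ?thesis using bij_betw_same_card[of y] by (fastforce simp: tail_count_def)
qed

text \<open>Every value count over a tail grows like a particle current: an active position
  takes the better of its two neighbours, both of which were updated in the previous round.\<close>
lemma oet_tail_count_bound:
  assumes p: "\<pi> permutes {..<n}" and th: "\<theta> \<le> n" and j: "j \<le> n"
  shows "n - \<theta> \<le> tail_count n \<theta> (oet_array n \<pi> t) j \<or> n - j \<le> tail_count n \<theta> (oet_array n \<pi> t) j \<or>
    t + (n - \<theta>) + (if odd (t + j) then 1 else 0) \<le> 2 * tail_count n \<theta> (oet_array n \<pi> t) j + j + 1"
  using j
proof (induction t arbitrary: j)
  case 0
  have "n - \<theta> \<le> tail_count n \<theta> \<pi> j + j" using 0
  proof (induction j)
    case 0 then show ?case using tail_count_permutes_0[OF p th] by simp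
  next
    case (Suc j)
    then show ?case using tail_count_Suc[of j n \<theta> \<pi>] by (auto split: if_splits)
  qed
  then show ?case by auto
next
  case (Suc t)
  let ?y = "oet_array n \<pi> t" let ?N = "tail_count n \<theta> ?y"
  define y' where "y' = oet_array n \<pi> (Suc t)"
  have eq: "y' = ?y \<circ> oet_step n t ?y" by (simp add: y'_def)
  consider "j = 0" | "j = n" | "odd (t + j)" | "even (t + j)" "0 < j" "j < n"
    using Suc.prems by linarith
  then show ?case
  proof cases
    case 1
    then show ?thesis
      using tail_count_permutes_0[OF oet_array_permutes[OF p] th, of "Suc t"] by (metis order_refl)
  next
    case 2
    then show ?thesis by simp
  next
    \<comment> \<open>The cut is idle in this round. The parity summand in the induction hypothesis
      supplies the gain of one that the bound asks for.\<close>
    case 3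
    then have "tail_count n \<theta> y' j = ?N j"
      using tail_count_inactive[of t j n \<theta> ?y] eq by simp
    then show ?thesis using Suc.IH[OF Suc.prems] 3 unfolding y'_def[symmetric] by auto
  next
    case 4
    have IH1: "n - \<theta> \<le> ?N (j - 1) \<or> n - (j - 1) \<le> ?N (j - 1) \<or> t + (n - \<theta>) + 1 \<le> 2 * ?N (j - 1) + (j - 1) + 1"
      using Suc.IH[of "j - 1"] 4 by (auto split: if_splits)
    have IH2: "n - \<theta> \<le> ?N (Suc j) \<or> n - Suc j \<le> ?N (Suc j) \<or> t + (n - \<theta>) + 1 \<le> 2 * ?N (Suc j) + Suc j + 1"
      using Suc.IH[of "Suc j"] 4 by (auto split: if_splits)
    show ?thesis
      using tail_count_active[OF 4, of \<theta> ?y] IH1 IH2 4 unfolding eq[symmetric] y'_def[symmetric]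
      by auto
  qed
qed

lemma oet_array_sorted:
  assumes p: "\<pi> permutes {..<n}"
  shows "oet_array n \<pi> n = id"
proof (rule permutes_natset_ge)
  let ?y = "oet_array n \<pi> n"
  show "?y permutes {..<n}" by (rule oet_array_permutes[OF p])
  show "\<forall>i\<in>{..<n}. i \<le> ?y i"
  proof
    fix i assume i: "i \<in> {..<n}"
    \<comment> \<open>With both cut and threshold at \<open>i\<close> after \<open>n\<close> rounds,
      the last alternative says that \<open>2 * (n - i)\<close> is at most twice the count plus one,
      which suffices for integers. So every position from \<open>i\<close> on carries a value of at
      least \<open>i\<close>.\<close>
    have "n - i \<le> tail_count n i ?y i"
      using oet_tail_count_bound[OF p, of i i n] i by (auto split: if_splits)
    then have eq: "{k \<in> {i..<n}. i \<le> ?y k} = {i..<n}"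
      by (intro card_seteq) (auto simp: tail_count_def)
    have "i \<in> {k \<in> {i..<n}. i \<le> ?y k}" unfolding eq using i by simp
    then show "i \<le> ?y i" by simp
  qed
qed

lemma adjacent_transposition_rounds:
  assumes "\<pi> permutes {..<n}"
  obtains \<tau> where "compose_upto \<tau> n = \<pi>" "\<And>t i. \<tau> t (\<tau> t i) = i" "\<And>t i. n \<le> i \<Longrightarrow> \<tau> t i = i"
    "\<And>t i. \<tau> t i = i \<or> \<tau> t i = Suc i \<or> i = Suc (\<tau> t i)"
proof
  show "compose_upto (\<lambda>t. oet_step n t (oet_array n \<pi> t)) n = \<pi>"
    using oet_array_compose[of n \<pi> n] by (simp add: oet_array_sorted[OF assms])
qed (use oet_step_involution oet_step_outside oet_step_adjacent in auto)

section \<open>Edge colourings of regular bipartite multigraphs\<close>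

text \<open>Rado's argument: shrink the family to a minimal one satisfying Hall's condition.\<close>
lemma hall_marriage:
  fixes A :: "'i \<Rightarrow> 'b set"
  assumes "finite I" "\<And>i. i \<in> I \<Longrightarrow> finite (A i)"
    and "\<And>J. J \<subseteq> I \<Longrightarrow> card J \<le> card (\<Union>i\<in>J. A i)"
  obtains f where "inj_on f I" "\<And>i. i \<in> I \<Longrightarrow> f i \<in> A i"
proof -
  have "\<exists>f. inj_on f I \<and> (\<forall>i\<in>I. f i \<in> A i)"
    using assms(2,3)
  proof (induction "\<Sum>i\<in>I. card (A i)" arbitrary: A rule: less_induct)
    case less
    note fin = less.prems(1) and hall = less.prems(2)
    have finU: "finite (\<Union>i\<in>J. A i)" if "J \<subseteq> I" for J
      using that fin finite_subset[OF that assms(1)] by blast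
    show ?case
    proof (cases "\<exists>i\<in>I. 1 < card (A i)")
      case False
      have "\<exists>x. A i = {x}" if "i \<in> I" for i
      proof -
        have "card {i} \<le> card (\<Union>k\<in>{i}. A k)" by (rule hall) (use that in simp)
        then have "1 \<le> card (A i)" by simp
        moreover have "card (A i) \<le> 1" using False that by (meson not_less)
        ultimately have "card (A i) = 1" by (rule antisym[rotated])
        then show ?thesis by (rule card_1_singletonE) auto
      qed
      then obtain f where f: "\<And>i. i \<in> I \<Longrightarrow> A i = {f i}" by metis
      have "inj_on f I"
      proof (rule inj_onI, rule ccontr)
        fix i j assume ij: "i \<in> I" "j \<in> I" "f i = f j" "i \<noteq> j"
        then show False using hall[of "{i, j}"] f by simp
      qed
      then show ?thesis using f by auto
    next
      case True
      then obtain i where i: "i \<in> I" "1 < card (A i)" by auto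
      then obtain x y where xy: "x \<in> A i" "y \<in> A i" "x \<noteq> y"
        by (metis One_nat_def card_le_Suc0_iff_eq fin linorder_not_less)
      define R where "R z = A(i := A i - {z})" for z
      have R_sub: "R z k \<subseteq> A k" for z k by (auto simp: R_def)
      have good: "\<exists>f. inj_on f I \<and> (\<forall>i\<in>I. f i \<in> A i)"
        if z: "z \<in> A i" and h: "\<And>J. J \<subseteq> I \<Longrightarrow> card J \<le> card (\<Union>k\<in>J. R z k)" for z
      proof -
        have "(\<Sum>k\<in>I. card (R z k)) < (\<Sum>k\<in>I. card (A k))"
        proof (rule sum_strict_mono_ex1)
          show "\<forall>k\<in>I. card (R z k) \<le> card (A k)" using R_sub fin by (intro ballI card_mono) auto
          show "\<exists>k\<in>I. card (R z k) < card (A k)"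
            using i z fin[OF i(1)] by (intro bexI[of _ i]) (auto simp: R_def intro: psubset_card_mono)
        qed (use assms in auto)
        then obtain f where "inj_on f I" "\<forall>k\<in>I. f k \<in> R z k"
          using less.hyps[of "R z"] h fin R_sub by (metis finite_subset)
        then show ?thesis using R_sub by blast
      qed
      have violated: "\<exists>J \<subseteq> I - {i}. card (A i - {z} \<union> (\<Union>k\<in>J. A k)) \<le> card J"
        if z: "z \<in> A i" and no: "\<not> (\<exists>f. inj_on f I \<and> (\<forall>i\<in>I. f i \<in> A i))" for z
      proof -
        have "\<not> (\<forall>J\<subseteq>I. card J \<le> card (\<Union>k\<in>J. R z k))"
          using good[OF z] no by blast
        then obtain J where J: "J \<subseteq> I" "card (\<Union>k\<in>J. R z k) < card J"
          by (auto simp: not_le)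
        have "i \<in> J"
        proof (rule ccontr)
          assume "i \<notin> J"
          then have "(\<Union>k\<in>J. R z k) = (\<Union>k\<in>J. A k)" by (auto simp: R_def)
          then show False using J(2) hall[OF J(1)] by simp
        qed
        moreover have "(\<Union>k\<in>J. R z k) = A i - {z} \<union> (\<Union>k\<in>J - {i}. A k)"
          using \<open>i \<in> J\<close> by (auto simp: R_def split: if_splits)
        moreover have "card J = Suc (card (J - {i}))"
          using card_Suc_Diff1[OF finite_subset[OF J(1) assms(1)] \<open>i \<in> J\<close>] by simp
        ultimately show ?thesis using J by (intro exI[of _ "J - {i}"]) auto
      qed
      show ?thesis
      proof (rule ccontr)
        assume no: "\<not> ?thesis"
        obtain J where J: "J \<subseteq> I - {i}" "card (A i - {x} \<union> (\<Union>k\<in>J. A k)) \<le> card J"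
          using violated[OF xy(1) no] by blast
        obtain K where K: "K \<subseteq> I - {i}" "card (A i - {y} \<union> (\<Union>k\<in>K. A k)) \<le> card K"
          using violated[OF xy(2) no] by blast
        let ?X = "A i - {x} \<union> (\<Union>k\<in>J. A k)" and ?Y = "A i - {y} \<union> (\<Union>k\<in>K. A k)"
        have fJK: "finite J" "finite K" using J K assms(1) by (auto intro: finite_subset[of _ "I - {i}"])
        have fXY: "finite ?X" "finite ?Y"
          using J(1) K(1) fin[OF i(1)] finU[of J] finU[of K] by auto
        have "?X \<union> ?Y = (\<Union>k\<in>insert i (J \<union> K). A k)" using xy by auto
        then have 1: "card (insert i (J \<union> K)) \<le> card (?X \<union> ?Y)"
          using hall[of "insert i (J \<union> K)"] J(1) K(1) i(1) by (metis Diff_subset Un_subset_iff insert_subset order_trans)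
        have "card (J \<inter> K) \<le> card (\<Union>k\<in>J \<inter> K. A k)"
          using J by (intro hall) auto
        also have "\<dots> \<le> card (?X \<inter> ?Y)"
          using fXY by (intro card_mono) auto
        finally have 2: "card (J \<inter> K) \<le> card (?X \<inter> ?Y)" .
        have 3: "card (insert i (J \<union> K)) = Suc (card (J \<union> K))"
          using J K fJK by (subst card_insert_disjoint) auto
        \<comment> \<open>Cardinality is modular: the two violating families bound the sum of the
          sizes of union and intersection by \<open>card J + card K\<close>, while Hall's condition
          for \<open>insert i (J \<union> K)\<close> and for \<open>J \<inter> K\<close> requires
          one more.\<close>
        show False
          using 1 2 3 card_Un_Int[OF fXY] card_Un_Int[OF fJK] J(2) K(2) by linarith
      qed
    qed
  qed
  then show ?thesis using that by blast
qed

section \<open>Perfect matchings and Koenig's edge colouring\<close>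

lemma card_eq_fibres:
  assumes "finite E" "\<And>e. e \<in> E \<Longrightarrow> card {e' \<in> E. l e' = l e} = S" "J \<subseteq> l ` E"
  shows "card {e \<in> E. l e \<in> J} = card J * S"
proof -
  have "{e \<in> E. l e \<in> J} = (\<Union>u\<in>J. {e \<in> E. l e = u})" by auto
  moreover have "card (\<Union>u\<in>J. {e \<in> E. l e = u}) = (\<Sum>u\<in>J. card {e \<in> E. l e = u})"
    using assms(1,3) by (intro card_UN_disjoint) (auto intro: finite_subset)
  moreover have "\<dots> = (\<Sum>u\<in>J. S)"
    using assms(2,3) by (intro sum.cong) auto
  ultimately show ?thesis by simp
qed

text \<open>Hall's condition by double counting: the \<open>S * card J\<close> edges at
  \<open>J\<close> all end at its neighbours, and each of these absorbs only \<open>S\<close>. The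
  same count shows that both sides are equally large, so a matching that saturates the left side
  saturates the right one.\<close>

lemma regular_bipartite_perfect_matching:
  fixes l :: "'e \<Rightarrow> 'b" and r :: "'e \<Rightarrow> 'c"
  assumes fin: "finite E" and S: "0 < S"
    and l: "\<And>e. e \<in> E \<Longrightarrow> card {e' \<in> E. l e' = l e} = S"
    and r: "\<And>e. e \<in> E \<Longrightarrow> card {e' \<in> E. r e' = r e} = S"
  obtains M where "M \<subseteq> E" "inj_on l M" "inj_on r M" "l ` M = l ` E" "r ` M = r ` E"
proof -
  define A where "A u = r ` {e \<in> E. l e = u}" for u
  have hall: "card J \<le> card (\<Union>u\<in>J. A u)" if J: "J \<subseteq> l ` E" for J
  proof -
    have "card J * S = card {e \<in> E. l e \<in> J}"
      using card_eq_fibres[OF fin l J] by simp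
    also have "\<dots> \<le> card {e \<in> E. r e \<in> (\<Union>u\<in>J. A u)}"
      using fin by (intro card_mono) (auto simp: A_def)
    also have "\<dots> = card (\<Union>u\<in>J. A u) * S"
      by (rule card_eq_fibres[OF fin r]) (auto simp: A_def)
    finally show ?thesis using S by simp
  qed
  obtain f where f: "inj_on f (l ` E)" "\<And>u. u \<in> l ` E \<Longrightarrow> f u \<in> A u"
    by (rule hall_marriage[of "l ` E" A]) (use fin hall in \<open>auto simp: A_def\<close>)
  have "\<forall>u\<in>l ` E. \<exists>e\<in>E. l e = u \<and> r e = f u"
    using f(2) unfolding A_def by fastforce
  then obtain h where h: "\<And>u. u \<in> l ` E \<Longrightarrow> h u \<in> E \<and> l (h u) = u \<and> r (h u) = f u"
    by metis
  have "card {e \<in> E. l e \<in> l ` E} = card {e \<in> E. r e \<in> r ` E}"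
    by (rule arg_cong[where f=card]) auto
  then have cards: "card (l ` E) = card (r ` E)"
    using card_eq_fibres[OF fin l order_refl] card_eq_fibres[OF fin r order_refl] S by simp
  have hE: "h (l e) \<in> E" "l (h (l e)) = l e" "r (h (l e)) = f (l e)" if "e \<in> E" for e
    using h[of "l e"] that by auto
  show ?thesis
  proof
    show "h ` l ` E \<subseteq> E" using hE(1) by blast
    show "inj_on l (h ` l ` E)" by (auto simp: inj_on_def hE)
    show "inj_on r (h ` l ` E)" 
    proof (rule inj_onI)
      fix x y assume "x \<in> h ` l ` E" "y \<in> h ` l ` E" "r x = r y"
      then obtain e e' where e: "e \<in> E" "x = h (l e)" "e' \<in> E" "y = h (l e')" "f (l e) = f (l e')"
        using hE(3) by auto
      then have "l e = l e'" using inj_onD[OF f(1)] by blast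
      then show "x = y" using e by simp
    qed
    show "l ` h ` l ` E = l ` E" by (simp add: image_image hE)
    have "r ` h ` l ` E = f ` l ` E" by (simp add: image_image hE)
    moreover have "f ` l ` E = r ` E"
    proof (rule card_subset_eq)
      show "f ` l ` E \<subseteq> r ` E" using f(2) by (auto simp: A_def)
      show "card (f ` l ` E) = card (r ` E)" using cards card_image[OF f(1)] by simp
    qed (use fin in simp)
    ultimately show "r ` h ` l ` E = r ` E" by simp
  qed
qed

text \<open>Removing a perfect matching lowers the degree by one, and the removed edges share the
  last colour. Edges are elements with two end maps, which admits the parallel edges that arise in
  routing.\<close>

lemma regular_bipartite_edge_colouring:
  fixes l :: "'e \<Rightarrow> 'b" and r :: "'e \<Rightarrow> 'c"
  assumes "finite E"
    and "\<And>e. e \<in> E \<Longrightarrow> card {e' \<in> E. l e' = l e} = S"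
    and "\<And>e. e \<in> E \<Longrightarrow> card {e' \<in> E. r e' = r e} = S"
  shows "\<exists>c. (\<forall>e\<in>E. c e < S) \<and> inj_on (\<lambda>e. (l e, c e)) E \<and> inj_on (\<lambda>e. (r e, c e)) E"
  using assms
proof (induction S arbitrary: E)
  case 0
  then have "E = {}" by (auto simp: card_eq_0_iff)
  then show ?case by simp
next
  case (Suc S)
  obtain M where M: "M \<subseteq> E" "inj_on l M" "inj_on r M" "l ` M = l ` E" "r ` M = r ` E"
    using regular_bipartite_perfect_matching[OF Suc.prems(1) _ Suc.prems(2,3)] by blast
  have fibre: "card {e' \<in> E - M. k e' = k e} = S"
    if e: "e \<in> E - M" and k: "card {e' \<in> E. k e' = k e} = Suc S" "inj_on k M" "k ` M = k ` E"
    for e and k :: "'e \<Rightarrow> 'z"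
  proof -
    obtain m where m: "m \<in> M" "k m = k e" using k(3) e by (metis DiffD1 imageE image_eqI)
    have "{e' \<in> E - M. k e' = k e} = {e' \<in> E. k e' = k e} - {m}"
      using m inj_onD[OF k(2)] M(1) by (auto; metis)
    then show ?thesis using k(1) m M(1) Suc.prems(1) by (simp add: card_Diff_singleton subset_iff)
  qed
  have "\<exists>c. (\<forall>e\<in>E - M. c e < S) \<and> inj_on (\<lambda>e. (l e, c e)) (E - M) \<and>
      inj_on (\<lambda>e. (r e, c e)) (E - M)"
  proof (rule Suc.IH)
    show "card {e' \<in> E - M. l e' = l e} = S" if "e \<in> E - M" for e
      using fibre[OF that Suc.prems(2) M(2,4)] that by simp
    show "card {e' \<in> E - M. r e' = r e} = S" if "e \<in> E - M" for e
      using fibre[OF that Suc.prems(3) M(3,5)] that by simp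
  qed (use Suc.prems(1) in simp)
  then obtain c where c: "\<forall>e\<in>E - M. c e < S" "inj_on (\<lambda>e. (l e, c e)) (E - M)"
      "inj_on (\<lambda>e. (r e, c e)) (E - M)"
    by blast
  define c' where "c' e = (if e \<in> M then S else c e)" for e
  have inj: "inj_on (\<lambda>e. (k e, c' e)) E"
    if k: "inj_on k M" "inj_on (\<lambda>e. (k e, c e)) (E - M)" for k :: "'e \<Rightarrow> 'z"
  proof (rule inj_onI)
    fix x y assume xy: "x \<in> E" "y \<in> E" "(k x, c' x) = (k y, c' y)"
    have "c x < S" if "x \<notin> M" using c(1) xy that by blast
    moreover have "c y < S" if "y \<notin> M" using c(1) xy that by blast
    ultimately have "x \<in> M \<longleftrightarrow> y \<in> M"
      using xy(3) by (auto simp: c'_def split: if_splits)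
    then show "x = y"
      using xy inj_onD[OF k(1), of x y] inj_onD[OF k(2), of x y] by (auto simp: c'_def)
  qed
  have "\<forall>e\<in>E. c' e < Suc S"
    using c(1) by (auto simp: c'_def less_Suc_eq)
  then show ?case
    using inj[OF M(2) c(2)] inj[OF M(3) c(3)] by blast
qed

section \<open>Realizing lattice permutations\<close>

text \<open>Permutations are treated on integer vectors, where membership in blocks is division with
  remainder, and carried to Euclidean space by \<open>lat\<close>.\<close>

definition lat :: "('m::finite \<Rightarrow> int) \<Rightarrow> real^'m" where
  "lat z = (\<chi> i. of_int (z i))"

text \<open>The requirement on a single permutation in the definition of \<open>admissible\<close>,
  with the constant set free, so that a permutation can be realized factor by factor while the
  constants multiply.\<close>

definition layer_realizable :: "real \<Rightarrow> (('m::finite \<Rightarrow> int) \<Rightarrow> 'm \<Rightarrow> int) \<Rightarrow> bool" where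
  "layer_realizable L \<sigma> \<longleftrightarrow> (\<exists>\<Upsilon> :: (real^'m) \<times> real \<Rightarrow> (real^'m) \<times> real.
     bilipschitz_on L UNIV \<Upsilon> \<and> (\<forall>x. \<bar>snd x\<bar> \<ge> 1/2 \<longrightarrow> \<Upsilon> x = x) \<and> (\<forall>z. \<Upsilon> (lat z, 0) = (lat (\<sigma> z), 0)))"

lemma layer_realizable_id: "layer_realizable 1 id"
  unfolding layer_realizable_def using bilipschitz_on_id by auto

lemma layer_realizableE:
  fixes \<sigma> :: "('m::finite \<Rightarrow> int) \<Rightarrow> 'm \<Rightarrow> int"
  assumes "layer_realizable L \<sigma>"
  obtains F :: "(real^'m) \<times> real \<Rightarrow> (real^'m) \<times> real" where "bilipschitz_on L UNIV F"
    "\<And>x. \<bar>snd x\<bar> \<ge> 1/2 \<Longrightarrow> F x = x" "\<And>z. F (lat z, 0) = (lat (\<sigma> z), 0)"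
  using assms unfolding layer_realizable_def by blast

lemma layer_realizable_compose:
  fixes \<sigma> \<tau> :: "('m::finite \<Rightarrow> int) \<Rightarrow> 'm \<Rightarrow> int"
  assumes "layer_realizable L \<sigma>" "layer_realizable M \<tau>"
  shows "layer_realizable (L * M) (\<sigma> \<circ> \<tau>)"
proof -
  obtain F :: "(real^'m) \<times> real \<Rightarrow> (real^'m) \<times> real" where F: "bilipschitz_on L UNIV F" "\<And>x. \<bar>snd x\<bar> \<ge> 1/2 \<Longrightarrow> F x = x"
      "\<And>z. F (lat z, 0) = (lat (\<sigma> z), 0)"
    using layer_realizableE[OF assms(1)] by blast
  obtain G :: "(real^'m) \<times> real \<Rightarrow> (real^'m) \<times> real" where G: "bilipschitz_on M UNIV G" "\<And>x. \<bar>snd x\<bar> \<ge> 1/2 \<Longrightarrow> G x = x"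
      "\<And>z. G (lat z, 0) = (lat (\<tau> z), 0)"
    using layer_realizableE[OF assms(2)] by blast
  show ?thesis
    unfolding layer_realizable_def
    using bilipschitz_on_compose[OF F(1) G(1)] F G by (intro exI[of _ "F \<circ> G"]) simp
qed

section \<open>Blocks of integer vectors\<close>

lemma int_div_bounds:
  assumes "0 < S"
  shows "int S * (k div int S) \<le> k" "k < int S * (k div int S) + int S"
  using assms mult_div_mod_eq[of "int S" k] pos_mod_bound[of "int S" k] pos_mod_sign[of "int S" k]
  by linarith+

lemma int_div_eqI:
  assumes "int S * c \<le> k" "k < int S * c + int S"
  shows "k div int S = c"
proof -
  have "((k - int S * c) + int S * c) div int S = c + (k - int S * c) div int S"
    using assms by (intro div_mult_self2) auto
  moreover have "(k - int S * c) div int S = 0"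
    using assms by (intro div_pos_pos_trivial) auto
  ultimately show ?thesis by simp
qed

definition blk :: "nat \<Rightarrow> ('m \<Rightarrow> int) \<Rightarrow> 'm \<Rightarrow> int" where
  "blk S z = (\<lambda>i. z i div int S)"

lemma finite_blk:
  assumes "0 < S"
  shows "finite {z :: 'm::finite \<Rightarrow> int. blk S z = b}"
proof (rule finite_subset)
  show "{z. blk S z = b} \<subseteq> Pi\<^sub>E UNIV (\<lambda>i. {int S * b i ..< int S * b i + int S})"
  proof (clarsimp simp: PiE_UNIV_domain)
    fix z i
    show "int S * blk S z i \<le> z i \<and> z i < int S * blk S z i + int S"
      using int_div_bounds[OF assms, of "z i"] by (simp add: blk_def)
  qed
qed (simp add: finite_PiE)

text \<open>Blocks are finite, and an injective self-map of a finite set is onto.\<close>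

lemma bij_if_blk_preserving:
  fixes f :: "('m::finite \<Rightarrow> int) \<Rightarrow> 'm \<Rightarrow> int"
  assumes S: "0 < S" and inj: "inj f" and blk: "\<And>z. blk S (f z) = blk S z"
  shows "bij f"
proof -
  have "\<exists>z. f z = w" for w
  proof -
    let ?B = "{z. blk S z = blk S w}"
    have "f ` ?B = ?B"
      using inj blk by (intro endo_inj_surj finite_blk[OF S]) (auto intro: inj_on_subset)
    then have "w \<in> f ` ?B" by simp
    then show ?thesis by auto
  qed
  then show ?thesis using inj unfolding bij_def surj_def by (metis (no_types))
qed

lemma blk_fun_upd:
  assumes "0 < S" "c < S"
  shows "blk S (z(a := int S * (z a div int S) + int c)) = blk S z"
  using assms by (auto simp: blk_def fun_eq_iff)

lemma blk_fun_updD: "blk S z = blk S w \<Longrightarrow> z i div int S = w i div int S"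
  by (simp add: blk_def fun_eq_iff)

section \<open>Swapping two neighbours\<close>

text \<open>Rotation by \<theta> in the oriented plane of \<open>e\<close> and \<open>n\<close>,
  written as the identity plus a correction in that plane, so that the orthogonal complement needs
  no coordinates.\<close>

definition plane_rot :: "'v::real_inner \<Rightarrow> 'v \<Rightarrow> real \<Rightarrow> 'v \<Rightarrow> 'v" where
  "plane_rot e n \<theta> v = v + ((cos \<theta> - 1) * (v \<bullet> e) - sin \<theta> * (v \<bullet> n)) *\<^sub>R e
     + ((cos \<theta> - 1) * (v \<bullet> n) + sin \<theta> * (v \<bullet> e)) *\<^sub>R n"

text \<open>A full half turn up to radius 1/2, where the points to be swapped lie, falling linearly
  to no turn at radius 1.\<close>

definition twist_angle :: "real \<Rightarrow> real" where
  "twist_angle r = min pi (max 0 (2 * pi * (1 - r)))"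

definition twist :: "'v::real_inner \<Rightarrow> 'v \<Rightarrow> real \<Rightarrow> 'v \<Rightarrow> 'v" where
  "twist e n s v = plane_rot e n (s * twist_angle (norm v)) v"

lemma twist_angle_outside: "1 \<le> r \<Longrightarrow> twist_angle r = 0"
  by (simp add: twist_angle_def mult_nonneg_nonpos)

lemma twist_angle_half: "twist_angle (1/2) = pi"
  by (simp add: twist_angle_def)

lemma twist_angle_lipschitz: "\<bar>twist_angle r - twist_angle s\<bar> \<le> 2 * pi * \<bar>r - s\<bar>"
proof -
  have "\<bar>twist_angle r - twist_angle s\<bar> \<le> \<bar>2 * pi * (1 - r) - 2 * pi * (1 - s)\<bar>"
    unfolding twist_angle_def by linarith
  also have "\<dots> = \<bar>2 * pi * (s - r)\<bar>" by (simp add: algebra_simps)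
  also have "\<dots> = 2 * pi * \<bar>r - s\<bar>" by (simp add: abs_mult abs_minus_commute)
  finally show ?thesis .
qed

text \<open>Keeps the direction \<open>e\<close> and doubles its orthogonal complement. This turns
  the long cell of a swap into the unit ball, on which the radial twist lives.\<close>

definition stretch :: "'v::real_inner \<Rightarrow> 'v \<Rightarrow> 'v" where
  "stretch e v = 2 *\<^sub>R v - (v \<bullet> e) *\<^sub>R e"

definition unstretch :: "'v::real_inner \<Rightarrow> 'v \<Rightarrow> 'v" where
  "unstretch e v = (1/2) *\<^sub>R v + ((v \<bullet> e) / 2) *\<^sub>R e"

text \<open>A half turn of the plane spanned by \<open>e\<close> and \<open>n\<close>, cut off at an ellipsoid that has
  half-axis \<open>1\<close> along \<open>e\<close> and half-axes \<open>1/2\<close> in all other directions.\<close>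
definition cell_swap :: "'v::real_inner \<Rightarrow> 'v \<Rightarrow> 'v \<Rightarrow> real \<Rightarrow> 'v \<Rightarrow> 'v" where
  "cell_swap e n c s p = c + unstretch e (twist e n s (stretch e (p - c)))"

section \<open>Estimates for rotations, twists and cell swaps\<close>

context
  fixes e n :: "'v::real_inner"
  assumes e1: "e \<bullet> e = 1" and n1: "n \<bullet> n = 1" and en: "e \<bullet> n = 0"
begin

lemma plane_rot_inner:
  "plane_rot e n \<theta> v \<bullet> e = cos \<theta> * (v \<bullet> e) - sin \<theta> * (v \<bullet> n)"
  "plane_rot e n \<theta> v \<bullet> n = cos \<theta> * (v \<bullet> n) + sin \<theta> * (v \<bullet> e)"
  using e1 n1 en by (simp_all add: plane_rot_def inner_add_left inner_commute[of n e] algebra_simps)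

lemma norm_plane_combination: "(norm (a *\<^sub>R e + b *\<^sub>R n))\<^sup>2 = a\<^sup>2 + b\<^sup>2"
  using e1 n1 en unfolding power2_norm_eq_inner
  by (simp add: inner_add_left inner_add_right inner_commute[of n e] power2_eq_square)

text \<open>Bessel's inequality, read off from the squared distance between \<open>v\<close> and its
  projection onto the plane.\<close>

lemma sum_squares_inner_le: "(v \<bullet> e)\<^sup>2 + (v \<bullet> n)\<^sup>2 \<le> (norm v)\<^sup>2"
proof -
  define w where "w = (v \<bullet> e) *\<^sub>R e + (v \<bullet> n) *\<^sub>R n"
  have "v \<bullet> w = (v \<bullet> e)\<^sup>2 + (v \<bullet> n)\<^sup>2"
    by (simp add: w_def inner_add_right power2_eq_square)
  moreover have "(norm w)\<^sup>2 = (v \<bullet> e)\<^sup>2 + (v \<bullet> n)\<^sup>2"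
    unfolding w_def by (rule norm_plane_combination)
  moreover have "0 \<le> (norm (v - w))\<^sup>2" by simp
  ultimately show ?thesis
    by (simp add: power2_norm_eq_inner inner_diff_left inner_diff_right inner_commute)
qed

lemma plane_rot_diff: "plane_rot e n \<theta> v - plane_rot e n \<theta> w = plane_rot e n \<theta> (v - w)"
  by (simp add: plane_rot_def inner_diff_left algebra_simps)

lemma norm_plane_rot: "norm (plane_rot e n \<theta> v) = norm v"
proof -
  define a where "a = (cos \<theta> - 1) * (v \<bullet> e) - sin \<theta> * (v \<bullet> n)"
  define b where "b = (cos \<theta> - 1) * (v \<bullet> n) + sin \<theta> * (v \<bullet> e)"
  have "(norm (plane_rot e n \<theta> v))\<^sup>2 = (norm (v + (a *\<^sub>R e + b *\<^sub>R n)))\<^sup>2"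
    by (simp add: plane_rot_def a_def b_def add.assoc)
  also have "\<dots> = (norm v)\<^sup>2 + 2 * (a * (v \<bullet> e) + b * (v \<bullet> n)) + (a\<^sup>2 + b\<^sup>2)"
    unfolding norm_plane_combination[symmetric]
    by (simp add: power2_norm_eq_inner inner_add_left inner_add_right inner_commute algebra_simps)
  also have "2 * (a * (v \<bullet> e) + b * (v \<bullet> n)) + (a\<^sup>2 + b\<^sup>2)
      = ((sin \<theta>)\<^sup>2 + (cos \<theta>)\<^sup>2 - 1) * ((v \<bullet> e)\<^sup>2 + (v \<bullet> n)\<^sup>2)"
    unfolding a_def b_def by algebra
  then have "(norm v)\<^sup>2 + 2 * (a * (v \<bullet> e) + b * (v \<bullet> n)) + (a\<^sup>2 + b\<^sup>2) = (norm v)\<^sup>2"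
    by simp
  finally show ?thesis by simp
qed

lemma plane_rot_inverse: "plane_rot e n (- \<theta>) (plane_rot e n \<theta> v) = v"
proof -
  let ?a = "v \<bullet> e" and ?b = "v \<bullet> n" and ?c = "cos \<theta>" and ?s = "sin \<theta>"
  have "(?c - 1) * (?c * ?a - ?s * ?b) + ?s * (?c * ?b + ?s * ?a) + ((?c - 1) * ?a - ?s * ?b)
      = (?s\<^sup>2 + ?c\<^sup>2 - 1) * ?a" by algebra
  then have 1: "(?c - 1) * (?c * ?a - ?s * ?b) + ?s * (?c * ?b + ?s * ?a) = - ((?c - 1) * ?a - ?s * ?b)"
    by simp
  have "(?c - 1) * (?c * ?b + ?s * ?a) - ?s * (?c * ?a - ?s * ?b) + ((?c - 1) * ?b + ?s * ?a)
      = (?s\<^sup>2 + ?c\<^sup>2 - 1) * ?b" by algebra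
  then have 2: "(?c - 1) * (?c * ?b + ?s * ?a) - ?s * (?c * ?a - ?s * ?b) = - ((?c - 1) * ?b + ?s * ?a)"
    by simp
  have "plane_rot e n (- \<theta>) (plane_rot e n \<theta> v) = plane_rot e n \<theta> v
      + ((?c - 1) * (?c * ?a - ?s * ?b) + ?s * (?c * ?b + ?s * ?a)) *\<^sub>R e
      + ((?c - 1) * (?c * ?b + ?s * ?a) - ?s * (?c * ?a - ?s * ?b)) *\<^sub>R n"
    by (subst (1) plane_rot_def) (simp only: plane_rot_inner cos_minus sin_minus mult_minus_left
        diff_minus_eq_add add_uminus_conv_diff)
  also have "\<dots> = v"
    unfolding 1 2 by (simp add: plane_rot_def algebra_simps)
  finally show ?thesis .
qed

text \<open>A chord is no longer than its arc: the squared chord on the unit circle is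
  \<open>4 * (sin ((\<theta> - \<phi>) / 2))^2\<close>.\<close>

lemma norm_plane_rot_angle_diff:
  "norm (plane_rot e n \<theta> v - plane_rot e n \<phi> v) \<le> \<bar>\<theta> - \<phi>\<bar> * norm v"
proof -
  let ?c = "cos \<theta> - cos \<phi>" and ?s = "sin \<theta> - sin \<phi>" and ?a = "v \<bullet> e" and ?b = "v \<bullet> n"
  have "plane_rot e n \<theta> v - plane_rot e n \<phi> v = (?c * ?a - ?s * ?b) *\<^sub>R e + (?c * ?b + ?s * ?a) *\<^sub>R n"
    by (simp add: plane_rot_def algebra_simps)
  then have "(norm (plane_rot e n \<theta> v - plane_rot e n \<phi> v))\<^sup>2 = (?c * ?a - ?s * ?b)\<^sup>2 + (?c * ?b + ?s * ?a)\<^sup>2"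
    by (simp add: norm_plane_combination)
  also have "\<dots> = (?c\<^sup>2 + ?s\<^sup>2) * (?a\<^sup>2 + ?b\<^sup>2)" by algebra
  also have "\<dots> \<le> (\<theta> - \<phi>)\<^sup>2 * (norm v)\<^sup>2"
  proof (rule mult_mono[OF _ sum_squares_inner_le])
    have "?c\<^sup>2 + ?s\<^sup>2 = (sin \<theta>)\<^sup>2 + (cos \<theta>)\<^sup>2 + ((sin \<phi>)\<^sup>2 + (cos \<phi>)\<^sup>2)
        - 2 * (cos \<theta> * cos \<phi> + sin \<theta> * sin \<phi>)" by algebra
    also have "\<dots> = 2 - 2 * cos (\<theta> - \<phi>)" by (simp add: cos_diff)
    also have "\<dots> = 4 * (sin ((\<theta> - \<phi>) / 2))\<^sup>2" 
    proof -
      have half: "2 * ((\<theta> - \<phi>) / 2) = \<theta> - \<phi>" by simp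
      show ?thesis using cos_double_sin[of "(\<theta> - \<phi>) / 2"] unfolding half by simp
    qed
    also have "\<dots> \<le> 4 * ((\<theta> - \<phi>) / 2)\<^sup>2"
      using abs_sin_x_le_abs_x[of "(\<theta> - \<phi>) / 2"] unfolding abs_le_square_iff by linarith
    finally show "?c\<^sup>2 + ?s\<^sup>2 \<le> (\<theta> - \<phi>)\<^sup>2" by (simp add: power_divide)
  qed auto
  finally show ?thesis
    by (metis (no_types, opaque_lifting) abs_ge_zero mult_nonneg_nonneg norm_ge_zero power2_abs power2_le_imp_le power_mult_distrib)
qed

lemma twist_inverse: "twist e n (- s) (twist e n s v) = v"
  by (simp add: twist_def norm_plane_rot plane_rot_inverse)

lemma twist_outside: "1 \<le> norm v \<Longrightarrow> twist e n s v = v"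
  by (simp add: twist_def twist_angle_outside plane_rot_def)

lemma twist_half:
  assumes "v = (1/2) *\<^sub>R e \<or> v = - (1/2) *\<^sub>R e"
  shows "twist e n 1 v = - v"
proof -
  have "norm e = 1" using e1 by (simp add: norm_eq_1)
  then have "norm v = 1/2" using assms by auto
  then show ?thesis
    using assms e1 en twist_angle_half by (auto simp: twist_def plane_rot_def algebra_simps simp flip: scaleR_2)
qed

text \<open>Rotating \<open>v\<close> and the shorter vector \<open>w\<close> by the same angle is
  an isometry. The remaining difference of angles acts on \<open>w\<close> only, whose norm is below
  1 unless both angles vanish.\<close>

lemma twist_lipschitz:
  assumes "\<bar>s\<bar> \<le> 1"
  shows "(1 + 2 * pi)-lipschitz_on UNIV (twist e n s)"
proof (rule lipschitz_onI)
  have main: "norm (twist e n s v - twist e n s w) \<le> (1 + 2 * pi) * norm (v - w)"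
    if le: "norm w \<le> norm v" for v w
  proof -
    let ?\<theta> = "s * twist_angle (norm v)" and ?\<phi> = "s * twist_angle (norm w)"
    have bound: "\<bar>?\<theta> - ?\<phi>\<bar> * norm w \<le> 2 * pi * norm (v - w)"
    proof (cases "1 \<le> norm w")
      case True
      then show ?thesis using le by (simp add: twist_angle_outside)
    next
      case False
      have "\<bar>?\<theta> - ?\<phi>\<bar> \<le> 1 * \<bar>twist_angle (norm v) - twist_angle (norm w)\<bar>"
        using assms by (subst right_diff_distrib[symmetric], subst abs_mult) (rule mult_right_mono, auto)
      also have "\<dots> \<le> 2 * pi * \<bar>norm v - norm w\<bar>" using twist_angle_lipschitz by simp
      also have "\<dots> \<le> 2 * pi * norm (v - w)"
        by (intro mult_left_mono norm_triangle_ineq3) simp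
      finally have "\<bar>?\<theta> - ?\<phi>\<bar> * norm w \<le> 2 * pi * norm (v - w) * 1"
        using False by (intro mult_mono) auto
      then show ?thesis by simp
    qed
    have "norm (twist e n s v - twist e n s w) \<le> norm (plane_rot e n ?\<theta> (v - w))
        + norm (plane_rot e n ?\<theta> w - plane_rot e n ?\<phi> w)"
      unfolding twist_def plane_rot_diff[symmetric] by (rule order_trans[OF _ norm_triangle_ineq]) simp
    also have "\<dots> \<le> norm (v - w) + 2 * pi * norm (v - w)"
      using norm_plane_rot_angle_diff[of ?\<theta> w ?\<phi>] bound by (simp add: norm_plane_rot)
    finally show ?thesis by (simp add: algebra_simps)
  qed
  fix v w
  show "dist (twist e n s v) (twist e n s w) \<le> (1 + 2 * pi) * dist v w"
    using main[of v w] main[of w v] by (cases "norm w \<le> norm v") (auto simp: dist_norm norm_minus_commute)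
qed (simp add: add_nonneg_nonneg)

lemma unstretch_stretch: "unstretch e (stretch e v) = v" "stretch e (unstretch e v) = v"
  using e1 by (simp_all add: stretch_def unstretch_def inner_diff_left inner_add_left algebra_simps)

lemma stretch_diff: "stretch e v - stretch e w = stretch e (v - w)"
  and unstretch_diff: "unstretch e v - unstretch e w = unstretch e (v - w)"
  by (simp_all add: stretch_def unstretch_def inner_diff_left algebra_simps diff_divide_distrib)

lemma norm_stretch_le: "norm (stretch e v) \<le> 2 * norm v"
proof -
  have "(norm (stretch e v))\<^sup>2 = 4 * (norm v)\<^sup>2 - 3 * (v \<bullet> e)\<^sup>2"
    using e1 unfolding stretch_def power2_norm_eq_inner
    by (simp add: inner_diff_left inner_diff_right inner_commute power2_eq_square)
  then have "(norm (stretch e v))\<^sup>2 \<le> (2 * norm v)\<^sup>2" by (simp add: power_mult_distrib)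
  then show ?thesis by (rule power2_le_imp_le) simp
qed

lemma norm_unstretch_le: "norm (unstretch e v) \<le> norm v"
proof -
  have "(norm (unstretch e v))\<^sup>2 = (1/4) * (norm v)\<^sup>2 + (3/4) * (v \<bullet> e)\<^sup>2"
    using e1 unfolding unstretch_def power2_norm_eq_inner
    by (simp add: inner_add_left inner_add_right inner_commute power2_eq_square field_simps)
  moreover have "(v \<bullet> e)\<^sup>2 \<le> (norm v)\<^sup>2"
    using sum_squares_inner_le[of v] zero_le_power2[of "v \<bullet> n"] by linarith
  ultimately have "(norm (unstretch e v))\<^sup>2 \<le> (norm v)\<^sup>2" by linarith
  then show ?thesis by (rule power2_le_imp_le) simp
qed

lemma stretch_inner:
  "stretch e v \<bullet> e = v \<bullet> e" "u \<bullet> e = 0 \<Longrightarrow> stretch e v \<bullet> u = 2 * (v \<bullet> u)"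
  using e1 by (simp_all add: stretch_def inner_diff_left inner_commute[of e u])

lemma cell_swap_inverse: "cell_swap e n c (- s) (cell_swap e n c s p) = p"
  by (simp add: cell_swap_def unstretch_stretch twist_inverse)

lemma cell_swap_lipschitz:
  assumes "\<bar>s\<bar> \<le> 1"
  shows "16-lipschitz_on UNIV (cell_swap e n c s)"
proof (rule lipschitz_onI)
  \<comment> \<open>Then \<open>2 * (1 + 2 * pi)\<close> is at most 16. The factor 2 is the price of
    \<open>stretch\<close>, whereas \<open>unstretch\<close> is a contraction in the weak sense.
    Machin's formula bounds pi by 16/5.\<close>
  have pi: "pi \<le> 7/2"
    using pi_machin arctan_le_self[of "1/5"] zero_le_arctan_iff[of "1/239"] by linarith
  fix p q
  have "norm (cell_swap e n c s p - cell_swap e n c s q)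
      \<le> norm (twist e n s (stretch e (p - c)) - twist e n s (stretch e (q - c)))"
    by (simp add: cell_swap_def unstretch_diff norm_unstretch_le)
  also have "\<dots> \<le> (1 + 2 * pi) * norm (stretch e (p - c) - stretch e (q - c))"
    using lipschitz_onD[OF twist_lipschitz[OF assms]] by (simp add: dist_norm)
  also have "\<dots> \<le> (1 + 2 * pi) * (2 * norm (p - q))"
    using norm_stretch_le[of "p - q"] by (intro mult_left_mono) (simp_all add: stretch_diff)
  also have "\<dots> \<le> 16 * norm (p - q)"
    using mult_right_mono[OF pi, of "norm (p - q)"] by (simp add: algebra_simps)
  finally show "dist (cell_swap e n c s p) (cell_swap e n c s q) \<le> 16 * dist p q" by (simp add: dist_norm)
qed simp

lemma cell_swap_bilipschitz: "bilipschitz_on 16 UNIV (cell_swap e n c 1)" "bij (cell_swap e n c 1)"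
proof -
  show "bilipschitz_on 16 UNIV (cell_swap e n c 1)"
    by (rule bilipschitz_on_inverseI[of "cell_swap e n c (-1)"])
       (use cell_swap_inverse[of c 1] cell_swap_lipschitz in auto)
  show "bij (cell_swap e n c 1)"
    by (rule o_bij[of "cell_swap e n c (-1)"])
       (use cell_swap_inverse[of c 1] cell_swap_inverse[of c "-1"] in \<open>auto simp: fun_eq_iff\<close>)
qed

lemma cell_swap_outside: "1 \<le> norm (stretch e (p - c)) \<Longrightarrow> cell_swap e n c s p = p"
  by (simp add: cell_swap_def twist_outside unstretch_stretch)

lemma cell_swap_half:
  assumes "p = c + (1/2) *\<^sub>R e \<or> p = c - (1/2) *\<^sub>R e"
  shows "cell_swap e n c 1 p = c - (p - c)"
proof -
  have "stretch e (p - c) = p - c"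
    using assms e1 by (auto simp: stretch_def algebra_simps) (simp_all flip: scaleR_add_left)
  moreover have "twist e n 1 (p - c) = - (p - c)"
    using assms by (intro twist_half) auto
  moreover have "unstretch e (- (p - c)) = - (p - c)"
    using assms e1 by (auto simp: unstretch_def algebra_simps simp flip: scaleR_add_left)
  ultimately show ?thesis by (simp add: cell_swap_def)
qed

end

lemma lat_nth [simp]: "lat z $ i = of_int (z i)"
  by (simp add: lat_def)

lemma inj_lat: "inj (lat :: ('m::finite \<Rightarrow> int) \<Rightarrow> real^'m)"
  by (auto simp: inj_def vec_eq_iff)

lemma range_lat: "range (lat :: ('m::finite \<Rightarrow> int) \<Rightarrow> real^'m) = int_lattice"
proof -
  have "x \<in> range lat" if "x \<in> int_lattice" for x :: "real^'m"
  proof -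
    have "x = lat (\<lambda>i. \<lfloor>x $ i\<rfloor>)"
      using that by (auto simp: vec_eq_iff int_lattice_def)
    then show ?thesis by blast
  qed
  then show ?thesis by (auto simp: int_lattice_def)
qed

text \<open>All swaps are carried out at once in cells around the midpoints of the pairs. The open
  cells are disjoint: on parallel lines they have half-width 1/2, and on one line two midpoints at
  distance 1 would need a point that belongs to two pairs of an involution.\<close>

lemma adjacent_involution_realizable:
  fixes \<tau> :: "('m::finite \<Rightarrow> int) \<Rightarrow> 'm \<Rightarrow> int"
  assumes inv: "\<And>z. \<tau> (\<tau> z) = z"
    and adj: "\<And>z. \<tau> z = z \<or> \<tau> z = z(a := z a + 1) \<or> \<tau> z = z(a := z a - 1)"
  shows "layer_realizable 16 \<tau>"
proof -
  define e :: "(real^'m) \<times> real" where "e = (axis a 1, 0)"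
  define n :: "(real^'m) \<times> real" where "n = (0, 1)"
  have e1: "e \<bullet> e = 1" and n1: "n \<bullet> n = 1" and en: "e \<bullet> n = 0"
    by (simp_all add: e_def n_def inner_axis_axis)
  \<comment> \<open>Every swapped pair is indexed once, by its lower end.\<close>
  define I where "I = {z. \<tau> z = z(a := z a + 1)}"
  define c where "c z = (lat z, 0) + (1/2) *\<^sub>R e" for z :: "'m \<Rightarrow> int"
  define U where "U z = {p. norm (stretch e (p - c z)) < 1}" for z :: "'m \<Rightarrow> int"
  \<comment> \<open>Only the bounding box of a cell matters below; it comes from pairing the
    stretched vector with unit vectors.\<close>
  have UD: "\<bar>fst p $ a - of_int (z a) - 1/2\<bar> < 1" "j \<noteq> a \<Longrightarrow> \<bar>fst p $ j - of_int (z j)\<bar> < 1/2"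
    "\<bar>snd p\<bar> < 1/2" if "p \<in> U z" for p z j
  proof -
    have less: "\<bar>stretch e (p - c z) \<bullet> u\<bar> < 1" if "norm u = 1" for u
      using Cauchy_Schwarz_ineq2[of "stretch e (p - c z)" u] \<open>p \<in> U z\<close> that by (simp add: U_def)
    have in_e: "v \<bullet> e = fst v $ a" and in_n: "v \<bullet> n = snd v"
      and in_j: "v \<bullet> (axis j 1, 0) = fst v $ j" for v :: "(real^'m) \<times> real" and j
      by (cases v; simp add: e_def n_def inner_axis)+
    have c: "fst (c z) $ a = of_int (z a) + 1/2" "k \<noteq> a \<Longrightarrow> fst (c z) $ k = of_int (z k)" "snd (c z) = 0" for k
      by (simp_all add: c_def e_def axis_def)
    have "norm e = 1" "norm n = 1" using e1 n1 by (simp_all add: norm_eq_1)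
    note 1 = less[OF this(1)] and 2 = less[OF this(2)]
    show "\<bar>fst p $ a - of_int (z a) - 1/2\<bar> < 1"
      using 1 stretch_inner(1)[OF e1 n1 en, of "p - c z"] by (simp add: in_e c diff_diff_eq)
    show "\<bar>snd p\<bar> < 1/2"
      using 2 stretch_inner(2)[OF e1 n1 en, of n "p - c z"] en inner_commute[of n e]
      by (simp add: in_n c)
    show "\<bar>fst p $ j - of_int (z j)\<bar> < 1/2" if "j \<noteq> a"
    proof -
      have "(axis j 1, 0) \<bullet> e = 0" using that by (simp add: e_def inner_axis_axis)
      moreover have "norm ((axis j 1, 0) :: (real^'m) \<times> real) = 1" by (simp add: norm_Pair)
      ultimately have "\<bar>2 * ((p - c z) \<bullet> (axis j 1, 0))\<bar> < 1"
        using less[of "(axis j 1, 0)"] stretch_inner(2)[OF e1 n1 en, of "(axis j 1, 0)" "p - c z"]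
        by simp
      then show ?thesis using that by (simp only: abs_mult in_j) (simp add: c)
    qed
  qed
  have \<tau>I: "\<tau> z a = z a + 1" "j \<noteq> a \<Longrightarrow> \<tau> z j = z j" if "z \<in> I" for z j
    using that by (simp_all add: I_def)
  have near: "x = z \<or> x = \<tau> z"
    if "z \<in> I" "\<And>j. j \<noteq> a \<Longrightarrow> x j = z j" "x a = z a \<or> x a = z a + 1" for x z
  proof -
    have "x k = z k" if "x a = z a" for k
      using that \<open>\<And>j. j \<noteq> a \<Longrightarrow> x j = z j\<close>[of k] by (cases "k = a") auto
    moreover have "x k = \<tau> z k" if "x a = z a + 1" for k
      using that \<open>\<And>j. j \<noteq> a \<Longrightarrow> x j = z j\<close>[of k] \<tau>I(1)[OF \<open>z \<in> I\<close>]
        \<tau>I(2)[OF \<open>z \<in> I\<close>, of k] by (cases "k = a") auto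
    ultimately show ?thesis using that(3) by blast
  qed
  obtain f where f: "bilipschitz_on 16 UNIV f" "bij f"
      "\<And>z x. z \<in> I \<Longrightarrow> x \<in> U z \<Longrightarrow> f x = cell_swap e n (c z) 1 x"
      "\<And>x. x \<notin> (\<Union>z\<in>I. U z) \<Longrightarrow> f x = x"
  proof (rule glue_bilipschitz[of I U 16 "\<lambda>z. cell_swap e n (c z) 1"])
    show "open (U z)" for z
      unfolding U_def stretch_def by (intro open_Collect_less continuous_intros)
    show "bilipschitz_on 16 UNIV (cell_swap e n (c z) 1)" "bij (cell_swap e n (c z) 1)" for z
      by (rule cell_swap_bilipschitz[OF e1 n1 en])+
    show "cell_swap e n (c z) 1 x = x" if "x \<notin> U z" for z x
      using that by (intro cell_swap_outside[OF e1 n1 en]) (simp add: U_def)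
    show "U z \<inter> U w = {}" if zw: "z \<in> I" "w \<in> I" "z \<noteq> w" for z w
    proof -
      have False if p: "p \<in> U z" "p \<in> U w" for p
      proof -
        have eq: "z j = w j" if "j \<noteq> a" for j
          using UD(2)[OF p(1) that] UD(2)[OF p(2) that] by linarith
        have "z a \<noteq> w a" using zw(3) eq by (metis ext)
        then have "z a = w a + 1 \<or> w a = z a + 1"
          using UD(1)[OF p(1)] UD(1)[OF p(2)] by linarith
        then have "z = \<tau> w \<or> w = \<tau> z"
          using near[OF zw(1), of w] near[OF zw(2), of z] eq \<open>z a \<noteq> w a\<close> by metis
        then show False
        proof
          assume "z = \<tau> w"
          then show False using inv[of w] \<tau>I(1)[OF zw(1)] \<tau>I(1)[OF zw(2)] by simp
        next
          assume "w = \<tau> z"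
          then show False using inv[of z] \<tau>I(1)[OF zw(1)] \<tau>I(1)[OF zw(2)] by simp
        qed
      qed
      then show ?thesis by blast
    qed
  qed auto
  have up: "(lat z, 0) \<in> U z \<and> (lat (\<tau> z), 0) \<in> U z \<and> f (lat z, 0) = (lat (\<tau> z), 0) \<and>
      f (lat (\<tau> z), 0) = (lat z, 0)" if "z \<in> I" for z
  proof -
    have eq: "(lat (\<tau> z), 0) = c z + (1/2) *\<^sub>R e" "(lat z, 0) = c z - (1/2) *\<^sub>R e"
      using \<tau>I[OF that] by (auto simp: c_def e_def vec_eq_iff axis_def)
    have "stretch e ((1/2) *\<^sub>R e) = (1/2) *\<^sub>R e" "stretch e (- (1/2) *\<^sub>R e) = - (1/2) *\<^sub>R e"
      using e1 by (simp_all add: stretch_def) (simp_all add: algebra_simps flip: scaleR_add_left)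
    moreover have "norm e = 1" using e1 by (simp add: norm_eq_1)
    ultimately have mem: "(lat z, 0) \<in> U z" "(lat (\<tau> z), 0) \<in> U z"
      unfolding eq U_def by simp_all
    have "cell_swap e n (c z) 1 (lat z, 0) = (lat (\<tau> z), 0)"
      using cell_swap_half[OF e1 n1 en, of "c z - (1/2) *\<^sub>R e" "c z"] unfolding eq by simp
    moreover have "cell_swap e n (c z) 1 (lat (\<tau> z), 0) = (lat z, 0)"
      using cell_swap_half[OF e1 n1 en, of "c z + (1/2) *\<^sub>R e" "c z"] unfolding eq by simp
    ultimately show ?thesis
      using f(3)[OF that] mem by simp
  qed
  have "f (lat z, 0) = (lat (\<tau> z), 0)" for z
  proof (cases "z \<in> I \<or> \<tau> z \<in> I")
    case True
    then show ?thesis using up inv by metis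
  next
    case False
    have "(lat z, 0) \<notin> U w" if "w \<in> I" for w
    proof
      assume u: "(lat z, 0) \<in> U w"
      have "z j = w j" if "j \<noteq> a" for j using UD(2)[OF u that] unfolding fst_conv lat_nth by linarith
      moreover have "z a = w a \<or> z a = w a + 1" using UD(1)[OF u] unfolding fst_conv lat_nth by linarith
      ultimately have "z = w \<or> z = \<tau> w" using near[OF \<open>w \<in> I\<close>] by blast
      then show False using False that inv by auto
    qed
    then have "f (lat z, 0) = (lat z, 0)" by (intro f(4)) auto
    moreover have "\<tau> z = z"
    proof (rule ccontr)
      assume "\<tau> z \<noteq> z"
      then have "\<tau> z = z(a := z a - 1)" using adj[of z] False by (auto simp: I_def)
      then have "z = (\<tau> z)(a := \<tau> z a + 1)" by simp
      then show False using False inv[of z] by (simp add: I_def)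
    qed
    ultimately show ?thesis by simp
  qed
  moreover have "f x = x" if "1/2 \<le> \<bar>snd x\<bar>" for x
  proof (rule f(4))
    show "x \<notin> (\<Union>z\<in>I. U z)"
    proof
      assume "x \<in> (\<Union>z\<in>I. U z)"
      then obtain z where "x \<in> U z" by auto
      then show False using UD(3)[of x z] that by simp
    qed
  qed
  ultimately show ?thesis
    unfolding layer_realizable_def using f(1) by blast
qed

section \<open>Routing block permutations\<close>

text \<open>All segments of length \<open>S\<close> in direction \<open>a\<close> are sorted in
  parallel. The rounds with the same number form one adjacent involution of the whole lattice, so
  there are \<open>S\<close> factors however many segments there are.\<close>

lemma line_permutation_realizable:
  fixes \<sigma> :: "('m::finite \<Rightarrow> int) \<Rightarrow> 'm \<Rightarrow> int"
  assumes S: "0 < S" and bij: "bij \<sigma>" and blk: "\<And>z. blk S (\<sigma> z) = blk S z"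
    and only: "\<And>z j. j \<noteq> a \<Longrightarrow> \<sigma> z j = z j"
  shows "layer_realizable (16 ^ S) \<sigma>"
proof -
  define site where "site w c i = w(a := int S * c + int i)" for w :: "'m \<Rightarrow> int" and c i
  define \<pi> where "\<pi> w c i = (if i < S then nat (\<sigma> (site w c i) a - int S * c) else i)"
    for w :: "'m \<Rightarrow> int" and c i
  have site_inj: "site w c i = site w c j \<longleftrightarrow> i = j" for w c i j
    by (auto simp: site_def fun_eq_iff)
  have sig: "\<sigma> (site w c i) = site w c (\<pi> w c i)" "\<pi> w c i < S" if "i < S" for w c i
  proof -
    have "\<sigma> (site w c i) a div int S = c"
      using blk_fun_updD[OF blk[of "site w c i"], of a] that by (simp add: site_def)
    then have b: "int S * c \<le> \<sigma> (site w c i) a" "\<sigma> (site w c i) a < int S * c + int S"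
      using int_div_bounds[OF S, of "\<sigma> (site w c i) a"] by auto
    then show "\<pi> w c i < S" using that by (simp add: \<pi>_def)
    show "\<sigma> (site w c i) = site w c (\<pi> w c i)"
      using b that only by (auto simp: fun_eq_iff \<pi>_def) (auto simp: site_def)
  qed
  have perm: "\<pi> w c permutes {..<S}" for w c
  proof (rule bij_imp_permutes)
    have inj: "inj_on (\<pi> w c) {..<S}"
    proof (rule inj_onI)
      fix i j assume ij: "i \<in> {..<S}" "j \<in> {..<S}" "\<pi> w c i = \<pi> w c j"
      then have "\<sigma> (site w c i) = \<sigma> (site w c j)" using sig by simp
      then show "i = j" using bij site_inj by (metis bij_is_inj injD)
    qed
    then show "bij_betw (\<pi> w c) {..<S} {..<S}"
      unfolding bij_betw_def using sig by (intro conjI endo_inj_surj) auto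
    show "\<pi> w c i = i" if "i \<notin> {..<S}" for i using that by (simp add: \<pi>_def)
  qed
  have "\<forall>w c. \<exists>\<tau>. compose_upto \<tau> S = \<pi> w c \<and> (\<forall>t i. \<tau> t (\<tau> t i) = i) \<and> (\<forall>t i. S \<le> i \<longrightarrow> \<tau> t i = i)
      \<and> (\<forall>t i. \<tau> t i = i \<or> \<tau> t i = Suc i \<or> i = Suc (\<tau> t i))"
    using adjacent_transposition_rounds[OF perm] by metis
  then obtain \<tau> where \<tau>: "\<And>w c. compose_upto (\<tau> w c) S = \<pi> w c"
      "\<And>w c t i. \<tau> w c t (\<tau> w c t i) = i" "\<And>w c t i. S \<le> i \<Longrightarrow> \<tau> w c t i = i"
      "\<And>w c t i. \<tau> w c t i = i \<or> \<tau> w c t i = Suc i \<or> i = Suc (\<tau> w c t i)"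
    by metis
  have \<tau>_less: "\<tau> w c t i < S \<longleftrightarrow> i < S" for w c t i
    by (metis \<tau>(2,3) linorder_not_less)
  \<comment> \<open>\<open>z(a := 0)\<close> names the line through \<open>z\<close> without regard
    to the position on it, so all sites of a segment follow the same sorting process.\<close>
  define T where "T t z = site z (z a div int S)
      (\<tau> (z(a := 0)) (z a div int S) t (nat (z a mod int S)))" for t z
  have decomp: "z = site z (z a div int S) (nat (z a mod int S))" "nat (z a mod int S) < S" for z
    using S by (auto simp: site_def fun_eq_iff nat_less_iff)
  have T_site: "T t (site w c i) = site w c (\<tau> (w(a := 0)) c t i)" if "i < S" for t w c i
    using that by (simp add: T_def site_def)
  have T_inv: "T t (T t z) = z" for t z
    by (subst (1 2) decomp(1)[of z]) (simp add: T_site decomp(2) \<tau>_less \<tau>(2) del: fun_upd_apply)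
  have T_adj: "T t z = z \<or> T t z = z(a := z a + 1) \<or> T t z = z(a := z a - 1)" for t z
  proof -
    have "site w c j = site w c i \<or> site w c j = (site w c i)(a := site w c i a + 1)
        \<or> site w c j = (site w c i)(a := site w c i a - 1)" if "j = i \<or> j = Suc i \<or> i = Suc j" for w c i j
      using that by (auto simp: site_def fun_eq_iff)
    from this[OF \<tau>(4)] T_site[OF decomp(2)] show ?thesis
      by (metis decomp(1))
  qed
  have "compose_upto T n (site w c i) = site w c (compose_upto (\<tau> (w(a := 0)) c) n i) \<and>
      compose_upto (\<tau> (w(a := 0)) c) n i < S" if "i < S" for n w c i
    using that by (induction n) (auto simp: T_site \<tau>_less)
  then have "compose_upto T S (site w c i) = \<sigma> (site w c i)" if "i < S" for w c i
    using that sig \<tau>(1) by (simp add: \<pi>_def site_def)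
  then have "compose_upto T S = \<sigma>"
    using decomp by (metis ext)
  moreover have "layer_realizable (16 ^ n) (compose_upto T n)" for n
  proof (induction n)
    case 0 then show ?case using layer_realizable_id by (simp only: compose_upto.simps power_0)
  next
    case (Suc n)
    have "layer_realizable 16 (T n)"
      by (rule adjacent_involution_realizable[of _ a]) (use T_inv T_adj in auto)
    from layer_realizable_compose[OF this Suc] show ?case
      by (simp only: compose_upto.simps power_Suc)
  qed
  ultimately show ?thesis by metis
qed

text \<open>This makes the multigraph of lines regular of degree \<open>S\<close>.\<close>

lemma card_line_fibre:
  fixes z :: "'m \<Rightarrow> int"
  assumes S: "0 < S"
  shows "card {w. blk S w = blk S z \<and> w(a := 0) = z(a := 0)} = S"
proof -
  let ?I = "{int S * (z a div int S) ..< int S * (z a div int S) + int S}"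
  have "bij_betw (\<lambda>k. z(a := k)) ?I {w. blk S w = blk S z \<and> w(a := 0) = z(a := 0)}"
    unfolding bij_betw_def
  proof (intro conjI set_eqI iffI)
    show "inj_on (\<lambda>k. z(a := k)) ?I" by (auto simp: inj_on_def fun_eq_iff)
    fix w
    show "w \<in> {w. blk S w = blk S z \<and> w(a := 0) = z(a := 0)}" if w: "w \<in> (\<lambda>k. z(a := k)) ` ?I"
    proof -
      obtain k where k: "w = z(a := k)" "k \<in> ?I" using w by blast
      have "k div int S = z a div int S"
        using k(2) by (intro int_div_eqI) auto
      then show ?thesis using k by (auto simp: blk_def fun_eq_iff)
    qed
    assume w: "w \<in> {w. blk S w = blk S z \<and> w(a := 0) = z(a := 0)}"
    then have d: "w a div int S = z a div int S" by (auto dest: blk_fun_updD)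
    have "int S * (w a div int S) \<le> w a" "w a < int S * (w a div int S) + int S"
      by (rule int_div_bounds[OF S])+
    moreover have "w = z(a := w a)" using w by (auto simp: fun_eq_iff split: if_splits)
    ultimately show "w \<in> (\<lambda>k. z(a := k)) ` ?I" using d by (metis atLeastLessThan_iff imageI)
  qed
  then show ?thesis using bij_betw_same_card by fastforce
qed

text \<open>Three-stage routing: a proper colouring of the edges joining source line to target line
  tells where to park each point on its own line, so that the points parked at equal height
  along \<open>a\<close> can be permuted by moving the coordinates in \<open>A\<close> only.\<close>
lemma block_permutation_realizable:
  fixes \<sigma> :: "('m::finite \<Rightarrow> int) \<Rightarrow> 'm \<Rightarrow> int"
  assumes S: "0 < S" and "finite A" and "bij \<sigma>" and "\<And>z. blk S (\<sigma> z) = blk S z"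
    and "\<And>z j. j \<notin> A \<Longrightarrow> \<sigma> z j = z j"
  shows "layer_realizable (16 ^ (2 * card A * S)) \<sigma>"
  using assms(2-)
proof (induction A arbitrary: \<sigma> rule: finite_induct)
  case empty
  then have "\<sigma> = id" by (auto simp: fun_eq_iff)
  then show ?case using layer_realizable_id by (metis card.empty mult_0 mult_0_right power_0)
next
  case (insert a A)
  note bij = insert.prems(1) and blk = insert.prems(2) and only = insert.prems(3)
  \<comment> \<open>Within a block the vertices are the lines in direction \<open>a\<close> and the
    edges are the points: \<open>z\<close> joins its own line to the line of
    \<open>\<sigma> z\<close>.\<close>
  have "\<forall>b. \<exists>c. (\<forall>z\<in>{z. blk S z = b}. c z < S) \<and> inj_on (\<lambda>z. (z(a := 0), c z)) {z. blk S z = b} \<and>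
      inj_on (\<lambda>z. ((\<sigma> z)(a := 0), c z)) {z. blk S z = b}"
  proof (rule allI, rule regular_bipartite_edge_colouring[OF finite_blk[OF S]])
    fix b z :: "'m \<Rightarrow> int" assume z: "z \<in> {z. blk S z = b}"
    show "card {w \<in> {z. blk S z = b}. w(a := 0) = z(a := 0)} = S"
      using card_line_fibre[OF S, of z a] z by simp
    let ?X = "{w. blk S w = blk S (\<sigma> z) \<and> w(a := 0) = (\<sigma> z)(a := 0)}"
    have "{w \<in> {z. blk S z = b}. (\<sigma> w)(a := 0) = (\<sigma> z)(a := 0)} = \<sigma> -` ?X"
      using z by (simp add: blk vimage_def)
    moreover have "card (\<sigma> -` ?X) = card ?X"
      using bij by (intro card_vimage_inj) (simp_all add: bij_is_inj bij_is_surj)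
    ultimately show "card {w \<in> {z. blk S z = b}. (\<sigma> w)(a := 0) = (\<sigma> z)(a := 0)} = S"
      using card_line_fibre[OF S, of "\<sigma> z" a] by simp
  qed
  from choice[OF this] obtain cc where
    cc: "\<forall>b. (\<forall>z\<in>{z. blk S z = b}. cc b z < S) \<and> inj_on (\<lambda>z. (z(a := 0), cc b z)) {z. blk S z = b} \<and>
      inj_on (\<lambda>z. ((\<sigma> z)(a := 0), cc b z)) {z. blk S z = b}" ..
  have cc1: "cc (blk S z) z < S" for z using cc by blast
  have cc2: "inj_on (\<lambda>z. (z(a := 0), cc b z)) {z. blk S z = b}" for b using cc by blast
  have cc3: "inj_on (\<lambda>z. ((\<sigma> z)(a := 0), cc b z)) {z. blk S z = b}" for b using cc by blast
  define c where "c z = cc (blk S z) z" for z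
  have c_less: "c z < S" for z by (simp add: c_def cc1)
  \<comment> \<open>The colour serves as the height along \<open>a\<close>, used both on the source
    line by \<open>park\<close> and on the target line by \<mu>. Properness of the colouring at the
    left ends makes \<open>park\<close> injective, at the right ends \<mu>.\<close>
  define park where "park z = z(a := int S * (z a div int S) + int (c z))" for z
  define \<mu> where "\<mu> z = (\<sigma> z)(a := int S * (\<sigma> z a div int S) + int (c z))" for z
  have park_blk: "blk S (park z) = blk S z" and \<mu>_blk: "blk S (\<mu> z) = blk S z" for z
    unfolding park_def \<mu>_def by (simp_all only: blk_fun_upd[OF S c_less] blk)
  have "inj park"
  proof (rule injI)
    fix z w assume e: "park z = park w"
    then have b: "blk S z = blk S w" by (metis park_blk)
    have "z(a := 0) = w(a := 0)" using e unfolding park_def by (metis fun_upd_upd)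
    moreover have "c z = c w"
      using fun_cong[OF e, of a] blk_fun_updD[OF b, of a] by (simp add: park_def)
    ultimately show "z = w" using inj_onD[OF cc2[of "blk S w"], of z w] b by (simp add: c_def)
  qed
  then have bij_park: "bij park" using bij_if_blk_preserving[OF S] park_blk by blast
  have "inj \<mu>"
  proof (rule injI)
    fix z w assume e: "\<mu> z = \<mu> w"
    then have b: "blk S z = blk S w" by (metis \<mu>_blk)
    have "(\<sigma> z)(a := 0) = (\<sigma> w)(a := 0)" using e unfolding \<mu>_def by (metis fun_upd_upd)
    moreover have "\<sigma> z a div int S = \<sigma> w a div int S" using b blk blk_fun_updD by metis
    then have "c z = c w"
      using fun_cong[OF e, of a] by (simp add: \<mu>_def)
    ultimately show "z = w" using inj_onD[OF cc3[of "blk S w"], of z w] b by (simp add: c_def)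
  qed
  then have bij_\<mu>: "bij \<mu>" using bij_if_blk_preserving[OF S] \<mu>_blk by blast
  have inv_park: "park (inv park z) = z" and inv_\<mu>: "\<mu> (inv \<mu> z) = z" for z
    using bij_park bij_\<mu> by (simp_all add: bij_is_surj surj_f_inv_f)
  have 1: "layer_realizable (16 ^ S) park"
    by (rule line_permutation_realizable[OF S bij_park park_blk, of a]) (simp add: park_def)
  \<comment> \<open>Both positions of a point now agree in the coordinate \<open>a\<close>, so the
    induction hypothesis for \<open>A\<close> applies. The line stages before and after it add
    \<open>2 * S\<close> to the exponent.\<close>
  have 2: "layer_realizable (16 ^ (2 * card A * S)) (\<mu> \<circ> inv park)"
  proof (rule insert.IH)
    show "bij (\<mu> \<circ> inv park)" by (intro bij_comp bij_imp_bij_inv bij_park bij_\<mu>)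
    show "blk S ((\<mu> \<circ> inv park) z) = blk S z" for z
      using \<mu>_blk park_blk[of "inv park z"] by (simp add: inv_park)
    show "(\<mu> \<circ> inv park) z j = z j" if "j \<notin> A" for z j
    proof -
      define w where "w = inv park z"
      have "\<mu> w j = park w j"
        using only[of j w] that blk_fun_updD[OF blk[of w], of a] by (auto simp: \<mu>_def park_def)
      then show ?thesis using inv_park[of z] by (simp add: w_def)
    qed
  qed
  have 3: "layer_realizable (16 ^ S) (\<sigma> \<circ> inv \<mu>)"
  proof (rule line_permutation_realizable[OF S, of _ a])
    show "bij (\<sigma> \<circ> inv \<mu>)" by (intro bij_comp bij_imp_bij_inv bij bij_\<mu>)
    show "blk S ((\<sigma> \<circ> inv \<mu>) z) = blk S z" for z
      using blk \<mu>_blk[of "inv \<mu> z"] by (simp add: inv_\<mu>)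
    show "(\<sigma> \<circ> inv \<mu>) z j = z j" if "j \<noteq> a" for z j
    proof -
      have "\<sigma> (inv \<mu> z) j = \<mu> (inv \<mu> z) j" using that by (simp add: \<mu>_def)
      then show ?thesis by (simp add: inv_\<mu>)
    qed
  qed
  have "(\<sigma> \<circ> inv \<mu>) \<circ> ((\<mu> \<circ> inv park) \<circ> park) = \<sigma>"
    using bij_park bij_\<mu> by (auto simp: fun_eq_iff bij_is_inj inv_f_f)
  then have "layer_realizable (16 ^ S * (16 ^ (2 * card A * S) * 16 ^ S)) \<sigma>"
    using layer_realizable_compose[OF 3 layer_realizable_compose[OF 2 1]] by metis
  moreover have "(16::real) ^ S * (16 ^ (2 * card A * S) * 16 ^ S) = 16 ^ (2 * card (insert a A) * S)"
    using insert.hyps by (simp add: algebra_simps flip: power_add)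
  ultimately show ?case by metis
qed

text \<open>Owing to the offset 1/2 no integer vector lies on the boundary of a cube, so the closed
  cubes split the lattice exactly as \<open>div\<close> does.\<close>

lemma lat_in_block_iff:
  fixes z w :: "'m::finite \<Rightarrow> int"
  assumes S: "0 < S"
  shows "lat z \<in> block S (lat w) \<longleftrightarrow> blk S z = w"
proof -
  have "real S * of_int (w i) - 1/2 \<le> of_int (z i) \<and> of_int (z i) \<le> real S * of_int (w i) + real S - 1/2
      \<longleftrightarrow> z i div int S = w i" for i
  proof -
    have half: "of_int x - 1/2 \<le> (of_int y :: real) \<longleftrightarrow> x \<le> y" for x y :: int
      by linarith
    have "real S * of_int (w i) - 1/2 \<le> of_int (z i) \<longleftrightarrow> int S * w i \<le> z i"
      using half[of "int S * w i" "z i"] by simp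
    moreover have "of_int (z i) \<le> real S * of_int (w i) + real S - 1/2 \<longleftrightarrow> z i < int S * w i + int S"
      using half[of "z i + 1" "int S * w i + int S"] by (simp add: algebra_simps) linarith
    moreover have "int S * w i \<le> z i \<and> z i < int S * w i + int S \<longleftrightarrow> z i div int S = w i"
      using int_div_eqI int_div_bounds[OF S] by metis
    ultimately show ?thesis by simp
  qed
  then show ?thesis by (auto simp: block_def blk_def fun_eq_iff)
qed

lemma block_perm_imp_lattice_permutation:
  fixes \<sigma> :: "real^'m::finite \<Rightarrow> real^'m"
  assumes S: "0 < S" and \<sigma>: "block_perm S \<sigma>"
  obtains \<sigma>' where "bij \<sigma>'" "\<And>z. blk S (\<sigma>' z) = blk S z" "\<And>z. \<sigma> (lat z) = lat (\<sigma>' z)"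
proof -
  have b: "bij_betw \<sigma> int_lattice int_lattice"
    and bz: "bij_betw \<sigma> (int_lattice \<inter> block S (lat w)) (int_lattice \<inter> block S (lat w))" for w
    using \<sigma> range_lat by (auto simp: block_perm_def)
  have "\<exists>w. \<sigma> (lat z) = lat w" for z
    using b range_lat by (metis bij_betw_apply rangeI imageE)
  then obtain \<sigma>' where \<sigma>': "\<And>z. \<sigma> (lat z) = lat (\<sigma>' z)" by metis
  have blk: "blk S (\<sigma>' z) = blk S z" for z
  proof -
    have "lat z \<in> int_lattice \<inter> block S (lat (blk S z))"
      using range_lat lat_in_block_iff[OF S] by blast
    then have "lat (\<sigma>' z) \<in> block S (lat (blk S z))"
      using bij_betw_apply[OF bz] \<sigma>' by fastforce
    then show ?thesis by (simp add: lat_in_block_iff[OF S])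
  qed
  have "inj \<sigma>'"
  proof (rule injI)
    fix x y assume "\<sigma>' x = \<sigma>' y"
    then have "\<sigma> (lat x) = \<sigma> (lat y)" by (simp add: \<sigma>')
    then have "lat x = lat y" using b range_lat unfolding bij_betw_def by (metis inj_on_eq_iff rangeI)
    then show "x = y" by (rule injD[OF inj_lat])
  qed
  then show ?thesis using that bij_if_blk_preserving[OF S _ blk] blk \<sigma>' by blast
qed

lemma lattice_permutation_imp_block_perm:
  fixes \<sigma> :: "('m::finite \<Rightarrow> int) \<Rightarrow> 'm \<Rightarrow> int"
  assumes S: "0 < S" and bij: "bij \<sigma>" and blk: "\<And>z. blk S (\<sigma> z) = blk S z"
  shows "block_perm S (\<lambda>x. lat (\<sigma> (inv lat x)))"
proof -
  let ?f = "\<lambda>x. lat (\<sigma> (inv lat x))"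
  have *: "bij_betw ?f (lat ` X) (lat ` X)" if "\<sigma> ` X = X" for X
  proof -
    have "bij_betw (inv lat) (lat ` X) X"
      by (rule inj_imp_bij_betw_inv[OF inj_lat])
    moreover have "bij_betw \<sigma> X X"
      using that inj_on_subset[OF bij_is_inj[OF bij]] by (simp add: bij_betw_def)
    moreover have "bij_betw lat X (lat ` X)"
      using inj_on_subset[OF inj_lat] by (simp add: bij_betw_def)
    ultimately have "bij_betw (lat \<circ> (\<sigma> \<circ> inv lat)) (lat ` X) (lat ` X)"
      by (meson bij_betw_trans)
    then show ?thesis by (simp add: comp_def)
  qed
  have "bij_betw ?f int_lattice int_lattice"
    using *[of UNIV] bij by (simp add: range_lat bij_is_surj)
  moreover have "bij_betw ?f (int_lattice \<inter> block S z) (int_lattice \<inter> block S z)" if z: "z \<in> int_lattice" for z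
  proof -
    obtain w where w: "z = lat w" using z range_lat by blast
    have eq: "int_lattice \<inter> block S z = lat ` {v. blk S v = w}"
      unfolding w range_lat[symmetric] using lat_in_block_iff[OF S] by blast
    have "\<sigma> ` {v. blk S v = w} = {v. blk S v = w}"
      by (intro endo_inj_surj finite_blk[OF S] inj_on_subset[OF bij_is_inj[OF bij]]) (use blk in auto)
    then show ?thesis using * eq by simp
  qed
  ultimately show ?thesis by (simp add: block_perm_def)
qed

text \<open>There are \<open>2 * (d - 1)\<close> line stages of \<open>S\<close> rounds, each
  costing 16, that is \<open>2 ^ (8 * (d - 1) * S)\<close> in total.\<close>

lemma admissible_exponential:
  "admissible TYPE('m::finite) (\<lambda>t. 2 powr (8 * (real CARD('m) + 1) * t))"
  unfolding admissible_def
proof (intro conjI allI impI)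
  show "mono_on {1..} (\<lambda>t. 2 powr (8 * (real CARD('m) + 1) * t))"
    by (intro mono_onI powr_mono mult_left_mono) auto
  show "(\<lambda>t. 2 powr (8 * (real CARD('m) + 1) * t)) ` {1..} \<subseteq> {1..}"
    by (auto intro!: ge_one_powr_ge_zero)
  fix S :: nat and \<sigma> :: "real^'m \<Rightarrow> real^'m"
  assume S: "1 \<le> S" and \<sigma>: "block_perm S \<sigma>"
  have S0: "0 < S" using S by simp
  obtain \<sigma>' where \<sigma>': "bij \<sigma>'" "\<And>z. blk S (\<sigma>' z) = blk S z" "\<And>z. \<sigma> (lat z) = lat (\<sigma>' z)"
    using block_perm_imp_lattice_permutation[OF S0 \<sigma>] by blast
  have "layer_realizable (16 ^ (2 * CARD('m) * S)) \<sigma>'"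
    by (rule block_permutation_realizable[OF S0 finite \<sigma>'(1,2)]) simp
  then obtain F :: "(real^'m) \<times> real \<Rightarrow> (real^'m) \<times> real" where
    F: "bilipschitz_on (16 ^ (2 * CARD('m) * S)) UNIV F" "\<And>x. \<bar>snd x\<bar> \<ge> 1/2 \<Longrightarrow> F x = x"
      "\<And>z. F (lat z, 0) = (lat (\<sigma>' z), 0)"
    using layer_realizableE by blast
  have "(16::real) ^ (2 * CARD('m) * S) = 2 powr (8 * real CARD('m) * real S)"
  proof -
    have "(16::real) ^ (2 * CARD('m) * S) = (2 ^ 4) ^ (2 * CARD('m) * S)" by simp
    also have "\<dots> = 2 ^ (4 * (2 * CARD('m) * S))" by (rule power_mult[symmetric])
    also have "\<dots> = 2 powr real (4 * (2 * CARD('m) * S))" by (rule powr_realpow[symmetric]) simp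
    finally show ?thesis by (simp add: mult.assoc)
  qed
  also have "\<dots> \<le> 2 powr (8 * (real CARD('m) + 1) * real S)"
    by (intro powr_mono) (simp_all add: algebra_simps)
  finally have "bilipschitz_on (2 powr (8 * (real CARD('m) + 1) * real S)) UNIV F"
    using bilipschitz_on_mono[OF F(1)] by blast
  moreover have "F (x, 0) = (\<sigma> x, 0)" if x: "x \<in> int_lattice" for x
  proof -
    obtain z where "x = lat z" using x range_lat by blast
    then show ?thesis using F(3) \<sigma>'(3) by simp
  qed
  ultimately show "\<exists>\<Upsilon> :: (real^'m) \<times> real \<Rightarrow> (real^'m) \<times> real. bilipschitz_on (2 powr (8 * (real CARD('m) + 1) * real S)) UNIV \<Upsilon> \<and>
      (\<forall>x. 1 / 2 \<le> \<bar>snd x\<bar> \<longrightarrow> \<Upsilon> x = x) \<and> (\<forall>x\<in>int_lattice. \<Upsilon> (x, 0) = (\<sigma> x, 0))"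
    using F(2) by blast
qed

section \<open>Bounds for beta\<close>

lemma bilipschitz_on_inj: "bilipschitz_on L X f \<Longrightarrow> inj_on f X"
  by (simp add: bilipschitz_on_def)

lemma bilipschitz_on_continuous: "bilipschitz_on L X f \<Longrightarrow> continuous_on X f"
  by (auto simp: bilipschitz_on_def intro: lipschitz_on_continuous_on)

text \<open>In the plane the image of the segment over \<open>0\<close> has to avoid the image of the segment
  over \<open>c\<close>, which leads from \<open>0\<close> to the upper boundary line. It can only do so by first
  passing on the far side of \<open>0\<close>, and this detour costs the constant \<open>2 c + 1\<close>.\<close>
lemma planar_swap_crosses_ray:
  fixes \<Upsilon> :: "(real^'m::finite) \<times> real \<Rightarrow> (real^'m) \<times> real"
  assumes one: "CARD('m) = 1" and lip: "bilipschitz_on L UNIV \<Upsilon>"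
    and fix_out: "\<And>x. \<bar>snd x\<bar> \<ge> 1/2 \<Longrightarrow> \<Upsilon> x = x"
    and c: "0 < c $ k" and swap: "\<Upsilon> (c, 0) = (0, 0)"
  obtains s x where "\<bar>s\<bar> \<le> 1/2" "x $ k \<le> 0" "\<Upsilon> (0, s) = (x, 0)"
proof -
  have all_k: "i = k" for i :: 'm
    using one by (metis card_1_singletonE UNIV_I singletonD)
  have inj: "inj \<Upsilon>" by (rule bilipschitz_on_inj[OF lip])
  have cont: "continuous_on A \<Upsilon>" for A
    using bilipschitz_on_continuous[OF lip] continuous_on_subset by blast
  \<comment> \<open>The index type has a single element, so the space is a plane; the crossing
    theorem for paths in a rectangle is available for \<open>real^2\<close>.\<close>
  define J :: "(real^'m) \<times> real \<Rightarrow> real^2" where "J p = (\<chi> i. if i = 1 then fst p $ k else snd p)" for p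
  have J1: "J p $ 1 = fst p $ k" and J2: "J p $ 2 = snd p" for p
    by (simp_all add: J_def)
  have J_eq: "J p = J q \<longleftrightarrow> p = q" for p q
  proof
    assume "J p = J q"
    then have "fst p $ k = fst q $ k" "snd p = snd q" by (metis J1, metis J2)
    then show "p = q" by (metis all_k prod_eqI vec_eq_iff)
  qed simp
  have cont_J: "continuous_on A J" for A
    unfolding J_def
  proof (rule continuous_on_vec_lambda)
    show "continuous_on A (\<lambda>p :: (real^'m) \<times> real. if i = 1 then fst p $ k else snd p)" for i :: 2
      by (cases "i = 1") (auto intro!: continuous_intros)
  qed
  define a where "a u = J (\<Upsilon> (0, u - 1/2))" for u
  define b where "b u = J (\<Upsilon> (c, u / 2))" for u
  have path_a: "path a" and path_b: "path b"
    unfolding path_def a_def b_def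
    by (intro continuous_on_compose2[OF cont_J _ subset_UNIV] continuous_on_compose2[OF cont _ subset_UNIV]
        continuous_intros; simp)+
  have strip: "\<bar>snd (\<Upsilon> p)\<bar> \<le> 1/2" if "\<bar>snd p\<bar> \<le> 1/2" for p
  proof (rule ccontr)
    assume n: "\<not> \<bar>snd (\<Upsilon> p)\<bar> \<le> 1/2"
    then have "\<Upsilon> (\<Upsilon> p) = \<Upsilon> p" by (intro fix_out) simp
    then have "\<Upsilon> p = p" using inj by (simp add: inj_eq)
    then show False using that n by simp
  qed
  have "bounded (path_image a \<union> path_image b)"
    using path_a path_b by (simp add: bounded_path_image)
  then obtain R where R: "\<And>z. z \<in> path_image a \<union> path_image b \<Longrightarrow> norm z \<le> R"
    by (auto simp: bounded_iff)
  define M where "M = max R (c $ k + 1)"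
  have M: "c $ k < M" "0 < M" using c by (auto simp: M_def)
  have R1: "\<bar>z $ 1\<bar> \<le> M" if "z \<in> path_image a \<union> path_image b" for z
    using R[OF that] component_le_norm_cart[of z 1] by (simp add: M_def)
  have R2: "\<bar>z $ 2\<bar> \<le> 1/2" if z: "z \<in> path_image a \<union> path_image b" for z
  proof -
    obtain u where u: "u \<in> {0..1}" "z = a u \<or> z = b u" using z unfolding path_image_def by blast
    have "\<bar>u - 1/2\<bar> \<le> 1/2" "\<bar>u / 2\<bar> \<le> 1/2" using u(1) unfolding abs_le_iff atLeastAtMost_iff by linarith+
    then show ?thesis
      using u(2) strip[of "(0, u - 1/2)"] strip[of "(c, u / 2)"] unfolding a_def b_def by (metis J2 snd_conv)
  qed
  define p0 p1 p2 p3 :: "real^2" where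
    "p0 = J ((\<chi> i. - M), 0)" and "p1 = J (0, 0)" and "p2 = J (c, 1/2)" and "p3 = J ((\<chi> i. M), 1/2)"
  \<comment> \<open>From the left side along the ray to the origin, which is the image of
    \<open>(c, 0)\<close>, then along the image of the segment over \<open>c\<close> up to the top
    line, and on to the right side. The path \<open>a\<close> joins bottom to top, so the two meet;
    injectivity leaves only the ray as the place.\<close>
  define g where "g = linepath p0 p1 +++ (b +++ linepath p2 p3)"
  have b_ends: "pathstart b = p1" "pathfinish b = p2"
    using swap fix_out[of "(c, 1/2)"] by (simp_all add: pathstart_def pathfinish_def b_def p1_def p2_def)
  have path_g: "path g" and im_g: "path_image g = closed_segment p0 p1 \<union> path_image b \<union> closed_segment p2 p3"
    unfolding g_def using path_b b_ends by (auto simp: path_image_join)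
  define lo up :: "real^2" where "lo = J ((\<chi> i. - M), - 1/2)" and "up = J ((\<chi> i. M), 1/2)"
  have box: "z \<in> cbox lo up \<longleftrightarrow> \<bar>z $ 1\<bar> \<le> M \<and> \<bar>z $ 2\<bar> \<le> 1/2" for z
    by (auto simp: mem_box_cart forall_2 lo_def up_def J1 J2)
  have "closed_segment p0 p1 \<subseteq> cbox lo up" "closed_segment p2 p3 \<subseteq> cbox lo up"
    by (intro closed_segment_subset convex_box(1);
        use M c in \<open>simp add: box p0_def p1_def p2_def p3_def J1 J2\<close>)+
  then have sub: "path_image g \<subseteq> cbox lo up" "path_image a \<subseteq> cbox lo up"
    using R1 R2 by (auto simp: im_g box)
  obtain z where z: "z \<in> path_image g" "z \<in> path_image a"
  proof (rule fashoda[OF path_g path_a sub])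
    show "pathstart g $ 1 = lo $ 1" "pathfinish g $ 1 = up $ 1"
      by (simp_all add: g_def p0_def p3_def lo_def up_def J1)
    show "pathstart a $ 2 = lo $ 2" "pathfinish a $ 2 = up $ 2"
      using fix_out[of "(0, - 1/2)"] fix_out[of "(0, 1/2)"]
      by (simp_all add: pathstart_def pathfinish_def a_def lo_def up_def J2)
  qed
  then obtain u where u: "u \<in> {0..1}" "z = J (\<Upsilon> (0, u - 1/2))"
    by (auto simp: path_image_def a_def)
  have "0 \<noteq> c" using c by auto
  have "z \<notin> path_image b"
  proof
    assume "z \<in> path_image b"
    then obtain v where "z = J (\<Upsilon> (c, v / 2))" by (auto simp: path_image_def b_def)
    then have "(0, u - 1/2) = (c, v / 2)" using u(2) inj by (simp add: J_eq inj_eq)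
    then show False using \<open>0 \<noteq> c\<close> by simp
  qed
  moreover have "z \<notin> closed_segment p2 p3"
  proof
    assume "z \<in> closed_segment p2 p3"
    then obtain v where v: "0 \<le> v" "v \<le> 1" "z = (1 - v) *\<^sub>R p2 + v *\<^sub>R p3" by (auto simp: in_segment)
    have z2: "z $ 2 = 1/2" by (simp add: v(3) p2_def p3_def J2 algebra_simps)
    have "z $ 1 = (1 - v) * c $ k + v * M" by (simp add: v(3) p2_def p3_def J1)
    also have "\<dots> \<ge> (1 - v) * c $ k + v * c $ k" using v M by (intro add_left_mono mult_left_mono) auto
    finally have z1: "0 < z $ 1" using c by (simp add: algebra_simps)
    let ?q = "\<Upsilon> (0, u - 1/2)"
    have "snd ?q = 1/2" "0 < fst ?q $ k" using z1 z2 u(2) by (simp_all add: J1 J2)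
    then have "\<Upsilon> ?q = ?q" by (intro fix_out) simp
    then have "?q = (0, u - 1/2)" using inj by (simp add: inj_eq)
    then show False using \<open>0 < fst ?q $ k\<close> by simp
  qed
  ultimately have "z \<in> closed_segment p0 p1" using z(1) im_g by blast
  then obtain v where v: "0 \<le> v" "v \<le> 1" "z = (1 - v) *\<^sub>R p0 + v *\<^sub>R p1" by (auto simp: in_segment)
  have "z $ 2 = 0" by (simp add: v(3) p0_def p1_def J2)
  moreover have "z $ 1 \<le> 0" using v M by (simp add: v(3) p0_def p1_def J1 mult_nonneg_nonneg)
  ultimately have "snd (\<Upsilon> (0, u - 1/2)) = 0" "fst (\<Upsilon> (0, u - 1/2)) $ k \<le> 0"
    using u(2) by (simp_all add: J1 J2)
  moreover have "\<bar>u - 1/2\<bar> \<le> 1/2" using u(1) unfolding abs_le_iff atLeastAtMost_iff by linarith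
  ultimately show ?thesis using that by (metis prod.collapse)
qed

lemma dist_Pair_ge: "dist a c \<le> dist (a, b) (c, d)" "dist b d \<le> dist (a, b) (c, d)"
  by (simp_all add: dist_Pair_Pair)

text \<open>The vertical segment of length 1/2 from \<open>(0, 0)\<close> to the boundary line on
  the side of \<open>s\<close> has an image that runs from \<open>(c, 0)\<close> to the far side of
  the origin, over a distance of at least \<open>c $ k\<close>, and then to the line, over another
  1/2. Hence \<open>L / 2\<close> is at least their sum.\<close>

lemma planar_swap_lower_bound:
  fixes \<Upsilon> :: "(real^'m::finite) \<times> real \<Rightarrow> (real^'m) \<times> real"
  assumes one: "CARD('m) = 1" and lip: "bilipschitz_on L UNIV \<Upsilon>"
    and fix_out: "\<And>x. \<bar>snd x\<bar> \<ge> 1/2 \<Longrightarrow> \<Upsilon> x = x"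
    and c: "0 < c $ k" and swap: "\<Upsilon> (c, 0) = (0, 0)" "\<Upsilon> (0, 0) = (c, 0)"
  shows "2 * c $ k + 1 \<le> L"
proof -
  obtain s x where s: "\<bar>s\<bar> \<le> 1/2" "x $ k \<le> 0" "\<Upsilon> (0, s) = (x, 0)"
    by (rule planar_swap_crosses_ray[OF one lip fix_out c swap(1)])
  define h :: real where "h = (if 0 \<le> s then 1/2 else - 1/2)"
  have h: "\<bar>h\<bar> = 1/2" "\<bar>s - h\<bar> + \<bar>s\<bar> = 1/2" using s(1) by (auto simp: h_def)
  have "c $ k \<le> \<bar>(c - x) $ k\<bar>" using s(2) c by simp
  also have "\<dots> \<le> dist c x" using component_le_norm_cart[of "c - x" k] by (simp add: dist_norm)
  also have "\<dots> \<le> dist (c, 0 :: real) (x, 0)" by (rule dist_Pair_ge)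
  also have "\<dots> \<le> L * dist ((0 :: real^'m), 0 :: real) (0, s)"
    using bilipschitz_on_upper[OF lip, of "(0, 0)" "(0, s)"] s(3) swap(2) by simp
  finally have 1: "c $ k \<le> L * \<bar>s\<bar>" by (simp add: dist_Pair_Pair dist_real_def)
  have "1/2 = dist 0 h" using h by (simp add: dist_real_def)
  also have "\<dots> \<le> dist (x, 0) (0 :: real^'m, h)" by (rule dist_Pair_ge)
  also have "\<dots> \<le> L * dist ((0 :: real^'m), s) (0, h)"
    using bilipschitz_on_upper[OF lip, of "(0, s)" "(0, h)"] s(3) fix_out[of "(0, h)"] h by simp
  finally have 2: "1/2 \<le> L * \<bar>s - h\<bar>" by (simp add: dist_Pair_Pair dist_real_def)
  have "c $ k + 1/2 \<le> L * (\<bar>s - h\<bar> + \<bar>s\<bar>)" using 1 2 by (simp add: algebra_simps)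
  then show ?thesis using h(2) by simp
qed

lemma admissibleE:
  fixes \<sigma> :: "real^'m::finite \<Rightarrow> real^'m"
  assumes "admissible TYPE('m) \<psi>" "1 \<le> S" "block_perm S \<sigma>"
  obtains \<Upsilon> :: "(real^'m) \<times> real \<Rightarrow> (real^'m) \<times> real" where
    "bilipschitz_on (\<psi> (real S)) UNIV \<Upsilon>" "\<And>x. \<bar>snd x\<bar> \<ge> 1/2 \<Longrightarrow> \<Upsilon> x = x"
    "\<And>x. x \<in> int_lattice \<Longrightarrow> \<Upsilon> (x, 0) = (\<sigma> x, 0)"
proof -
  have "\<exists>\<Upsilon> :: (real^'m) \<times> real \<Rightarrow> (real^'m) \<times> real. bilipschitz_on (\<psi> (real S)) UNIV \<Upsilon> \<and>
      (\<forall>x. \<bar>snd x\<bar> \<ge> 1/2 \<longrightarrow> \<Upsilon> x = x) \<and> (\<forall>x\<in>int_lattice. \<Upsilon> (x, 0) = (\<sigma> x, 0))"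
    using assms unfolding admissible_def by simp
  then show ?thesis using that by blast
qed

text \<open>The test case is the exchange of two opposite corners of a block, with
  \<open>r = S - 1\<close>. For \<open>d \<ge> 3\<close> the diagonal has squared length at least
  \<open>2 * r^2\<close>, and moving its end off the boundary plane costs at least
  \<open>r + 1/2\<close> over a distance 1/2. For \<open>d = 2\<close> that comparison gives only
  \<open>sqrt (r^2 + 1/4)\<close>, which is too little.\<close>

lemma admissible_lower_bound:
  assumes adm: "admissible TYPE('m::finite) \<psi>" and t: "1 \<le> t"
  shows "2 * of_int \<lfloor>t\<rfloor> - 1 \<le> \<psi> t"
proof -
  define S where "S = nat \<lfloor>t\<rfloor>"
  have S: "1 \<le> S" "real S \<le> t" "real S = of_int \<lfloor>t\<rfloor>" using t by (auto simp: S_def le_nat_iff)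
  have \<psi>: "mono_on {1..} \<psi>" "1 \<le> \<psi> t" using adm t by (auto simp: admissible_def)
  show ?thesis
  proof (cases "S = 1")
    case True
    then show ?thesis using \<psi>(2) S(3) by simp
  next
    case False
    then have S2: "2 \<le> S" using S(1) by simp
    define w :: "'m \<Rightarrow> int" where "w = (\<lambda>_. int S - 1)"
    define \<sigma> where "\<sigma> = Transposition.transpose (\<lambda>_. 0) w"
    have "blk S w = blk S (\<lambda>_. 0)" using S2 by (simp add: blk_def w_def fun_eq_iff)
    then have "blk S (\<sigma> z) = blk S z" for z
      by (simp add: \<sigma>_def Transposition.transpose_def)
    moreover have "bij \<sigma>" unfolding \<sigma>_def by simp
    ultimately have perm: "block_perm S (\<lambda>x. lat (\<sigma> (inv lat x)))"
      using S(1) by (intro lattice_permutation_imp_block_perm) auto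
    obtain \<Upsilon> :: "(real^'m) \<times> real \<Rightarrow> (real^'m) \<times> real" where \<Upsilon>:
        "bilipschitz_on (\<psi> (real S)) UNIV \<Upsilon>" "\<And>x. \<bar>snd x\<bar> \<ge> 1/2 \<Longrightarrow> \<Upsilon> x = x"
        "\<And>x. x \<in> int_lattice \<Longrightarrow> \<Upsilon> (x, 0) = (lat (\<sigma> (inv lat x)), 0)"
      using admissibleE[OF adm S(1) perm] by blast
    have lat_swap: "\<Upsilon> (lat z, 0) = (lat (\<sigma> z), 0)" for z
      using \<Upsilon>(3)[of "lat z"] by (simp add: inv_f_f[OF inj_lat] flip: range_lat)
    have lat0: "lat (\<lambda>_. 0) = (0 :: real^'m)" by (simp add: vec_eq_iff)
    have sw: "\<Upsilon> (lat w, 0) = (0, 0)" "\<Upsilon> (0, 0) = (lat w, 0)"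
      using lat_swap[of w] lat_swap[of "\<lambda>_. 0"] by (simp_all add: \<sigma>_def lat0)
    have "2 * real S - 1 \<le> \<psi> (real S)"
    proof (cases "CARD('m) = 1")
      case True
      have "0 < lat w $ undefined" using S2 by (simp add: w_def)
      from planar_swap_lower_bound[OF True \<Upsilon>(1,2) this sw] show ?thesis by (simp add: w_def)
    next
      case False
      then have m2: "2 \<le> real CARD('m)" using zero_less_card_finite[where 'a='m]
        by (metis One_nat_def Suc_leI numeral_2_eq_2 le_antisym not_less_eq_eq of_nat_le_iff of_nat_numeral)
      define r where "r = real S - 1"
      have r: "1 \<le> r" using S2 by (simp add: r_def)
      have "(norm (lat w :: real^'m))\<^sup>2 = real CARD('m) * r\<^sup>2"
        by (simp add: norm_vec_def L2_set_def sum_nonneg w_def r_def)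
      then have nw: "2 * r\<^sup>2 \<le> (norm (lat w :: real^'m))\<^sup>2" using m2 by (simp add: mult_right_mono)
      have "sqrt ((norm (lat w :: real^'m))\<^sup>2 + (1/2)\<^sup>2) = dist (\<Upsilon> (0, 0)) (\<Upsilon> (0, 1/2))"
        using sw(2) \<Upsilon>(2)[of "(0, 1/2)"] by (simp add: dist_Pair_Pair dist_real_def)
      also have "\<dots> \<le> \<psi> (real S) * dist ((0 :: real^'m), 0 :: real) (0, 1/2)"
        by (rule bilipschitz_on_upper[OF \<Upsilon>(1)]) auto
      also have "\<dots> = \<psi> (real S) / 2" by (simp add: dist_Pair_Pair dist_real_def)
      finally have le: "sqrt ((norm (lat w :: real^'m))\<^sup>2 + (1/2)\<^sup>2) \<le> \<psi> (real S) / 2" .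
      have "r * 1 \<le> r * r" using r by (intro mult_left_mono) auto
      then have "(r + 1/2)\<^sup>2 \<le> (norm (lat w :: real^'m))\<^sup>2 + (1/2)\<^sup>2"
        using nw by (simp add: power2_eq_square algebra_simps)
      then have "r + 1/2 \<le> sqrt ((norm (lat w :: real^'m))\<^sup>2 + (1/2)\<^sup>2)" by (rule real_le_rsqrt)
      then show ?thesis using le by (simp add: r_def)
    qed
    also have "\<psi> (real S) \<le> \<psi> t" using \<psi>(1) by (rule mono_onD) (use S t in auto)
    finally show ?thesis using S(3) by simp
  qed
qed

section \<open>Passing to the infimum\<close>

lemma beta_bounds:
  assumes "1 \<le> t"
  shows "1 \<le> beta TYPE('m::finite) t" "2 * of_int \<lfloor>t\<rfloor> - 1 \<le> beta TYPE('m) t"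
    "beta TYPE('m) t \<le> 2 powr (8 * (real CARD('m) + 1) * t)"
proof -
  have ne: "{\<psi>. admissible TYPE('m) \<psi>} \<noteq> {}" using admissible_exponential by blast
  have ge1: "1 \<le> \<psi> t" if "admissible TYPE('m) \<psi>" for \<psi>
    using that assms by (auto simp: admissible_def)
  then have bdd: "bdd_below ((\<lambda>\<psi>. \<psi> t) ` {\<psi>. admissible TYPE('m) \<psi>})"
    by (intro bdd_belowI[of _ 1]) auto
  show "1 \<le> beta TYPE('m) t"
    unfolding beta_def using ne ge1 by (intro cINF_greatest) auto
  show "2 * of_int \<lfloor>t\<rfloor> - 1 \<le> beta TYPE('m) t"
    unfolding beta_def using ne admissible_lower_bound[OF _ assms] by (intro cINF_greatest) auto
  show "beta TYPE('m) t \<le> 2 powr (8 * (real CARD('m) + 1) * t)"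
    unfolding beta_def using admissible_exponential by (intro cINF_lower2[OF bdd, rotated]) auto
qed

lemma admissible_near_beta:
  assumes "1 \<le> t" "beta TYPE('m::finite) t < b"
  obtains \<psi> where "admissible TYPE('m) \<psi>" "\<psi> t < b"
  using cInf_lessD[of "(\<lambda>\<psi>. \<psi> t) ` {\<psi>. admissible TYPE('m) \<psi>}" b] assms(2) admissible_exponential
  unfolding beta_def by blast

lemma mono_on_beta: "mono_on {1..} (beta TYPE('m::finite))"
proof (rule mono_onI)
  fix s t :: real assume st: "s \<in> {1..}" "t \<in> {1..}" "s \<le> t"
  show "beta TYPE('m) s \<le> beta TYPE('m) t"
    unfolding beta_def
  proof (rule cINF_mono)
    show "{\<psi>. admissible TYPE('m) \<psi>} \<noteq> {}" using admissible_exponential by blast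
    show "bdd_below ((\<lambda>\<psi>. \<psi> s) ` {\<psi>. admissible TYPE('m) \<psi>})"
      using st by (intro bdd_belowI[of _ 1]) (auto simp: admissible_def)
    show "\<exists>\<phi>\<in>{\<psi>. admissible TYPE('m) \<psi>}. \<phi> s \<le> \<psi> t" if "\<psi> \<in> {\<psi>. admissible TYPE('m) \<psi>}" for \<psi>
    proof (rule bexI[OF _ that])
      have "mono_on {1..} \<psi>" using that by (simp add: admissible_def)
      then show "\<psi> s \<le> \<psi> t" using st by (rule mono_onD)
    qed
  qed
qed

section \<open>Flattening\<close>

text \<open>Stable under maximum and minimum, so a piecewise linear function written with these
  needs no case distinction over its pieces.\<close>

definition slope_between :: "real \<Rightarrow> real \<Rightarrow> (real \<Rightarrow> real) \<Rightarrow> bool" where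
  "slope_between l K k \<longleftrightarrow> (\<forall>u v. v \<le> u \<longrightarrow> l * (u - v) \<le> k u - k v \<and> k u - k v \<le> K * (u - v))"

lemma slope_betweenD:
  "slope_between l K k \<Longrightarrow> v \<le> u \<Longrightarrow> l * (u - v) \<le> k u - k v"
  "slope_between l K k \<Longrightarrow> v \<le> u \<Longrightarrow> k u - k v \<le> K * (u - v)"
  by (simp_all add: slope_between_def)

lemma slope_between_max:
  assumes "slope_between l K f" "slope_between l K g"
  shows "slope_between l K (\<lambda>u. max (f u) (g u))"
  unfolding slope_between_def
proof (intro allI impI)
  fix u v :: real assume "v \<le> u"
  then show "l * (u - v) \<le> max (f u) (g u) - max (f v) (g v) \<and>
      max (f u) (g u) - max (f v) (g v) \<le> K * (u - v)"
    using slope_betweenD[OF assms(1), of v u] slope_betweenD[OF assms(2), of v u] by linarith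
qed

lemma slope_between_min:
  assumes "slope_between l K f" "slope_between l K g"
  shows "slope_between l K (\<lambda>u. min (f u) (g u))"
  unfolding slope_between_def
proof (intro allI impI)
  fix u v :: real assume "v \<le> u"
  then show "l * (u - v) \<le> min (f u) (g u) - min (f v) (g v) \<and>
      min (f u) (g u) - min (f v) (g v) \<le> K * (u - v)"
    using slope_betweenD[OF assms(1), of v u] slope_betweenD[OF assms(2), of v u] by linarith
qed

lemma slope_between_affine:
  assumes "l \<le> c" "c \<le> K" "\<And>u. f u = c * u + b"
  shows "slope_between l K f"
  unfolding slope_between_def
proof (intro allI impI)
  fix u v :: real assume "v \<le> u"
  then have "l * (u - v) \<le> c * (u - v)" "c * (u - v) \<le> K * (u - v)"
    using assms(1,2) by (auto intro: mult_right_mono)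
  then show "l * (u - v) \<le> f u - f v \<and> f u - f v \<le> K * (u - v)"
    by (simp add: assms(3) algebra_simps)
qed

text \<open>Piecewise linear with slope \<open>l\<close> around \<open>0\<close>, slope \<open>K\<close> up to \<open>\<plusminus>h\<close> and slope \<open>1\<close> beyond.\<close>
definition squeeze :: "real \<Rightarrow> real \<Rightarrow> real \<Rightarrow> real \<Rightarrow> real" where
  "squeeze l K h u = max (min u (u + (K - 1) * (u - h))) (min (l * u) (max (u + (K - 1) * (u + h)) u))"

context
  fixes l K h :: real
  assumes l: "0 < l" "l \<le> 1" and K: "1 \<le> K" and h: "0 < h"
begin

lemma slope_between_squeeze: "slope_between l K (squeeze l K h)"
  unfolding squeeze_def
proof (intro slope_between_max slope_between_min)
  show "slope_between l K (\<lambda>u. u)" by (rule slope_between_affine[of _ 1 _ _ 0]) (use l K in auto)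
  show "slope_between l K (\<lambda>u. u + (K - 1) * (u - h))"
    by (rule slope_between_affine[of _ K _ _ "- (K - 1) * h"]) (use l K in \<open>auto simp: algebra_simps\<close>)
  show "slope_between l K (\<lambda>u. u + (K - 1) * (u + h))"
    by (rule slope_between_affine[of _ K _ _ "(K - 1) * h"]) (use l K in \<open>auto simp: algebra_simps\<close>)
  show "slope_between l K ((*) l)"
    by (rule slope_between_affine[of _ l _ _ 0]) (use l K in auto)
  show "slope_between l K (\<lambda>u. u)" by (rule slope_between_affine[of _ 1 _ _ 0]) (use l K in auto)
qed

lemma squeeze_outside:
  assumes "h \<le> \<bar>u\<bar>"
  shows "squeeze l K h u = u"
proof (cases "0 \<le> u")
  case True
  then have "h \<le> u" using assms by simp
  then have "0 \<le> (K - 1) * (u - h)" using K by simp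
  moreover have "l * u \<le> 1 * u" using l True by (intro mult_right_mono) auto
  ultimately show ?thesis by (simp add: squeeze_def)
next
  case False
  then have u: "u \<le> - h" using assms by simp
  then have "(K - 1) * (u - h) \<le> 0" "(K - 1) * (u + h) \<le> 0"
    using K h by (auto intro: mult_nonneg_nonpos)
  moreover have "1 * u \<le> l * u" using l u h by (intro mult_right_mono_neg) auto
  ultimately show ?thesis by (simp add: squeeze_def)
qed

text \<open>The line of slope \<open>K\<close> through \<open>(h, h)\<close> reaches zero at
  \<open>h - h / K\<close>; up to there the flat piece decides, and symmetrically on the negative
  side.\<close>

lemma squeeze_inside:
  assumes "\<bar>u\<bar> \<le> h - h / K"
  shows "squeeze l K h u = l * u"
proof -
  have "K * \<bar>u\<bar> \<le> K * (h - h / K)" using assms K by (intro mult_left_mono) auto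
  then have b: "K * \<bar>u\<bar> \<le> K * h - h" using K by (simp add: algebra_simps)
  show ?thesis
  proof (cases "0 \<le> u")
    case True
    then have "u + (K - 1) * (u - h) \<le> 0" using b by (simp add: algebra_simps)
    moreover have "0 \<le> l * u" using True l by simp
    moreover have "l * u \<le> 1 * u" using l True by (intro mult_right_mono) auto
    ultimately show ?thesis by (simp add: squeeze_def)
  next
    case False
    then have "0 \<le> u + (K - 1) * (u + h)" using b by (simp add: algebra_simps)
    moreover have "l * u \<le> 0" using False l by (simp add: mult_nonneg_nonpos)
    moreover have "1 * u \<le> l * u" using l False by (intro mult_right_mono_neg) auto
    ultimately show ?thesis by (simp add: squeeze_def)
  qed
qed

lemma squeeze_abs:
  "l * \<bar>u - v\<bar> \<le> \<bar>squeeze l K h u - squeeze l K h v\<bar>"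
  "\<bar>squeeze l K h u - squeeze l K h v\<bar> \<le> K * \<bar>u - v\<bar>"
proof -
  have "l * \<bar>u - v\<bar> \<le> \<bar>squeeze l K h u - squeeze l K h v\<bar> \<and>
      \<bar>squeeze l K h u - squeeze l K h v\<bar> \<le> K * \<bar>u - v\<bar>"
  proof (cases "v \<le> u")
    case True
    have "0 \<le> l * (u - v)" using True l by simp
    then show ?thesis
      using slope_betweenD[OF slope_between_squeeze True] True by simp
  next
    case False
    then have "u \<le> v" by simp
    have "0 \<le> l * (v - u)" using \<open>u \<le> v\<close> l by simp
    then show ?thesis
      using slope_betweenD[OF slope_between_squeeze \<open>u \<le> v\<close>] \<open>u \<le> v\<close> by simp
  qed
  then show "l * \<bar>u - v\<bar> \<le> \<bar>squeeze l K h u - squeeze l K h v\<bar>"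
    "\<bar>squeeze l K h u - squeeze l K h v\<bar> \<le> K * \<bar>u - v\<bar>" by auto
qed

lemma bij_squeeze: "bij (squeeze l K h)"
proof -
  have "inj (squeeze l K h)"
  proof (rule injI)
    fix u v assume "squeeze l K h u = squeeze l K h v"
    then have "l * \<bar>u - v\<bar> \<le> 0" using squeeze_abs(1)[of u v] by simp
    then show "u = v" using l by (simp add: mult_le_0_iff)
  qed
  moreover have "\<exists>u. y = squeeze l K h u" for y
  proof (cases "h \<le> \<bar>y\<bar>")
    case True
    then show ?thesis using squeeze_outside by metis
  next
    case False
    have "\<exists>u\<ge>-h. u \<le> h \<and> squeeze l K h u = y"
    proof (rule IVT')
      show "squeeze l K h (- h) \<le> y" "y \<le> squeeze l K h h"
        using False h by (simp_all add: squeeze_outside)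
      show "continuous_on {- h..h} (squeeze l K h)"
        unfolding squeeze_def by (intro continuous_intros)
    qed (use h in simp)
    then show ?thesis by blast
  qed
  ultimately show ?thesis by (simp add: bij_def surj_def)
qed

end

section \<open>From separated points to sites in one layer\<close>

lemma vertical_bilipschitz:
  fixes k :: "real \<Rightarrow> real"
  assumes B: "1 \<le> B" and up: "\<And>u v. \<bar>k u - k v\<bar> \<le> B * \<bar>u - v\<bar>" and lo: "\<And>u v. \<bar>u - v\<bar> \<le> B * \<bar>k u - k v\<bar>"
  shows "bilipschitz_on B UNIV (\<lambda>p :: 'a::metric_space \<times> real. (fst p, k (snd p)))"
proof -
  have comp: "sqrt (a\<^sup>2 + b\<^sup>2) \<le> B * sqrt (a\<^sup>2 + c\<^sup>2)" if "0 \<le> a" "0 \<le> b" "b \<le> B * c" for a b c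
  proof -
    have "a * 1 \<le> a * B" using B that by (intro mult_left_mono) auto
    then have "a\<^sup>2 \<le> (B * a)\<^sup>2" using that by (intro power_mono) (auto simp: mult.commute)
    moreover have "b\<^sup>2 \<le> (B * c)\<^sup>2" using that by (intro power_mono) auto
    ultimately have "a\<^sup>2 + b\<^sup>2 \<le> B\<^sup>2 * (a\<^sup>2 + c\<^sup>2)" by (simp add: power_mult_distrib algebra_simps)
    then have "sqrt (a\<^sup>2 + b\<^sup>2) \<le> sqrt (B\<^sup>2 * (a\<^sup>2 + c\<^sup>2))" by (rule real_sqrt_le_mono)
    then show ?thesis using B by (simp add: real_sqrt_mult)
  qed
  show ?thesis
    unfolding bilipschitz_on_iff dist_prod_def dist_real_def fst_conv snd_conv
    using B up lo by (intro conjI ballI comp) auto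
qed

text \<open>Gives each height level its own vector of digits, by mere counting; which vector it is
  does not matter.\<close>

lemma digits_exist:
  assumes "real M + 1 \<le> real N ^ CARD('m::finite)"
  obtains dig :: "nat \<Rightarrow> 'm::finite \<Rightarrow> int" where "inj_on dig {..M}"
    "\<And>k i. k \<le> M \<Longrightarrow> 0 \<le> dig k i" "\<And>k i. k \<le> M \<Longrightarrow> dig k i < int N"
proof -
  let ?B = "Pi\<^sub>E UNIV (\<lambda>i::'m. {0..<int N})"
  have "card ?B = N ^ CARD('m)" by (simp add: card_PiE)
  moreover have "M + 1 \<le> N ^ CARD('m)" using assms
    by (metis Suc_eq_plus1 of_nat_Suc of_nat_le_iff of_nat_power add.commute)
  ultimately have "card {..M} \<le> card ?B" by simp
  moreover have "finite ?B" by (rule finite_PiE) auto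
  ultimately obtain dig where "dig ` {..M} \<subseteq> ?B" "inj_on dig {..M}"
    using card_le_inj[of "{..M}" ?B] by auto
  then show ?thesis using that[of dig] by (auto simp: PiE_def Pi_def image_subset_iff)
qed

lemma norm_cart_le:
  fixes x :: "real^'m::finite"
  assumes "\<And>i. \<bar>x $ i\<bar> \<le> c"
  shows "norm x \<le> real CARD('m) * c"
  using norm_le_l1_cart[of x] sum_mono[of UNIV "\<lambda>i. \<bar>x $ i\<bar>" "\<lambda>_. c"] assms by simp

text \<open>Three steps: shift the points horizontally onto distinct sites of a fine lattice, squeeze the
  slab until all heights agree up to the lattice spacing, and finally move the points, which are
  now horizontally separated, to the middle height.\<close>
lemma flatten_points:
  fixes Y :: "((real^'m::finite) \<times> real) set" and b :: "real^'m"
  assumes H: "1 \<le> H" and r: "0 < r" "r \<le> 1/2"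
    and sep: "\<And>x y. x \<in> Y \<Longrightarrow> y \<in> Y \<Longrightarrow> x \<noteq> y \<Longrightarrow> 2 * r \<le> dist x y"
    and slab: "\<And>y. y \<in> Y \<Longrightarrow> 1/2 + r \<le> snd y" "\<And>y. y \<in> Y \<Longrightarrow> snd y \<le> H + 1/2 - r"
    and N: "1 \<le> N" "H / r + 1 \<le> real N ^ CARD('m)"
    and \<delta>: "\<delta> = r / (4 * real CARD('m) * real N)"
  obtains \<Phi> s where "bilipschitz_on (4 * H / \<delta>) UNIV \<Phi>" "bij \<Phi>"
    "\<And>x. snd x \<le> 1/2 \<or> H + 1/2 \<le> snd x \<Longrightarrow> \<Phi> x = x" "inj_on s Y"
    "\<And>y. y \<in> Y \<Longrightarrow> \<Phi> y = (b + (2 * \<delta>) *\<^sub>R lat (s y), (H + 1) / 2)"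
    "\<And>y i. y \<in> Y \<Longrightarrow> \<bar>(b + (2 * \<delta>) *\<^sub>R lat (s y)) $ i - fst y $ i\<bar> \<le> r / 2"
proof -
  define m where "m = real CARD('m)"
  have m: "1 \<le> m" using zero_less_card_finite[where 'a='m] by (simp add: m_def Suc_le_eq)
  have N1: "1 \<le> real N" using N(1) by simp
  \<comment> \<open>The side of a horizontal cell, which holds \<open>N\<close> sites of spacing
    \<open>2 * \<delta>\<close> per direction. The choice of \<delta> makes
    \<open>m * q = r / 2\<close>, a bound for the diameter of a cell.\<close>
  define q where "q = 2 * \<delta> * real N"
  have \<delta>0: "0 < \<delta>" using r m N1 by (simp add: \<delta> flip: m_def)
  have mq: "m * q = r / 2" using m N1 by (simp add: q_def \<delta> flip: m_def)
  have q0: "0 < q" using \<delta>0 N1 by (simp add: q_def)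
  have q_le: "q \<le> r / 2" using mq mult_right_mono[OF m, of q] q0 by linarith
  have \<delta>_le: "\<delta> \<le> r / 4" using q_le mult_left_mono[OF N1, of "2 * \<delta>"] \<delta>0 unfolding q_def by linarith
  define M where "M = nat \<lfloor>H / r\<rfloor>"
  have M: "real M + 1 \<le> real N ^ CARD('m)"
  proof -
    have "0 \<le> H / r" using H r by simp
    then have "real M \<le> H / r" by (simp add: M_def)
    then show ?thesis using N(2) by simp
  qed
  obtain dig :: "nat \<Rightarrow> 'm \<Rightarrow> int" where dig: "inj_on dig {..M}"
      "\<And>k i. k \<le> M \<Longrightarrow> 0 \<le> dig k i" "\<And>k i. k \<le> M \<Longrightarrow> dig k i < int N"
    using digits_exist[OF M] by blast
  define cell where "cell y i = \<lfloor>(fst y $ i - b $ i) / q\<rfloor>" for y :: "(real^'m) \<times> real" and i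
  define lev where "lev y = nat \<lfloor>(snd y - 1/2) / r\<rfloor>" for y :: "(real^'m) \<times> real"
  \<comment> \<open>In each coordinate the quotient by \<open>N\<close> records the cell and the
    remainder a digit of the height level.\<close>
  define s where "s y i = int N * cell y i + dig (lev y) i" for y i
  define site where "site y = b + (2 * \<delta>) *\<^sub>R lat (s y)" for y
  have lev_le: "lev y \<le> M" if "y \<in> Y" for y
    unfolding lev_def M_def using slab(2)[OF that] r
    by (intro nat_mono floor_mono divide_right_mono) auto
  have cell: "q * of_int (cell y i) \<le> fst y $ i - b $ i" "fst y $ i - b $ i < q * of_int (cell y i) + q" for y i
    using floor_divide_lower[OF q0, of "fst y $ i - b $ i"] floor_divide_upper[OF q0, of "fst y $ i - b $ i"]
    by (simp_all add: cell_def algebra_simps)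
  have near_site: "\<bar>site y $ i - fst y $ i\<bar> \<le> q" if "y \<in> Y" for y i
  proof -
    have d: "0 \<le> 2 * \<delta> * of_int (dig (lev y) i)" "2 * \<delta> * of_int (dig (lev y) i) \<le> q"
      using dig(2,3)[OF lev_le[OF that], of i] \<delta>0 unfolding q_def by (auto intro!: mult_left_mono)
    have "site y $ i = b $ i + q * of_int (cell y i) + 2 * \<delta> * of_int (dig (lev y) i)"
      by (simp add: site_def s_def q_def algebra_simps)
    then show ?thesis using cell[of y i] d unfolding abs_le_iff by linarith
  qed
  have site_dist: "norm (site y - fst y) \<le> r / 2" if "y \<in> Y" for y
    using norm_cart_le[of "site y - fst y" q] near_site[OF that] mq by (simp add: m_def)
  \<comment> \<open>Equal sites mean the same cell and the same level: a distance of at most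
    \<open>r / 2\<close> horizontally and below \<open>r\<close> vertically, which is less than the
    separation \<open>2 * r\<close>.\<close>
  have inj_s: "inj_on s Y"
  proof (rule inj_onI, rule ccontr)
    fix x y assume xy: "x \<in> Y" "y \<in> Y" "s x = s y" "x \<noteq> y"
    have *: "s z i div int N = cell z i" "s z i mod int N = dig (lev z) i" if "z \<in> Y" for z i
    proof -
      have d: "0 \<le> dig (lev z) i" "dig (lev z) i < int N" using dig(2,3)[OF lev_le[OF that]] by auto
      show "s z i div int N = cell z i"
        unfolding s_def using d by (intro int_div_eqI) auto
      then show "s z i mod int N = dig (lev z) i"
        using mult_div_mod_eq[of "int N" "s z i"] by (simp add: s_def)
    qed
    have "cell x i = cell y i" for i using * xy by metis
    then have "\<bar>(fst x - fst y) $ i\<bar> \<le> q" for i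
      using cell[of x i] cell[of y i] by simp
    then have 1: "dist (fst x) (fst y) \<le> r / 2"
      using norm_cart_le[of "fst x - fst y" q] mq by (simp add: m_def dist_norm)
    have "dig (lev x) = dig (lev y)" using * xy by (metis ext)
    then have "lev x = lev y" using inj_onD[OF dig(1), of "lev x" "lev y"] lev_le xy by simp
    moreover have "0 \<le> (snd x - 1/2) / r" "0 \<le> (snd y - 1/2) / r"
      using slab(1)[OF xy(1)] slab(1)[OF xy(2)] r by simp_all
    ultimately have "\<lfloor>(snd x - 1/2) / r\<rfloor> = \<lfloor>(snd y - 1/2) / r\<rfloor>"
      by (simp add: lev_def nat_eq_iff2)
    then have "\<bar>(snd x - 1/2) / r - (snd y - 1/2) / r\<bar> < 1" by linarith
    then have "\<bar>snd x - snd y\<bar> / r < 1"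
      using r by (simp flip: diff_divide_distrib)
    then have 2: "dist (snd x) (snd y) < r" using r by (simp add: dist_real_def)
    have "dist x y \<le> dist (fst x) (fst y) + dist (snd x) (snd y)"
      unfolding dist_prod_def by (rule sqrt_sum_squares_le_sum) auto
    then show False using sep[OF xy(1,2,4)] 1 2 r by simp
  qed
  have off_slab: "c \<le> dist p x" if "c \<le> \<bar>snd p - snd x\<bar>" for c and p x :: "(real^'m) \<times> real"
    using that dist_snd_le[of p x] by (simp add: dist_real_def)
  obtain f1 where f1: "bilipschitz_on 2 UNIV f1" "bij f1" "\<And>y. y \<in> Y \<Longrightarrow> f1 y = (site y, snd y)"
      "\<And>x. (\<And>p. p \<in> Y \<Longrightarrow> r \<le> dist p x) \<Longrightarrow> f1 x = x"
  proof (rule move_separated_points[OF r(1), of Y "\<lambda>y. (site y, snd y)"])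
    show "dist (site y, snd y) y \<le> r / 2" if "y \<in> Y" for y
      using site_dist[OF that] by (simp add: dist_prod_def dist_norm)
  qed (use sep in auto)
  define hs where "hs = (H + 1) / 2"
  \<comment> \<open>The inner slope compresses thickness \<open>H\<close> to \<delta>. The steep
    slope \<open>(H / 2) / r\<close> confines the compensation to a margin of width
    \<open>r\<close>, which the points of \<open>Y\<close> avoid.\<close>
  define k where "k = squeeze (\<delta> / H) (H / 2 / r) (H / 2)"
  have par: "0 < \<delta> / H" "\<delta> / H \<le> 1" "1 \<le> H / 2 / r" "0 < H / 2"
    using \<delta>0 \<delta>_le H r by (simp_all add: field_simps)
  have B: "1 \<le> H / \<delta>" "H / 2 / r \<le> H / \<delta>"
    using \<delta>0 \<delta>_le H r by (simp_all add: field_simps)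
  define f2 where "f2 p = (fst p, hs + k (snd p - hs))" for p :: "(real^'m) \<times> real"
  have f2: "bilipschitz_on (H / \<delta>) UNIV f2"
    unfolding f2_def
  proof (rule vertical_bilipschitz[OF B(1)])
    fix u v :: real
    have "\<bar>k (u - hs) - k (v - hs)\<bar> \<le> (H / 2 / r) * \<bar>(u - hs) - (v - hs)\<bar>"
      unfolding k_def by (rule squeeze_abs(2)[OF par])
    also have "\<dots> \<le> H / \<delta> * \<bar>(u - hs) - (v - hs)\<bar>" using B(2) by (rule mult_right_mono) simp
    finally show "\<bar>(hs + k (u - hs)) - (hs + k (v - hs))\<bar> \<le> H / \<delta> * \<bar>u - v\<bar>" by simp
    have "\<delta> / H * \<bar>(u - hs) - (v - hs)\<bar> \<le> \<bar>k (u - hs) - k (v - hs)\<bar>"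
      unfolding k_def by (rule squeeze_abs(1)[OF par])
    then have "H / \<delta> * (\<delta> / H * \<bar>(u - hs) - (v - hs)\<bar>) \<le> H / \<delta> * \<bar>k (u - hs) - k (v - hs)\<bar>"
      using B(1) by (intro mult_left_mono) auto
    then show "\<bar>u - v\<bar> \<le> H / \<delta> * \<bar>(hs + k (u - hs)) - (hs + k (v - hs))\<bar>"
      using \<delta>0 H by simp
  qed
  have bij_f2: "bij f2"
  proof (rule o_bij[of "\<lambda>p. (fst p, hs + inv k (snd p - hs))"])
    have "bij k" unfolding k_def by (rule bij_squeeze[OF par])
    then have "inv k (k u) = u" "k (inv k u) = u" for u
      by (simp_all add: bij_is_inj bij_is_surj inv_f_f surj_f_inv_f)
    then show "(\<lambda>p. (fst p, hs + inv k (snd p - hs))) \<circ> f2 = id"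
      "f2 \<circ> (\<lambda>p. (fst p, hs + inv k (snd p - hs))) = id"
      by (auto simp: f2_def fun_eq_iff)
  qed
  define t where "t y = hs + \<delta> / H * (snd y - hs)" for y :: "(real^'m) \<times> real"
  have f2_Y: "f2 (site y, snd y) = (site y, t y)" if "y \<in> Y" for y
  proof -
    have "\<bar>snd y - hs\<bar> \<le> H / 2 - r"
      using slab(1)[OF that] slab(2)[OF that] unfolding hs_def abs_le_iff by (simp add: field_simps)
    also have "r = (H / 2) / (H / 2 / r)" using H r by simp
    finally have "squeeze (\<delta> / H) (H / 2 / r) (H / 2) (snd y - hs) = \<delta> / H * (snd y - hs)"
      by (rule squeeze_inside[OF par])
    then show ?thesis unfolding f2_def t_def k_def by (simp only: fst_conv snd_conv)
  qed
  have t: "\<bar>t y - hs\<bar> \<le> \<delta> / 2" if "y \<in> Y" for y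
  proof -
    have "\<bar>snd y - hs\<bar> \<le> H / 2"
      using slab(1)[OF that] slab(2)[OF that] r unfolding hs_def abs_le_iff by (simp add: field_simps)
    then have "\<delta> / H * \<bar>snd y - hs\<bar> \<le> \<delta> / H * (H / 2)" using par by (intro mult_left_mono) auto
    then show ?thesis using H \<delta>0 by (simp add: t_def abs_mult)
  qed
  define P where "P = (\<lambda>y. (site y, t y)) ` Y"
  obtain f3 where f3: "bilipschitz_on 2 UNIV f3" "bij f3" "\<And>p. p \<in> P \<Longrightarrow> f3 p = (fst p, hs)"
      "\<And>x. (\<And>p. p \<in> P \<Longrightarrow> \<delta> \<le> dist p x) \<Longrightarrow> f3 x = x"
  \<comment> \<open>Distinct sites are \<open>2 * \<delta>\<close> apart and the heights are off by
    at most \<open>\<delta> / 2\<close>, just what radius \<delta> demands.\<close>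
  proof (rule move_separated_points[OF \<delta>0, of P "\<lambda>p. (fst p, hs)"])
    show "dist (fst p, hs) p \<le> \<delta> / 2" if "p \<in> P" for p
      using that t by (auto simp: P_def dist_prod_def dist_real_def abs_minus_commute)
    show "2 * \<delta> \<le> dist p p'" if p: "p \<in> P" "p' \<in> P" "p \<noteq> p'" for p p'
    proof -
      obtain y y' where y: "y \<in> Y" "p = (site y, t y)" "y' \<in> Y" "p' = (site y', t y')"
        using p by (auto simp: P_def)
      have "s y \<noteq> s y'" using y p(3) inj_s by (metis inj_onD)
      then obtain i where i: "s y i \<noteq> s y' i" by (auto simp: fun_eq_iff)
      have "1 \<le> \<bar>real_of_int (s y i) - real_of_int (s y' i)\<bar>" using i by linarith
      then have "2 * \<delta> * 1 \<le> 2 * \<delta> * \<bar>real_of_int (s y i) - real_of_int (s y' i)\<bar>"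
        using \<delta>0 by (intro mult_left_mono) auto
      also have "\<dots> = \<bar>(site y - site y') $ i\<bar>"
        using \<delta>0 by (simp add: site_def abs_mult flip: right_diff_distrib)
      also have "\<dots> \<le> dist (site y) (site y')" unfolding dist_norm by (rule component_le_norm_cart)
      also have "\<dots> \<le> dist p p'" using dist_fst_le[of p p'] y by simp
      finally show ?thesis by simp
    qed
  qed auto
  show ?thesis
  proof
    have "bilipschitz_on (2 * (H / \<delta> * 2)) UNIV (f3 \<circ> (f2 \<circ> f1))"
      by (intro bilipschitz_on_compose f1 f2 f3)
    then show "bilipschitz_on (4 * H / \<delta>) UNIV (f3 \<circ> (f2 \<circ> f1))" by simp
    show "bij (f3 \<circ> (f2 \<circ> f1))" by (intro bij_comp f1 bij_f2 f3)
    show "inj_on s Y" by (rule inj_s)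
    show "(f3 \<circ> (f2 \<circ> f1)) y = (b + (2 * \<delta>) *\<^sub>R lat (s y), (H + 1) / 2)" if "y \<in> Y" for y
    proof -
      have "f3 (site y, t y) = (site y, hs)" using f3(3)[of "(site y, t y)"] that by (simp add: P_def)
      then have "(f3 \<circ> (f2 \<circ> f1)) y = (site y, hs)" by (simp only: o_apply f1(3)[OF that] f2_Y[OF that])
      then show ?thesis by (simp only: site_def hs_def)
    qed
    show "\<bar>(b + (2 * \<delta>) *\<^sub>R lat (s y)) $ i - fst y $ i\<bar> \<le> r / 2" if "y \<in> Y" for y i
      using near_site[OF that, of i] q_le by (simp add: site_def)
    fix x :: "(real^'m) \<times> real" assume x: "snd x \<le> 1/2 \<or> H + 1/2 \<le> snd x"
    have "f1 x = x"
    proof (rule f1(4))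
      show "r \<le> dist p x" if "p \<in> Y" for p
        using slab(1)[OF that] slab(2)[OF that] x by (intro off_slab) auto
    qed
    moreover have far: "H / 2 \<le> \<bar>snd x - hs\<bar>" using x unfolding hs_def by (auto simp: field_simps)
    then have "f2 x = x"
      unfolding f2_def k_def squeeze_outside[OF par far] by simp
    moreover have "f3 x = x"
    proof (rule f3(4))
      fix p assume "p \<in> P"
      then have "\<bar>snd p - hs\<bar> \<le> \<delta> / 2" using t by (auto simp: P_def)
      then show "\<delta> \<le> dist p x" using far \<delta>_le r H by (intro off_slab) linarith
    qed
    ultimately show "(f3 \<circ> (f2 \<circ> f1)) x = x" by simp
  qed
qed

section \<open>Swapping pairs at bounded distance\<close>

lemma layer_realizable_translate:
  fixes v :: "'m::finite \<Rightarrow> int"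
  assumes "layer_realizable L \<sigma>"
  shows "layer_realizable L (\<lambda>z i. \<sigma> (\<lambda>j. z j - v j) i + v i)"
proof -
  obtain F :: "(real^'m) \<times> real \<Rightarrow> (real^'m) \<times> real" where F: "bilipschitz_on L UNIV F"
      "\<And>x. \<bar>snd x\<bar> \<ge> 1/2 \<Longrightarrow> F x = x" "\<And>z. F (lat z, 0) = (lat (\<sigma> z), 0)"
    using layer_realizableE[OF assms] by blast
  define G where "G p = F (p - (lat v, 0)) + (lat v, 0)" for p
  have "dist (G p) (G q) = dist (F (p - (lat v, 0))) (F (q - (lat v, 0)))" for p q
    by (simp add: G_def dist_norm)
  moreover have "dist p q = dist (p - (lat v, 0)) (q - (lat v, 0))" for p q :: "(real^'m) \<times> real"
    by (simp add: dist_norm)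
  ultimately have "bilipschitz_on L UNIV G"
    using F(1) unfolding bilipschitz_on_iff by (metis UNIV_I)
  moreover have "G x = x" if "\<bar>snd x\<bar> \<ge> 1/2" for x
    using F(2)[of "x - (lat v, 0)"] that by (simp add: G_def)
  moreover have "G (lat z, 0) = (lat (\<lambda>i. \<sigma> (\<lambda>j. z j - v j) i + v i), 0)" for z
  proof -
    have "(lat z, 0) - (lat v, 0) = (lat (\<lambda>j. z j - v j), 0 :: real)" by (simp add: vec_eq_iff)
    then have "G (lat z, 0) = (lat (\<sigma> (\<lambda>j. z j - v j)), 0) + (lat v, 0)"
      by (simp only: G_def F(3))
    then show ?thesis by (simp add: vec_eq_iff)
  qed
  ultimately show ?thesis unfolding layer_realizable_def by blast
qed

lemma admissible_imp_layer_realizable: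
  fixes \<sigma> :: "('m::finite \<Rightarrow> int) \<Rightarrow> 'm \<Rightarrow> int"
  assumes "admissible TYPE('m) \<psi>" "1 \<le> S" "bij \<sigma>" "\<And>z. blk S (\<sigma> z) = blk S z"
  shows "layer_realizable (\<psi> (real S)) \<sigma>"
proof -
  have perm: "block_perm S (\<lambda>x. lat (\<sigma> (inv lat x)))"
    using assms by (intro lattice_permutation_imp_block_perm) auto
  obtain \<Upsilon> :: "(real^'m) \<times> real \<Rightarrow> (real^'m) \<times> real" where \<Upsilon>:
      "bilipschitz_on (\<psi> (real S)) UNIV \<Upsilon>" "\<And>x. \<bar>snd x\<bar> \<ge> 1/2 \<Longrightarrow> \<Upsilon> x = x"
      "\<And>x. x \<in> int_lattice \<Longrightarrow> \<Upsilon> (x, 0) = (lat (\<sigma> (inv lat x)), 0)"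
    using admissibleE[OF assms(1,2) perm] by blast
  have "\<Upsilon> (lat z, 0) = (lat (\<sigma> z), 0)" for z
    using \<Upsilon>(3)[of "lat z"] by (simp add: inv_f_f[OF inj_lat] flip: range_lat)
  then show ?thesis unfolding layer_realizable_def using \<Upsilon>(1,2) by blast
qed

lemma swap_pairs_involution:
  fixes a b :: "'p \<Rightarrow> 'z"
  assumes "inj_on a P" "inj_on b P" "a ` P \<inter> b ` P = {}"
  obtains \<pi> where "\<And>x. \<pi> (\<pi> x) = x" "\<And>p. p \<in> P \<Longrightarrow> \<pi> (a p) = b p" "\<And>p. p \<in> P \<Longrightarrow> \<pi> (b p) = a p"
    "\<And>x. x \<notin> a ` P \<Longrightarrow> x \<notin> b ` P \<Longrightarrow> \<pi> x = x"
proof -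
  define \<pi> where "\<pi> x = (if x \<in> a ` P then b (the_inv_into P a x)
      else if x \<in> b ` P then a (the_inv_into P b x) else x)" for x
  have 1: "\<pi> (a p) = b p" if "p \<in> P" for p
    using that by (simp add: \<pi>_def the_inv_into_f_f[OF assms(1)])
  have 2: "\<pi> (b p) = a p" if "p \<in> P" for p
  proof -
    have "b p \<notin> a ` P" using assms(3) that by blast
    then show ?thesis using that by (simp add: \<pi>_def the_inv_into_f_f[OF assms(2)])
  qed
  have 3: "\<pi> x = x" if "x \<notin> a ` P" "x \<notin> b ` P" for x using that by (simp add: \<pi>_def)
  have "\<pi> (\<pi> x) = x" for x
    using 1 2 3 by (cases "x \<in> a ` P"; cases "x \<in> b ` P") auto
  then show ?thesis using that 1 2 3 by blast
qed

text \<open>All pairs whose first point lies in a cube of a fixed residue class mod \<open>3\<close> are swapped at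
  once: the cubes of side \<open>3 S\<close> around these cubes tile the lattice and contain both points.\<close>
lemma swap_class_realizable:
  fixes a b :: "'p \<Rightarrow> 'm::finite \<Rightarrow> int"
  assumes adm: "admissible TYPE('m) \<psi>" and S: "1 \<le> S"
    and ab: "inj_on a P" "inj_on b P" "a ` P \<inter> b ` P = {}"
    and near: "\<And>p i. p \<in> P \<Longrightarrow> \<bar>a p i - b p i\<bar> \<le> int S"
    and cls: "\<And>p i. p \<in> P \<Longrightarrow> (a p i div int S) mod 3 = c i"
  obtains \<pi> where "layer_realizable (\<psi> (real (3 * S))) \<pi>" "\<And>p. p \<in> P \<Longrightarrow> \<pi> (a p) = b p"
    "\<And>x. x \<notin> a ` P \<Longrightarrow> x \<notin> b ` P \<Longrightarrow> \<pi> x = x"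
proof -
  obtain \<pi> where \<pi>: "\<And>x. \<pi> (\<pi> x) = x" "\<And>p. p \<in> P \<Longrightarrow> \<pi> (a p) = b p" "\<And>p. p \<in> P \<Longrightarrow> \<pi> (b p) = a p"
      "\<And>x. x \<notin> a ` P \<Longrightarrow> x \<notin> b ` P \<Longrightarrow> \<pi> x = x"
    using swap_pairs_involution[OF ab] by blast
  \<comment> \<open>After this shift a cube of the class is the middle third, in every coordinate,
    of a block of side \<open>3 * S\<close>, so a partner at distance at most \<open>S\<close> stays
    in the same block.\<close>
  define v where "v i = int S * (c i - 1)" for i
  define \<sigma> where "\<sigma> x i = \<pi> (\<lambda>j. x j + v j) i - v i" for x i
  have same: "(a p i - v i) div int (3 * S) = (b p i - v i) div int (3 * S)" if "p \<in> P" for p i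
  proof -
    define k where "k = (a p i div int S) div 3"
    have "a p i div int S = 3 * k + c i"
      using cls[OF that, of i] mult_div_mod_eq[of 3 "a p i div int S"] by (simp add: k_def)
    then have "int S * (3 * k + c i) \<le> a p i" "a p i < int S * (3 * k + c i) + int S"
      using int_div_bounds[of S "a p i"] S by auto
    then have "int (3 * S) * k + int S \<le> a p i - v i" "a p i - v i < int (3 * S) * k + 2 * int S"
      by (simp_all add: v_def algebra_simps)
    moreover have "\<bar>(a p i - v i) - (b p i - v i)\<bar> \<le> int S" using near[OF that, of i] by simp
    ultimately have "(a p i - v i) div int (3 * S) = k" "(b p i - v i) div int (3 * S) = k"
      by (intro int_div_eqI; simp)+
    then show ?thesis by simp
  qed
  have "\<sigma> (\<sigma> x) = x" for x by (rule ext) (simp add: \<sigma>_def \<pi>(1))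
  then have "bij \<sigma>" by (intro o_bij[of \<sigma>]) (auto simp: fun_eq_iff)
  moreover have "blk (3 * S) (\<sigma> x) = blk (3 * S) x" for x
  proof -
    define y where "y = (\<lambda>j. x j + v j)"
    have "(\<pi> y i - v i) div int (3 * S) = (y i - v i) div int (3 * S)" for i
    proof (cases "y \<in> a ` P \<or> y \<in> b ` P")
      case True
      then show ?thesis using same \<pi>(2,3) by auto
    next
      case False
      then show ?thesis using \<pi>(4) by simp
    qed
    then show ?thesis by (simp add: blk_def \<sigma>_def y_def fun_eq_iff)
  qed
  ultimately have "layer_realizable (\<psi> (real (3 * S))) \<sigma>"
    using S by (intro admissible_imp_layer_realizable[OF adm]) auto
  from layer_realizable_translate[OF this, of v]
  have "layer_realizable (\<psi> (real (3 * S))) \<pi>" by (simp add: \<sigma>_def)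
  then show ?thesis using that \<pi>(2,4) by blast
qed

text \<open>The classes are treated one after another. As \<open>a\<close> and \<open>b\<close> are
  injective with disjoint ranges, the swap for one class touches neither a point of another class
  that has arrived at \<open>b p\<close> nor one still waiting at \<open>a p\<close>.\<close>

lemma transport_realizable:
  fixes a b :: "'p \<Rightarrow> 'm::finite \<Rightarrow> int"
  assumes adm: "admissible TYPE('m) \<psi>" and S: "1 \<le> S"
    and ab: "inj_on a P" "inj_on b P" "a ` P \<inter> b ` P = {}"
    and near: "\<And>p i. p \<in> P \<Longrightarrow> \<bar>a p i - b p i\<bar> \<le> int S"
  obtains \<pi> where "layer_realizable (\<psi> (real (3 * S)) ^ (3 ^ CARD('m))) \<pi>" "\<And>p. p \<in> P \<Longrightarrow> \<pi> (a p) = b p"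
proof -
  define cls where "cls p i = (a p i div int S) mod 3" for p i
  define C where "C = Pi\<^sub>E UNIV (\<lambda>i::'m. {0..<3::int})"
  have C: "finite C" "card C = 3 ^ CARD('m)" unfolding C_def by (simp_all add: finite_PiE card_PiE)
  have cls_C: "cls p \<in> C" for p by (auto simp: C_def cls_def)
  have "\<exists>\<pi>. layer_realizable (\<psi> (real (3 * S)) ^ card D) \<pi> \<and>
      (\<forall>p\<in>P. \<pi> (a p) = (if cls p \<in> D then b p else a p))" if "D \<subseteq> C" for D
    using finite_subset[OF that C(1)]
  proof (induction D rule: finite_induct)
    case empty
    show ?case
    proof (intro exI[of _ id] conjI)
      show "layer_realizable (\<psi> (real (3 * S)) ^ card {}) id"
        by (simp only: card.empty power_0 layer_realizable_id)
    qed simp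
  next
    case (insert c D)
    obtain \<pi> where \<pi>: "layer_realizable (\<psi> (real (3 * S)) ^ card D) \<pi>"
        "\<forall>p\<in>P. \<pi> (a p) = (if cls p \<in> D then b p else a p)"
      using insert.IH by blast
    define Pc where "Pc = {p \<in> P. cls p = c}"
    have Pc: "Pc \<subseteq> P" by (auto simp: Pc_def)
    obtain \<rho> where \<rho>: "layer_realizable (\<psi> (real (3 * S))) \<rho>" "\<And>p. p \<in> Pc \<Longrightarrow> \<rho> (a p) = b p"
        "\<And>x. x \<notin> a ` Pc \<Longrightarrow> x \<notin> b ` Pc \<Longrightarrow> \<rho> x = x"
    proof (rule swap_class_realizable[OF adm S, of a Pc b c])
      show "inj_on a Pc" "inj_on b Pc" using ab(1,2) Pc by (auto intro: inj_on_subset)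
      show "a ` Pc \<inter> b ` Pc = {}" using ab(3) Pc by blast
      show "\<bar>a p i - b p i\<bar> \<le> int S" if "p \<in> Pc" for p i using near that Pc by blast
      show "(a p i div int S) mod 3 = c i" if "p \<in> Pc" for p i
        using that by (auto simp: Pc_def cls_def)
    qed blast
    have "(\<rho> \<circ> \<pi>) (a p) = (if cls p \<in> insert c D then b p else a p)" if p: "p \<in> P" for p
    proof -
      consider "cls p = c" | "cls p \<noteq> c" "cls p \<in> D" | "cls p \<noteq> c" "cls p \<notin> D" by blast
      then show ?thesis
      proof cases
        case 1
        then show ?thesis using \<pi>(2) p \<rho>(2)[of p] insert.hyps by (simp add: Pc_def)
      next
        case 2
        have "b p \<notin> a ` Pc" using ab(3) p Pc by blast
        moreover have "b p \<notin> b ` Pc" using 2 inj_onD[OF ab(2) _ p] Pc by (auto simp: Pc_def)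
        ultimately show ?thesis using \<pi>(2) p \<rho>(3)[of "b p"] 2 by simp
      next
        case 3
        have "a p \<notin> b ` Pc" using ab(3) p Pc by blast
        moreover have "a p \<notin> a ` Pc" using 3 inj_onD[OF ab(1) _ p] Pc by (auto simp: Pc_def)
        ultimately show ?thesis using \<pi>(2) p \<rho>(3)[of "a p"] 3 by simp
      qed
    qed
    moreover have "layer_realizable (\<psi> (real (3 * S)) ^ card (insert c D)) (\<rho> \<circ> \<pi>)"
      using layer_realizable_compose[OF \<rho>(1) \<pi>(1)] insert.hyps by simp
    ultimately show ?case by blast
  qed
  from this[OF order_refl] show ?thesis using that C(2) cls_C by auto
qed

section \<open>The extension\<close>

text \<open>Conjugation by a similarity leaves bilipschitz constants unchanged, while the layer
  becomes as thin as the lattice is fine.\<close>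

lemma layer_realizable_scale:
  fixes \<sigma> :: "('m::finite \<Rightarrow> int) \<Rightarrow> 'm \<Rightarrow> int"
  assumes "layer_realizable L \<sigma>" "0 < \<delta>"
  obtains G :: "(real^'m) \<times> real \<Rightarrow> (real^'m) \<times> real" where "bilipschitz_on L UNIV G"
    "\<And>x. \<bar>snd x - h\<bar> \<ge> \<delta> / 2 \<Longrightarrow> G x = x" "\<And>z. G (\<delta> *\<^sub>R lat z, h) = (\<delta> *\<^sub>R lat (\<sigma> z), h)"
proof -
  obtain F :: "(real^'m) \<times> real \<Rightarrow> (real^'m) \<times> real" where F: "bilipschitz_on L UNIV F"
      "\<And>x. \<bar>snd x\<bar> \<ge> 1/2 \<Longrightarrow> F x = x" "\<And>z. F (lat z, 0) = (lat (\<sigma> z), 0)"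
    using layer_realizableE[OF assms(1)] by blast
  define down where "down p = (1 / \<delta>) *\<^sub>R (p - (0, h))" for p :: "(real^'m) \<times> real"
  define G where "G p = (0, h) + \<delta> *\<^sub>R F (down p)" for p
  have dG: "dist (G p) (G q) = \<delta> * dist (F (down p)) (F (down q))" for p q
    using assms(2) by (simp add: G_def dist_norm flip: scaleR_diff_right)
  have dd: "dist p q = \<delta> * dist (down p) (down q)" for p q
    using assms(2) by (simp add: down_def dist_norm flip: scaleR_diff_right)
  show ?thesis
  proof
    show "bilipschitz_on L UNIV G"
      unfolding bilipschitz_on_iff
    proof (intro conjI ballI)
      show "0 \<le> L" by (rule bilipschitz_on_nonneg[OF F(1)])
      fix p q
      have "\<delta> * dist (F (down p)) (F (down q)) \<le> \<delta> * (L * dist (down p) (down q))"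
        using assms(2) by (intro mult_left_mono bilipschitz_on_upper[OF F(1)]) auto
      then show "dist (G p) (G q) \<le> L * dist p q" by (simp add: dG dd[of p q] mult_ac)
      have "\<delta> * dist (down p) (down q) \<le> \<delta> * (L * dist (F (down p)) (F (down q)))"
        using assms(2) by (intro mult_left_mono bilipschitz_on_lower[OF F(1)]) auto
      then show "dist p q \<le> L * dist (G p) (G q)" by (simp add: dG dd[of p q] mult_ac)
    qed
    show "G x = x" if "\<bar>snd x - h\<bar> \<ge> \<delta> / 2" for x
    proof -
      have "\<bar>snd (down x)\<bar> \<ge> 1/2" using that assms(2) by (simp add: down_def field_simps)
      then show ?thesis using assms(2) by (simp add: G_def F(2)) (simp add: down_def)
    qed
    show "G (\<delta> *\<^sub>R lat z, h) = (\<delta> *\<^sub>R lat (\<sigma> z), h)" for z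
    proof -
      have "down (\<delta> *\<^sub>R lat z, h) = (lat z, 0)" using assms(2) by (simp add: down_def)
      then show ?thesis by (simp add: G_def F(3))
    qed
  qed
qed

text \<open>With \<open>b = 0\<close> and \<open>b = (\<delta>,\<dots>,\<delta>)\<close> the flattened source points occupy even and the
  flattened target points odd sites of \<open>\<delta> \<int>\<^sup>m\<close>.\<close>
lemma extension_with_parameters:
  fixes f :: "(real^'m::finite) \<times> real \<Rightarrow> (real^'m) \<times> real" and H :: nat
  assumes adm: "admissible TYPE('m) \<psi>" and H: "1 \<le> H" and L: "1 \<le> L"
    and lip: "bilipschitz_on L (UNIV \<times> {1/2, real H + 1/2} \<union> D) f"
    and D: "D = int_lattice \<times> {real k | k. k \<in> {1..H}}"
    and planes: "\<And>x. x \<in> UNIV \<times> {1/2, real H + 1/2} \<Longrightarrow> f x = x"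
    and slab: "f ` D \<subseteq> UNIV \<times> {1/2 .. real H + 1/2}"
    and N: "1 \<le> N" "2 * L * real H + 1 \<le> real N ^ CARD('m)"
    and \<delta>: "\<delta> = 1 / (8 * L * real CARD('m) * real N)"
    and S: "1 \<le> S" "2 * L * real H / \<delta> \<le> real S"
  obtains F where "\<And>x. x \<in> UNIV \<times> {1/2, real H + 1/2} \<union> D \<Longrightarrow> F x = f x"
    "bilipschitz_on ((4 * real H / \<delta>)\<^sup>2 * \<psi> (real (3 * S)) ^ (3 ^ CARD('m))) UNIV F"
proof -
  let ?A = "UNIV \<times> {1/2, real H + 1/2} \<union> D"
  define r where "r = 1 / (2 * L)"
  have r: "0 < r" "r \<le> 1/2" "L * r = 1/2" using L by (simp_all add: r_def field_simps)
  have N': "real H / r + 1 \<le> real N ^ CARD('m)" using N(2) by (simp add: r_def mult_ac)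
  have \<delta>': "\<delta> = r / (4 * real CARD('m) * real N)" by (simp add: \<delta> r_def)
  have m: "1 \<le> real CARD('m)" using zero_less_card_finite[where 'a='m] by (simp add: Suc_le_eq)
  have \<delta>0: "0 < \<delta>" using L m N(1) by (simp add: \<delta>)
  have H1: "1 \<le> real H" using H by simp
  have \<delta>_le: "\<delta> \<le> 1/8"
  proof -
    have "1 * 1 * 1 \<le> L * real CARD('m) * real N"
      using L m N(1) by (intro mult_mono) auto
    then show ?thesis unfolding \<delta> by (simp add: field_simps)
  qed
  have D_int: "snd p \<ge> 1" "snd p \<le> real H" "fst p \<in> int_lattice" if "p \<in> D" for p
    using that by (auto simp: D)
  have sepD: "1 \<le> dist p q" if pq: "p \<in> D" "q \<in> D" "p \<noteq> q" for p q
  proof (cases "fst p = fst q")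
    case True
    obtain j where j: "snd p = real j" using pq(1) by (auto simp: D)
    obtain k where k: "snd q = real k" using pq(2) by (auto simp: D)
    have "j \<noteq> k" using True j k pq(3) by (metis prod_eqI)
    with j k have "1 \<le> dist (snd p) (snd q)" by (simp add: dist_real_def)
    then show ?thesis using dist_snd_le[of p q] by linarith
  next
    case False
    then obtain i where i: "fst p $ i \<noteq> fst q $ i" by (auto simp: vec_eq_iff)
    have "fst p $ i - fst q $ i \<in> \<int>" using D_int(3) pq by (auto simp: int_lattice_def)
    then obtain z where z: "fst p $ i - fst q $ i = of_int z" by (rule Ints_cases)
    then have "1 \<le> \<bar>z\<bar>" using i by auto
    then have "1 \<le> \<bar>(fst p - fst q) $ i\<bar>" by (simp add: z flip: of_int_abs)
    also have "\<dots> \<le> dist (fst p) (fst q)" unfolding dist_norm by (rule component_le_norm_cart)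
    also have "\<dots> \<le> dist p q" by (rule dist_fst_le)
    finally show ?thesis .
  qed
  have sep_f: "2 * r \<le> dist x y" if xy: "x \<in> f ` D" "y \<in> f ` D" "x \<noteq> y" for x y
  proof -
    obtain p q where pq: "p \<in> D" "q \<in> D" "x = f p" "y = f q" using xy by auto
    then have "1 \<le> dist p q" using sepD xy by metis
    also have "\<dots> \<le> L * dist (f p) (f q)" using pq by (intro bilipschitz_on_lower[OF lip]) auto
    finally show ?thesis using pq L by (simp add: r_def field_simps)
  qed
  \<comment> \<open>The point of the plane vertically above or below \<open>f p\<close> is its own
    preimage, and \<open>p\<close> is at least 1/2 away from it.\<close>
  have plane_dist: "1/2 \<le> L * \<bar>snd (f p) - h\<bar>" if p: "p \<in> D" and h: "h \<in> {1/2, real H + 1/2}" for p h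
  proof -
    have "1/2 \<le> \<bar>snd p - h\<bar>" using D_int[OF p] h by auto
    also have "\<dots> \<le> dist p (fst (f p), h)" using dist_snd_le[of p "(fst (f p), h)"] by (simp add: dist_real_def)
    also have "\<dots> \<le> L * dist (f p) (f (fst (f p), h))"
      using p h by (intro bilipschitz_on_lower[OF lip]) auto
    also have "f (fst (f p), h) = (fst (f p), h)" using h by (intro planes) auto
    also have "dist (f p) (fst (f p), h) = \<bar>snd (f p) - h\<bar>" by (simp add: dist_prod_def dist_real_def)
    finally show ?thesis .
  qed
  have slab_f: "1/2 + r \<le> snd y" "snd y \<le> real H + 1/2 - r" if y: "y \<in> f ` D" for y
  proof -
    obtain p where p: "p \<in> D" "y = f p" using y by auto
    have "1/2 \<le> snd y" "snd y \<le> real H + 1/2" using slab y by auto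
    moreover have "r \<le> \<bar>snd y - 1/2\<bar>" "r \<le> \<bar>snd y - (real H + 1/2)\<bar>"
      using plane_dist[OF p(1), of "1/2"] plane_dist[OF p(1), of "real H + 1/2"] p(2) L
      by (simp_all add: r_def field_simps)
    ultimately show "1/2 + r \<le> snd y" "snd y \<le> real H + 1/2 - r" by linarith+
  qed
  obtain \<Phi> s where \<Phi>: "bilipschitz_on (4 * real H / \<delta>) UNIV \<Phi>" "bij \<Phi>"
    "\<And>x. snd x \<le> 1/2 \<or> real H + 1/2 \<le> snd x \<Longrightarrow> \<Phi> x = x" "inj_on s D"
    "\<And>y. y \<in> D \<Longrightarrow> \<Phi> y = (0 + (2 * \<delta>) *\<^sub>R lat (s y), (real H + 1) / 2)"
    "\<And>y i. y \<in> D \<Longrightarrow> \<bar>(0 + (2 * \<delta>) *\<^sub>R lat (s y)) $ i - fst y $ i\<bar> \<le> r / 2"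
  proof (rule flatten_points[OF H1 r(1,2) _ _ _ N(1) N' \<delta>', of D 0])
    show "2 * r \<le> dist x y" if "x \<in> D" "y \<in> D" "x \<noteq> y" for x y
      using sepD[OF that] r(2) by simp
    show "1/2 + r \<le> snd y" "snd y \<le> real H + 1/2 - r" if "y \<in> D" for y
      using D_int[OF that] r by auto
  qed blast
  obtain \<Psi> s' where \<Psi>: "bilipschitz_on (4 * real H / \<delta>) UNIV \<Psi>" "bij \<Psi>"
    "\<And>x. snd x \<le> 1/2 \<or> real H + 1/2 \<le> snd x \<Longrightarrow> \<Psi> x = x" "inj_on s' (f ` D)"
    "\<And>y. y \<in> f ` D \<Longrightarrow> \<Psi> y = ((\<chi> i. \<delta>) + (2 * \<delta>) *\<^sub>R lat (s' y), (real H + 1) / 2)"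
    "\<And>y i. y \<in> f ` D \<Longrightarrow> \<bar>((\<chi> i. \<delta>) + (2 * \<delta>) *\<^sub>R lat (s' y)) $ i - fst y $ i\<bar> \<le> r / 2"
    using flatten_points[where Y="f ` D" and b="\<chi> i. \<delta>", OF H1 r(1,2) sep_f slab_f N(1) N' \<delta>']
    by blast
  define a where "a p = (\<lambda>i. 2 * s p i)" for p
  define b where "b p = (\<lambda>i. 2 * s' (f p) i + 1)" for p
  have \<Phi>_a: "\<Phi> p = (\<delta> *\<^sub>R lat (a p), (real H + 1) / 2)" if "p \<in> D" for p
    using \<Phi>(5)[OF that] by (simp add: a_def vec_eq_iff)
  have \<Psi>_b: "\<Psi> (f p) = (\<delta> *\<^sub>R lat (b p), (real H + 1) / 2)" if "p \<in> D" for p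
    using \<Psi>(5)[of "f p"] that by (simp add: b_def vec_eq_iff algebra_simps)
  \<comment> \<open>Comparison with the fixed plane point below \<open>p\<close> bounds the
    horizontal displacement of \<open>f\<close> by \<open>L * H\<close>. The two flattenings add at
    most \<open>r\<close> together, which a second \<open>L * H\<close> absorbs.\<close>
  have near: "\<bar>a p i - b p i\<bar> \<le> int S" if p: "p \<in> D" for p i
  proof -
    have pl: "(fst p, 1/2) \<in> UNIV \<times> {1/2, real H + 1/2}" by auto
    have "\<bar>fst p $ i - fst (f p) $ i\<bar> \<le> dist (fst (f p)) (fst p)"
      using component_le_norm_cart[of "fst (f p) - fst p" i] by (simp add: dist_norm abs_minus_commute)
    also have "\<dots> \<le> dist (f p) (fst p, 1/2)" using dist_fst_le[of "f p" "(fst p, 1/2)"] by simp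
    also have "\<dots> = dist (f p) (f (fst p, 1/2))" by (simp only: planes[OF pl])
    also have "\<dots> \<le> L * dist p (fst p, 1/2)" using p by (intro bilipschitz_on_upper[OF lip]) auto
    also have "dist p (fst p, 1/2) = \<bar>snd p - 1/2\<bar>" by (simp add: dist_prod_def dist_real_def)
    also have "L * \<dots> \<le> L * real H" using D_int[OF p] L by (intro mult_left_mono) auto
    finally have 1: "\<bar>fst p $ i - fst (f p) $ i\<bar> \<le> L * real H" .
    have 2: "\<bar>\<delta> * of_int (a p i) - fst p $ i\<bar> \<le> r / 2"
      using \<Phi>(6)[OF p, of i] by (simp add: a_def mult_ac)
    have 3: "\<bar>\<delta> * of_int (b p i) - fst (f p) $ i\<bar> \<le> r / 2"
      using \<Psi>(6)[of "f p" i] p by (simp add: b_def algebra_simps)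
    have "1 * 1 \<le> L * real H" using L H1 by (intro mult_mono) auto
    then have "\<bar>\<delta> * of_int (a p i) - \<delta> * of_int (b p i)\<bar> \<le> 2 * (L * real H)"
      using 1 2 3 r(2) by linarith
    then have "\<delta> * \<bar>of_int (a p i) - of_int (b p i)\<bar> \<le> 2 * (L * real H)"
      using \<delta>0 by (simp add: abs_mult flip: right_diff_distrib)
    then have "\<bar>of_int (a p i) - of_int (b p i)\<bar> \<le> 2 * L * real H / \<delta>"
      using \<delta>0 by (simp add: field_simps)
    also have "\<dots> \<le> real S" by (rule S(2))
    finally show ?thesis by linarith
  qed
  obtain \<pi> where \<pi>: "layer_realizable (\<psi> (real (3 * S)) ^ (3 ^ CARD('m))) \<pi>" "\<And>p. p \<in> D \<Longrightarrow> \<pi> (a p) = b p"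
  proof (rule transport_realizable[OF adm S(1), of a D b])
    show "inj_on a D" using \<Phi>(4) by (auto simp: inj_on_def a_def fun_eq_iff)
    show "inj_on b D"
    proof (rule inj_onI)
      fix p q assume pq: "p \<in> D" "q \<in> D" "b p = b q"
      then have "s' (f p) = s' (f q)" by (auto simp: b_def fun_eq_iff)
      then have "f p = f q" using inj_onD[OF \<Psi>(4)] pq by blast
      then show "p = q" using lip pq unfolding bilipschitz_on_def by (auto dest: inj_onD)
    qed
    show "a ` D \<inter> b ` D = {}"
    proof -
      have False if "a p = b q" for p q
      proof -
        have "2 * s p i = 2 * s' (f q) i + 1" for i using fun_cong[OF that, of i] by (simp add: a_def b_def)
        from this[of undefined] show False by presburger
      qed
      then show ?thesis by blast
    qed
  qed (use near in blast)+
  obtain G :: "(real^'m) \<times> real \<Rightarrow> (real^'m) \<times> real" where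
    G: "bilipschitz_on (\<psi> (real (3 * S)) ^ (3 ^ CARD('m))) UNIV G"
    "\<And>x. \<bar>snd x - (real H + 1) / 2\<bar> \<ge> \<delta> / 2 \<Longrightarrow> G x = x"
    "\<And>z. G (\<delta> *\<^sub>R lat z, (real H + 1) / 2) = (\<delta> *\<^sub>R lat (\<pi> z), (real H + 1) / 2)"
    using layer_realizable_scale[OF \<pi>(1) \<delta>0] by blast
  show ?thesis
  proof
    \<comment> \<open>Flatten the source, match the sites, and undo the flattening of the target;
      near the two planes all three maps are the identity.\<close>
    have "bilipschitz_on ((4 * real H / \<delta>) * (\<psi> (real (3 * S)) ^ (3 ^ CARD('m)) * (4 * real H / \<delta>))) UNIV
        (inv \<Psi> \<circ> (G \<circ> \<Phi>))"
      by (intro bilipschitz_on_compose bilipschitz_on_inv \<Psi>(1,2) G(1) \<Phi>(1))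
    then show "bilipschitz_on ((4 * real H / \<delta>)\<^sup>2 * \<psi> (real (3 * S)) ^ (3 ^ CARD('m))) UNIV (inv \<Psi> \<circ> (G \<circ> \<Phi>))"
      by (simp only: power2_eq_square mult_ac)
    fix x assume "x \<in> ?A"
    then consider "x \<in> UNIV \<times> {1/2, real H + 1/2}" | "x \<in> D" by blast
    then show "(inv \<Psi> \<circ> (G \<circ> \<Phi>)) x = f x"
    proof cases
      case 1
      then have sx: "snd x \<le> 1/2 \<or> real H + 1/2 \<le> snd x" by auto
      then have "\<delta> / 2 \<le> \<bar>snd x - (real H + 1) / 2\<bar>" using \<delta>_le H1 by (auto simp: field_simps)
      then have "G (\<Phi> x) = x" using \<Phi>(3)[OF sx] G(2) by simp
      moreover have "inv \<Psi> x = x" using \<Psi>(2) \<Psi>(3)[OF sx] by (metis bij_inv_eq_iff)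
      ultimately show ?thesis using planes[OF 1] by simp
    next
      case 2
      then have "G (\<Phi> x) = \<Psi> (f x)" by (simp only: \<Phi>_a \<Psi>_b G(3) \<pi>(2))
      then show ?thesis using \<Psi>(2) by (simp add: bij_is_inj inv_f_f)
    qed
  qed
qed

section \<open>Choice of the numerical parameters\<close>

lemma lattice_parameters:
  fixes H :: nat
  assumes H: "1 \<le> H" and L: "1 \<le> L" and m: "1 \<le> m"
  obtains N S :: nat and \<delta> where "1 \<le> N" "2 * L * real H + 1 \<le> real N ^ m"
    "\<delta> = 1 / (8 * L * real m * real N)" "1 \<le> S" "2 * L * real H / \<delta> \<le> real S" "0 < \<delta>"
    "1 / \<delta> \<le> 64 * L\<^sup>2 * real m * real H powr (1 / real m)"
    "real (3 * S) \<le> 576 * L ^ 3 * real m * real H powr (1 + 1 / real m)"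
proof -
  have H1: "1 \<le> real H" using H by simp
  define e where "e = 1 / real m"
  have e: "0 < e" "e \<le> 1" using m by (simp_all add: e_def)
  have LH: "1 * 1 \<le> L * real H" using L H1 by (intro mult_mono) auto
  \<comment> \<open>\<open>4 * L * H\<close> dominates \<open>2 * L * H + 1\<close>, and its root
    splits as a product. Bounding the root of \<open>4 * L\<close> by \<open>4 * L\<close> itself
    costs only powers of \<open>L\<close>.\<close>
  define x where "x = (4 * L * real H) powr e"
  have x1: "1 \<le> x" unfolding x_def using LH e by (intro ge_one_powr_ge_zero) auto
  have x_le: "x \<le> 4 * L * real H powr e"
  proof -
    have "x = (4 * L) powr e * real H powr e" using L H1 by (simp add: x_def powr_mult)
    also have "(4 * L) powr e \<le> (4 * L) powr 1" using L e by (intro powr_mono) auto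
    finally show ?thesis using L by (simp add: mult_right_mono)
  qed
  define N where "N = nat \<lceil>x\<rceil>"
  have N: "x \<le> real N" "real N \<le> x + 1" using x1 by (simp_all add: N_def)
  have N1: "1 \<le> real N" using N(1) x1 by simp
  have N8: "real N \<le> 8 * L * real H powr e" using N(2) x1 x_le by linarith
  have "4 * L * real H = x ^ m"
  proof -
    have "x ^ m = x powr real m" using x1 by (simp add: powr_realpow)
    also have "\<dots> = 4 * L * real H" unfolding x_def using L H1 m by (simp add: powr_powr e_def)
    finally show ?thesis by simp
  qed
  also have "\<dots> \<le> real N ^ m" using N(1) x1 by (intro power_mono) auto
  finally have Nm: "2 * L * real H + 1 \<le> real N ^ m" using LH by linarith
  define \<delta> where "\<delta> = 1 / (8 * L * real m * real N)"
  have inv: "1 / \<delta> = 8 * L * real m * real N" by (simp add: \<delta>_def)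
  have \<delta>0: "0 < \<delta>" using L m N1 by (simp add: \<delta>_def)
  have E: "1 / \<delta> \<le> 64 * L\<^sup>2 * real m * real H powr e"
  proof -
    have "8 * L * real m * real N \<le> 8 * L * real m * (8 * L * real H powr e)"
      using N8 L by (intro mult_left_mono) auto
    then show ?thesis unfolding inv by (simp add: power2_eq_square mult_ac)
  qed
  define S where "S = nat \<lceil>2 * L * real H / \<delta>\<rceil>"
  have d8: "8 \<le> 1 / \<delta>"
  proof -
    have "1 * 1 * 1 \<le> L * real m * real N" using L m N1 by (intro mult_mono) auto
    then show ?thesis unfolding inv by simp
  qed
  have LHd: "1 \<le> L * real H / \<delta>"
    using mult_mono[OF LH, of 1 "1 / \<delta>"] d8 LH by simp
  have S: "2 * L * real H / \<delta> \<le> real S" "real S \<le> 2 * L * real H / \<delta> + 1"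
    using LHd by (simp_all add: S_def)
  \<comment> \<open>Rounding up adds at most 1, which is at most
    \<open>L * H / \<delta>\<close>.\<close>
  have "real (3 * S) \<le> 9 * (L * real H) * (1 / \<delta>)" using S(2) LHd by simp
  also have "\<dots> \<le> 9 * (L * real H) * (64 * L\<^sup>2 * real m * real H powr e)"
    using E LH by (intro mult_left_mono) auto
  also have "\<dots> = 576 * L ^ 3 * real m * real H powr (1 + e)"
    using H1 by (simp add: powr_add power2_eq_square power3_eq_cube mult_ac)
  finally have S3: "real (3 * S) \<le> 576 * L ^ 3 * real m * real H powr (1 + e)" .
  show ?thesis
    using that[of N \<delta> S] N1 Nm \<delta>_def S(1) LHd \<delta>0 E S3 by (simp add: e_def)
qed

theorem theorem6p1:
  fixes d :: nat
  defines "d \<equiv> CARD('m::finite) + 1"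
  shows "mono_on {1..} (beta TYPE('m)) \<and>
    (\<forall>t\<ge>1. 1 \<le> beta TYPE('m) t \<and> 2 * of_int \<lfloor>t\<rfloor> - 1 \<le> beta TYPE('m) t
            \<and> beta TYPE('m) t \<le> 2 powr (8 * real d * t)) \<and>
    (\<forall>(H::nat) (L::real) (f :: (real^'m) \<times> real \<Rightarrow> (real^'m) \<times> real).
       H \<ge> 1 \<longrightarrow> L \<ge> 1 \<longrightarrow>
       (let A = (UNIV \<times> {1/2, real H + 1/2}) \<union> (int_lattice \<times> {real k | k. k \<in> {1..H}}) in
         bilipschitz_on L A f \<longrightarrow>
         (\<forall>x \<in> UNIV \<times> {1/2, real H + 1/2}. f x = x) \<longrightarrow>
         f ` (int_lattice \<times> {real k | k. k \<in> {1..H}}) \<subseteq> UNIV \<times> {1/2 .. real H + 1/2} \<longrightarrow>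
         (\<exists>F :: (real^'m) \<times> real \<Rightarrow> (real^'m) \<times> real.
            (\<forall>x\<in>A. F x = f x) \<and>
            bilipschitz_on
              (2^38 * real d powr (9/2) * L^9 * real H powr (2 + 3 / (real d - 1)) *
               beta TYPE('m) (2^42 * real d powr (9/2) * L^10 * real H powr (3 + 3 / (real d - 1)))
                 ^ (3 ^ (d - 1)))
              UNIV F)))"
proof (intro conjI allI impI)
  show "mono_on {1..} (beta TYPE('m))" by (rule mono_on_beta)
  fix t :: real assume t: "1 \<le> t"
  show "1 \<le> beta TYPE('m) t" "2 * of_int \<lfloor>t\<rfloor> - 1 \<le> beta TYPE('m) t"
    "beta TYPE('m) t \<le> 2 powr (8 * real d * t)"
    using beta_bounds[OF t, where 'm='m] by (simp_all add: d_def add.commute)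
next
  fix H :: nat and L :: real and f :: "(real^'m) \<times> real \<Rightarrow> (real^'m) \<times> real"
  assume H: "1 \<le> H" and L: "1 \<le> L"
  define D :: "((real^'m) \<times> real) set" where "D = int_lattice \<times> {real k | k. k \<in> {1..H}}"
  define m where "m = CARD('m)"
  have m: "1 \<le> m" using zero_less_card_finite[where 'a='m] by (simp add: m_def Suc_le_eq)
  have d: "real d - 1 = real m" "d - 1 = m" "real m \<le> real d" "1 \<le> real d"
    by (simp_all add: d_def m_def)
  have H1: "1 \<le> real H" using H by simp
  define T where "T = 2^42 * real d powr (9/2) * L^10 * real H powr (3 + 3 / real m)"
  obtain N S :: nat and \<delta> where par: "1 \<le> N" "2 * L * real H + 1 \<le> real N ^ m"
      "\<delta> = 1 / (8 * L * real m * real N)" "1 \<le> S" "2 * L * real H / \<delta> \<le> real S" "0 < \<delta>"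
      "1 / \<delta> \<le> 64 * L\<^sup>2 * real m * real H powr (1 / real m)"
      "real (3 * S) \<le> 576 * L ^ 3 * real m * real H powr (1 + 1 / real m)"
    using lattice_parameters[OF H L m] by blast
  have dpow: "real m ^ 2 \<le> real d powr (9/2)" "real m \<le> real d powr (9/2)"
  proof -
    have "real m ^ 2 \<le> real d ^ 2" using d by (intro power_mono) auto
    also have "\<dots> = real d powr 2" using d(4) by (simp add: powr_numeral)
    also have "\<dots> \<le> real d powr (9/2)" using d(4) by (intro powr_mono) auto
    finally show "real m ^ 2 \<le> real d powr (9/2)" .
    have "real m \<le> real d powr 1" using d by simp
    also have "\<dots> \<le> real d powr (9/2)" using d(4) by (intro powr_mono) auto
    finally show "real m \<le> real d powr (9/2)" .
  qed
  have "576 * L ^ 3 * real m * real H powr (1 + 1 / real m) \<le> T"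
  proof -
    have "576 * (L ^ 3 * real m * real H powr (1 + 1 / real m))
        \<le> 2^42 * (L ^ 10 * real d powr (9/2) * real H powr (3 + 3 / real m))"
    proof (intro mult_mono)
      show "L ^ 3 \<le> L ^ 10" using L by (intro power_increasing) auto
      show "real m \<le> real d powr (9/2)" by (rule dpow(2))
      show "real H powr (1 + 1 / real m) \<le> real H powr (3 + 3 / real m)"
        using H1 by (intro powr_mono add_mono divide_right_mono) auto
    qed (use L in auto)
    then show ?thesis by (simp add: T_def mult_ac)
  qed
  with par(8) have ST: "real (3 * S) \<le> T" by linarith
  have T1: "1 \<le> T" using ST par(4) by simp
  define n :: nat where "n = 3 ^ m"
  have n: "0 < n" by (simp add: n_def)
  define \<beta> where "\<beta> = beta TYPE('m) T"
  have \<beta>: "1 \<le> \<beta>" unfolding \<beta>_def by (rule beta_bounds(1)[OF T1])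
  \<comment> \<open>Approximating \<open>beta\<close> at \<open>T\<close> within the
    \<open>n\<close>-th root of 2 limits the loss in the \<open>n\<close>-th power to the factor
    2.\<close>
  have root2: "1 < root n 2" "root n 2 ^ n = 2" using n by (simp_all add: real_root_pow_pos2)
  have "\<beta> * 1 < \<beta> * root n 2" using \<beta> root2(1) by (intro mult_strict_left_mono) auto
  then have "beta TYPE('m) T < \<beta> * root n 2" by (simp add: \<beta>_def)
  \<comment> \<open>The infimum defining \<open>beta\<close> need not be attained; the factor \<open>2\<close> lost here is absorbed by \<open>2^38\<close>.\<close>
  then obtain \<psi> where \<psi>: "admissible TYPE('m) \<psi>" "\<psi> T < \<beta> * root n 2"
    using admissible_near_beta[OF T1] by blast
  have "mono_on {1..} \<psi>" and range_\<psi>: "\<psi> ` {1..} \<subseteq> {1..}"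
    using \<psi>(1) by (simp_all add: admissible_def)
  have S1: "1 \<le> real (3 * S)" using par(4) by simp
  then have "\<psi> (real (3 * S)) \<in> {1..}" using range_\<psi> by blast
  moreover have "\<psi> (real (3 * S)) \<le> \<psi> T"
    using \<open>mono_on {1..} \<psi>\<close> by (rule mono_onD) (use S1 ST T1 in auto)
  ultimately have \<psi>S: "1 \<le> \<psi> (real (3 * S))" "\<psi> (real (3 * S)) \<le> \<psi> T" by simp_all
  have "\<psi> (real (3 * S)) ^ n \<le> (\<beta> * root n 2) ^ n"
    using \<psi>S \<psi>(2) by (intro power_mono) auto
  then have \<psi>n: "\<psi> (real (3 * S)) ^ n \<le> 2 * \<beta> ^ n" by (simp add: power_mult_distrib root2(2))
  have "(4 * real H / \<delta>)\<^sup>2 * \<psi> (real (3 * S)) ^ n \<le>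
      (4 * real H * (64 * L\<^sup>2 * real m * real H powr (1 / real m)))\<^sup>2 * (2 * \<beta> ^ n)"
  proof (intro mult_mono power_mono)
    have "4 * real H * (1 / \<delta>) \<le> 4 * real H * (64 * L\<^sup>2 * real m * real H powr (1 / real m))"
      using par(7) by (intro mult_left_mono) auto
    then show "4 * real H / \<delta> \<le> 4 * real H * (64 * L\<^sup>2 * real m * real H powr (1 / real m))" by simp
  qed (use \<psi>n \<psi>S par(6) \<beta> in auto)
  \<comment> \<open>The constant is \<open>(4 * 64)^2 * 2\<close>.\<close>
  also have "(4 * real H * (64 * L\<^sup>2 * real m * real H powr (1 / real m)))\<^sup>2 * (2 * \<beta> ^ n)
      = 2 ^ 17 * (real m ^ 2 * L ^ 4 * real H powr (2 + 2 / real m) * \<beta> ^ n)"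
  proof -
    have "(real H powr (1 / real m))\<^sup>2 * (real H)\<^sup>2 = real H powr (2 + 2 / real m)"
    proof -
      have "(real H powr (1 / real m))\<^sup>2 = real H powr (2 / real m)" using H1 by (simp add: powr_power)
      moreover have "(real H)\<^sup>2 = real H powr 2" using H1 by (simp add: powr_numeral)
      ultimately show ?thesis by (simp only: powr_add mult.commute)
    qed
    then show ?thesis by (simp add: power_mult_distrib mult_ac flip: power_mult)
  qed
  \<comment> \<open>The estimate reached so far is stronger than the stated one; since all bases are
    at least 1, raising the exponents is harmless.\<close>
  also have "\<dots> \<le> 2 ^ 38 * (real d powr (9/2) * L ^ 9 * real H powr (2 + 3 / real m) * \<beta> ^ n)"
  proof (intro mult_mono)
    show "real m ^ 2 \<le> real d powr (9/2)" by (rule dpow(1))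
    show "L ^ 4 \<le> L ^ 9" using L by (intro power_increasing) auto
    show "real H powr (2 + 2 / real m) \<le> real H powr (2 + 3 / real m)"
      using H1 by (intro powr_mono add_mono divide_right_mono) auto
  qed (use L \<beta> in auto)
  finally have bound: "(4 * real H / \<delta>)\<^sup>2 * \<psi> (real (3 * S)) ^ n
      \<le> 2 ^ 38 * real d powr (9/2) * L ^ 9 * real H powr (2 + 3 / real m) * \<beta> ^ n"
    by (simp add: mult_ac)
  show "let A = (UNIV \<times> {1/2, real H + 1/2}) \<union> (int_lattice \<times> {real k | k. k \<in> {1..H}}) in
         bilipschitz_on L A f \<longrightarrow>
         (\<forall>x \<in> UNIV \<times> {1/2, real H + 1/2}. f x = x) \<longrightarrow>
         f ` (int_lattice \<times> {real k | k. k \<in> {1..H}}) \<subseteq> UNIV \<times> {1/2 .. real H + 1/2} \<longrightarrow>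
         (\<exists>F :: (real^'m) \<times> real \<Rightarrow> (real^'m) \<times> real.
            (\<forall>x\<in>A. F x = f x) \<and>
            bilipschitz_on
              (2^38 * real d powr (9/2) * L^9 * real H powr (2 + 3 / (real d - 1)) *
               beta TYPE('m) (2^42 * real d powr (9/2) * L^10 * real H powr (3 + 3 / (real d - 1)))
                 ^ (3 ^ (d - 1)))
              UNIV F)"
    unfolding Let_def D_def[symmetric] d T_def[symmetric] \<beta>_def[symmetric] n_def[symmetric]
  proof (intro impI)
    assume lip: "bilipschitz_on L (UNIV \<times> {1/2, real H + 1/2} \<union> D) f"
      and planes: "\<forall>x \<in> UNIV \<times> {1/2, real H + 1/2}. f x = x"
      and slab: "f ` D \<subseteq> UNIV \<times> {1/2 .. real H + 1/2}"
    obtain F where F: "\<And>x. x \<in> UNIV \<times> {1/2, real H + 1/2} \<union> D \<Longrightarrow> F x = f x"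
        "bilipschitz_on ((4 * real H / \<delta>)\<^sup>2 * \<psi> (real (3 * S)) ^ (3 ^ CARD('m))) UNIV F"
      using extension_with_parameters[OF \<psi>(1) H L lip D_def _ slab par(1)
          par(2)[unfolded m_def] par(3)[unfolded m_def] par(4,5)] planes by blast
    have "bilipschitz_on (2 ^ 38 * real d powr (9/2) * L ^ 9 * real H powr (2 + 3 / real m) * \<beta> ^ n) UNIV F"
      using bilipschitz_on_mono[OF F(2)] bound by (simp add: n_def m_def)
    then show "\<exists>F. (\<forall>x\<in>UNIV \<times> {1/2, real H + 1/2} \<union> D. F x = f x) \<and>
        bilipschitz_on (2 ^ 38 * real d powr (9/2) * L ^ 9 * real H powr (2 + 3 / real m) * \<beta> ^ n) UNIV F"
      using F(1) by blast
  qed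
qed

end
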